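(* Let $H\in(0,1)$ and let $B=\{B_t: t\ge 0\}$ be a real-valued fractional Brownian motion of Hurst index $H$ with continuous sample paths. For $x\in\mathbb{R}$ let $\mathcal{L}_x=\{t\ge 0: B_t=x\}$. Then $$\mathbb{P}\big(\forall x\in\mathbb{R}:\ \mathrm{Dim}_H\,\mathcal{L}_x = 1-H\big)=1,$$ where $\mathrm{Dim}_H$ denotes the macroscopic Hausdorff dimension.
   Context: A fractional Brownian motion of Hurst index $H\in(0,1)$ is a centered real Gaussian process with covariance $\mathbb{E}(B_sB_t)=\frac12(|s|^{2H}+|t|^{2H}-|s-t|^{2H})$. Macroscopic Hausdorff dimension: let $S_{-1}=[0,1/2)$ and $S_n=[2^{n-1},2^n)$ for $n\ge 0$. For $E\subset\mathbb{R}_+$ and $n\ge -1$, let $\mathcal{I}_n(E)$ be the set of finite families $\{I_i\}_{i=1}^m$ of intervals $I_i=[x_i,y_i]$ with $x_i,y_i\in\mathbb{N}$, $y_i>x_i$, $I_i\subset S_n$, and $E\cap S_n\subset\bigcup_i I_i$. For $\rho\ge 0$ put $\nu^n_\rho(E)=\inf\{\sum_{i=1}^m (\mathrm{diam}(I_i)/2^n)^\rho : \{I_i\}\in\mathcal{I}_n(E)\}$, where $\mathrm{diam}([a,b])=b-a$. Then $\mathrm{Dim}_H E=\inf\{\rho>0: \sum_{n\ge -1}\nu^n_\rho(E)<\infty\}$.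
   Formalization: Covering intervals I_i may lie in the closure of S_n rather than in S_n, and Dim_H uses convergence of a tail of the sum over n rather than the sum from n=-1 (literally the dimension of L_0 is inf of the empty set); probability one means outside a null set. *)

theory Defs
  imports "HOL-Probability.Probability"
begin

definition centered_gaussian_rv :: "'a measure \<Rightarrow> ('a \<Rightarrow> real) \<Rightarrow> bool" where
  "centered_gaussian_rv M X \<longleftrightarrow> X \<in> borel_measurable M \<and>
     ((AE \<omega> in M. X \<omega> = 0) \<or> (\<exists>\<sigma>>0. distributed M lborel X (normal_density 0 \<sigma>)))"

definition fbm :: "'a measure \<Rightarrow> real \<Rightarrow> (real \<Rightarrow> 'a \<Rightarrow> real) \<Rightarrow> bool" where
  "fbm M H B \<longleftrightarrow> prob_space M \<and>
     (\<forall>t\<ge>0. B t \<in> borel_measurable M) \<and>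
     (\<forall>T c. finite T \<and> T \<subseteq> {0..} \<longrightarrow>
        centered_gaussian_rv M (\<lambda>\<omega>. \<Sum>t\<in>T. c t * B t \<omega>)) \<and>
     (\<forall>s\<ge>0. \<forall>t\<ge>0. (\<integral>\<omega>. B s \<omega> * B t \<omega> \<partial>M) =
        (\<bar>s\<bar> powr (2*H) + \<bar>t\<bar> powr (2*H) - \<bar>s - t\<bar> powr (2*H)) / 2)"

definition shell :: "int \<Rightarrow> real set" where
  "shell n = {2 powr (real_of_int n - 1) ..< 2 powr (real_of_int n)}"

definition admissible_covers :: "int \<Rightarrow> real set \<Rightarrow> (nat \<times> nat) set set" where
  "admissible_covers n E = {F. finite F \<and>
      (\<forall>(x,y)\<in>F. x < y \<and> {real x .. real y} \<subseteq> closure (shell n)) \<and>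
      E \<inter> shell n \<subseteq> (\<Union>(x,y)\<in>F. {real x .. real y})}"

definition nu :: "int \<Rightarrow> real \<Rightarrow> real set \<Rightarrow> ennreal" where
  "nu n \<rho> E = (INF F\<in>admissible_covers n E.
      \<Sum>(x,y)\<in>F. ennreal (((real y - real x) / 2 powr (real_of_int n)) powr \<rho>))"

definition macro_dimH :: "real set \<Rightarrow> real" where
  "macro_dimH E = Inf {\<rho>. \<rho> > 0 \<and> (\<exists>N::nat. (\<Sum>k. nu (int (k + N)) \<rho> E) < \<top>)}"

end

theory Submission
  imports Defs "HOL-Real_Asymp.Real_Asymp"
begin

text \<open>
  Upper bound. By dyadic chaining the path oscillates by at most \<open>k powr \<epsilon>\<close> on \<open>[k, k+1]\<close> for all
  large \<open>k\<close>. Hence every level set is covered in the \<open>n\<close>-th shell by the unit intervals with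
  \<open>B k\<close> of order at most \<open>2 powr (n * \<epsilon>)\<close>, and on average there are about \<open>2 powr (n * (1 - H + \<epsilon>))\<close> of them.

  Lower bound. Local times are avoided: for a fixed \<open>L\<close>, give the integer \<open>k\<close> a weight that is positive only if the
  path passes from below \<open>-L\<close> to above \<open>L\<close> during \<open>[k, k+1]\<close>. The same weights then serve all levels in
  \<open>[-L, L]\<close> at once. If \<open>Y\<close> is the normalized mass and \<open>E\<close> the normalized Riesz energy of the
  weights in a shell, the Cauchy-Schwarz inequality bounds the covering sum from below by a multiple of \<open>Y\<^sup>2 / E\<close>.
  The mass has mean bounded below, the energy has bounded mean for exponents less than \<open>1 - H\<close>, and the masses
  of distant shells are asymptotically uncorrelated. So over \<open>N\<close> well separated shells the masses sum to order
  \<open>N\<close> and the energies to at most order \<open>N\<close>, with probability close to one, and by Cauchy-Schwarz again the sum of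
  \<open>Y\<^sup>2 / E\<close> diverges almost surely.
\<close>

section \<open>The tent function as a characteristic function\<close>

text \<open>The obstacle is dependence. Distinct increments are in general correlated, and the mean
  of the weight at time \<open>k\<close> is only of order \<open>k powr (- H)\<close>. A
  decorrelation estimate is therefore useful only if its error is small relative to a product of
  such small means. Tents in place of indicators achieve this. A tent is the characteristic function
  of the Fejer law, whose density is bounded. Correlations of size \<eta> between finitely many
  increments then change the mean of a product of tents by at most a multiple of \<eta> times the
  product of the reciprocal standard deviations, which is the order of the main term itself. This
  one estimate yields the lower bound for the mean mass, the upper bound for the mean energy and the
  decay of covariances between shells. Small correlations have two sources: an increment that is
  short compared with the time at which it starts is almost uncorrelated with the value there, and
  distant shells are almost uncorrelated.\<close>

definition tent :: "real \<Rightarrow> real" where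
  "tent u = max 0 (1 - \<bar>u\<bar>)"

text \<open>The probability density whose characteristic function is the tent. At
  \<open>p = 0\<close> division by zero gives 0 instead of the limit \<open>1 / (2 * pi)\<close>,
  which concerns only a null set.\<close>

definition fejer :: "real \<Rightarrow> real" where
  "fejer p = (1 - cos p) / (pi * p\<^sup>2)"

lemma tent_nonneg: "0 \<le> tent u" and tent_le_1: "tent u \<le> 1"
  by (auto simp: tent_def)

lemma isCont_tent: "isCont tent x"
  unfolding tent_def by (intro continuous_intros)

lemma tent_measurable [measurable]: "tent \<in> borel_measurable borel"
  unfolding tent_def by measurable

lemma fejer_measurable [measurable]: "fejer \<in> borel_measurable borel"
  unfolding fejer_def by measurable

lemma fejer_nonneg: "0 \<le> fejer p"
  by (simp add: fejer_def)


lemma one_minus_cos_le: "1 - cos p \<le> p\<^sup>2 / (2::real)"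
proof -
  have "1 - cos p = 2 * (sin (p / 2))\<^sup>2"
    using cos_double_sin[of "p / 2"] by simp
  also have "(sin (p / 2))\<^sup>2 \<le> (p / 2)\<^sup>2"
    using abs_sin_x_le_abs_x[of "p / 2"] abs_le_square_iff by blast
  finally show ?thesis by (simp add: power_divide)
qed

text \<open>Boundedness of the density lets Lebesgue measure replace the Fejer law in Gaussian
  integrals; the factors \<open>1 / s\<close> of the decoupling estimate come from here.\<close>

lemma fejer_le: "fejer p \<le> 1 / (2 * pi)"
proof (cases "p = 0")
  case False
  then show ?thesis
    using one_minus_cos_le[of p] by (simp add: fejer_def divide_simps)
qed (simp add: fejer_def)

lemma fejer_le': "fejer p \<le> (5/2) * inverse (1 + p\<^sup>2)"
proof (cases "p = 0")
  case False
  have "(1 - cos p) * (1 + p\<^sup>2) = (1 - cos p) + (1 - cos p) * p\<^sup>2" by (simp add: algebra_simps)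
  also have "\<dots> \<le> p\<^sup>2 / 2 + 2 * p\<^sup>2"
    using one_minus_cos_le[of p] cos_ge_minus_one[of p]
    by (intro add_mono mult_right_mono) auto
  finally have *: "(1 - cos p) * (1 + p\<^sup>2) \<le> 5/2 * p\<^sup>2" by simp
  have "fejer p \<le> (1 - cos p) / p\<^sup>2"
    unfolding fejer_def using False pi_ge_two
    by (intro divide_left_mono) (auto simp: mult_le_cancel_right1)
  also have "\<dots> \<le> (5/2) * inverse (1 + p\<^sup>2)"
  proof -
    have "0 < 1 + p\<^sup>2" by (simp add: add_pos_nonneg)
    then show ?thesis using * False by (simp add: field_simps)
  qed
  finally show ?thesis .
qed (simp add: fejer_def)

lemma integrable_inverse_1_plus_square': "integrable lborel (\<lambda>x::real. inverse (1 + x\<^sup>2))"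
  using integrable_inverse_1_plus_square
  by (simp add: set_integrable_def einterval_def)

lemma fejer_integrable: "integrable lborel fejer"
  by (rule Bochner_Integration.integrable_bound[OF
        integrable_mult_right[OF integrable_inverse_1_plus_square', of "5/2"]])
     (use fejer_nonneg fejer_le' in \<open>auto simp: field_simps intro!: AE_I2\<close>)

lemma tent_integrable: "integrable lborel tent"
proof -
  have "integrable lborel (\<lambda>x. indicator {-1..1} x *\<^sub>R tent x)"
    by (rule borel_integrable_compact) (auto intro!: continuous_at_imp_continuous_on isCont_tent)
  also have "(\<lambda>x. indicator {-1..1} x *\<^sub>R tent x) = tent"
    by (auto simp: tent_def indicator_def fun_eq_iff)
  finally show ?thesis .
qed

text \<open>This direction of the Fourier pair is elementary: \<open>F\<close> and \<open>G\<close>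
  are the antiderivatives found by parts on the two linear pieces. The other direction is deduced
  from it by inversion.\<close>

lemma integral_tent_iexp:
  assumes "p \<noteq> 0"
  shows "(\<integral>y. complex_of_real (tent y) * iexp (- (p * y)) \<partial>lborel) = complex_of_real (2 * pi * fejer p)"
proof -
  define F where "F y = (1 - complex_of_real y) * iexp (- (p * y)) * (\<i> / p) - iexp (- (p * y)) / p\<^sup>2" for y
  define G where "G y = (1 + complex_of_real y) * iexp (- (p * y)) * (\<i> / p) + iexp (- (p * y)) / p\<^sup>2" for y
  have 1: "has_bochner_integral lborel
     (\<lambda>y. indicator {0..1} y *\<^sub>R ((1 - complex_of_real y) * iexp (- (p * y)))) (F 1 - F 0)"
  proof (rule has_bochner_integral_FTC_Icc)
    show "(F has_vector_derivative (1 - complex_of_real x) * iexp (- (p * x))) (at x within {0..1})" for x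
    proof -
      have "((\<lambda>z. (1 - z) * exp (- (\<i> * p * z)) * (\<i> / p) - exp (- (\<i> * p * z)) / p\<^sup>2)
        has_field_derivative (1 - complex_of_real x) * exp (- (\<i> * p * complex_of_real x))) (at (complex_of_real x))"
        using assms by (auto intro!: derivative_eq_intros simp: field_simps power2_eq_square)
      from has_vector_derivative_real_field[OF this, of "{0..1}"] show ?thesis
        unfolding F_def by (simp add: mult.assoc)
    qed
  qed (auto intro!: continuous_intros)
  have 2: "has_bochner_integral lborel
     (\<lambda>y. indicator {-1..0} y *\<^sub>R ((1 + complex_of_real y) * iexp (- (p * y)))) (G 0 - G (-1))"
  proof (rule has_bochner_integral_FTC_Icc)
    show "(G has_vector_derivative (1 + complex_of_real x) * iexp (- (p * x))) (at x within {-1..0})" for x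
    proof -
      have "((\<lambda>z. (1 + z) * exp (- (\<i> * p * z)) * (\<i> / p) + exp (- (\<i> * p * z)) / p\<^sup>2)
        has_field_derivative (1 + complex_of_real x) * exp (- (\<i> * p * complex_of_real x))) (at (complex_of_real x))"
        using assms by (auto intro!: derivative_eq_intros simp: field_simps power2_eq_square)
      from has_vector_derivative_real_field[OF this, of "{-1..0}"] show ?thesis
        unfolding G_def by (simp add: mult.assoc)
    qed
  qed (auto intro!: continuous_intros)
  have "(\<integral>y. complex_of_real (tent y) * iexp (- (p * y)) \<partial>lborel) =
    (\<integral>y. indicator {0..1} y *\<^sub>R ((1 - complex_of_real y) * iexp (- (p * y)))
      + indicator {-1..0} y *\<^sub>R ((1 + complex_of_real y) * iexp (- (p * y))) \<partial>lborel)"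
  proof (rule integral_cong_AE)
    show "AE y in lborel. complex_of_real (tent y) * iexp (- (p * y)) =
      indicator {0..1} y *\<^sub>R ((1 - complex_of_real y) * iexp (- (p * y)))
      + indicator {-1..0} y *\<^sub>R ((1 + complex_of_real y) * iexp (- (p * y)))"
      using AE_lborel_singleton[of "0::real"]
      by eventually_elim (auto simp: tent_def indicator_def max_def)
  qed measurable
  also have "\<dots> = (F 1 - F 0) + (G 0 - G (-1))"
    by (rule has_bochner_integral_integral_eq[OF has_bochner_integral_add[OF 1 2]])
  also have "\<dots> = (2 - (iexp p + iexp (-p))) / p\<^sup>2"
    unfolding F_def G_def using assms by (simp add: field_simps)
  also have "iexp p + iexp (-p) = complex_of_real (2 * cos p)"
    by (simp add: complex_eq_iff Re_exp Im_exp)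
  also have "(2 - complex_of_real (2 * cos p)) / p\<^sup>2 = complex_of_real (2 * pi * fejer p)"
    using assms by (simp add: fejer_def field_simps)
  finally show ?thesis .
qed

section \<open>Gaussian damping and Fourier inversion for the tent\<close>

lemma integral_std_normal_iexp:
  "(\<integral>x. complex_of_real (std_normal_density x) * iexp (t * x) \<partial>lborel) = complex_of_real (exp (- t\<^sup>2 / 2))"
proof -
  have "complex_of_real (exp (- t\<^sup>2 / 2)) = char std_normal_distribution t"
    by (simp add: char_std_normal_distribution)
  also have "\<dots> = (\<integral>x. std_normal_density x *\<^sub>R iexp (t * x) \<partial>lborel)"
    unfolding char_def by (subst integral_density) auto
  finally show ?thesis by (simp add: scaleR_conv_of_real)
qed

lemma integral_gauss_iexp:
  assumes "\<epsilon> > 0"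
  shows "(\<integral>p. complex_of_real (exp (- (\<epsilon> * p)\<^sup>2 / 2)) * iexp (p * v) \<partial>lborel)
     = complex_of_real (sqrt (2 * pi) / \<epsilon> * exp (- (v / \<epsilon>)\<^sup>2 / 2))" 
proof -
  have "complex_of_real (exp (- (v / \<epsilon>)\<^sup>2 / 2))
      = (\<integral>x. complex_of_real (std_normal_density x) * iexp ((v / \<epsilon>) * x) \<partial>lborel)"
    by (rule integral_std_normal_iexp[symmetric])
  also have "\<dots> = \<bar>\<epsilon>\<bar> *\<^sub>R (\<integral>p. complex_of_real (std_normal_density (0 + \<epsilon> * p)) * iexp ((v / \<epsilon>) * (0 + \<epsilon> * p)) \<partial>lborel)"
    using assms by (intro lborel_integral_real_affine) auto
  also have "\<dots> = complex_of_real (\<epsilon> / sqrt (2 * pi)) * (\<integral>p. complex_of_real (exp (- (\<epsilon> * p)\<^sup>2 / 2)) * iexp (p * v) \<partial>lborel)"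
  proof -
    have "complex_of_real (std_normal_density (0 + \<epsilon> * p)) * iexp ((v / \<epsilon>) * (0 + \<epsilon> * p)) =
       complex_of_real (1 / sqrt (2 * pi)) * (complex_of_real (exp (- (\<epsilon> * p)\<^sup>2 / 2)) * iexp (p * v))" for p
      using assms by (simp add: std_normal_density_def mult.commute)
    then show ?thesis using assms by (simp add: scaleR_conv_of_real)
  qed
  finally show ?thesis using assms by (simp add: field_simps)
qed

lemma integrable_gauss:
  assumes "\<epsilon> > 0" shows "integrable lborel (\<lambda>p. exp (- (\<epsilon> * p)\<^sup>2 / 2))"
    and integral_gauss: "(\<integral>p. exp (- (\<epsilon> * p)\<^sup>2 / 2) \<partial>lborel) = sqrt (2 * pi) / \<epsilon>"
proof -
  have e: "exp (- (\<epsilon> * p)\<^sup>2 / 2) = sqrt (2 * pi) / \<epsilon> * normal_density 0 (1 / \<epsilon>) p" for p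
    using assms by (simp add: normal_density_def power_mult_distrib real_sqrt_divide real_sqrt_mult field_simps)
  show "integrable lborel (\<lambda>p. exp (- (\<epsilon> * p)\<^sup>2 / 2))"
    unfolding e using assms by auto
  show "(\<integral>p. exp (- (\<epsilon> * p)\<^sup>2 / 2) \<partial>lborel) = sqrt (2 * pi) / \<epsilon>"
    unfolding e using assms by (simp del: times_divide_eq_left)
qed

lemma integral_fejer_gauss_iexp:
  assumes "\<epsilon> > 0"
  shows "(\<integral>p. complex_of_real (fejer p) * (complex_of_real (exp (- (\<epsilon> * p)\<^sup>2 / 2)) * iexp (p * u)) \<partial>lborel)
     = complex_of_real (\<integral>z. tent (u + \<epsilon> * z) * std_normal_density z \<partial>lborel)"
proof -
  let ?f = "\<lambda>p y. complex_of_real (tent y) * (complex_of_real (exp (- (\<epsilon> * p)\<^sup>2 / 2)) * iexp (p * (u - y)))"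
  have int: "integrable (lborel \<Otimes>\<^sub>M lborel) (case_prod ?f)"
  proof (rule lborel_pair.Fubini_integrable)
    show "integrable lborel (\<lambda>x. LINT y|lborel. norm (case (x, y) of (p, y) \<Rightarrow> ?f p y))"
      using integrable_gauss[OF assms] by (simp add: norm_mult tent_nonneg)
    have "integrable lborel (\<lambda>y. ?f p y)" for p
      by (rule Bochner_Integration.integrable_bound[OF tent_integrable])
         (auto simp: norm_mult tent_nonneg intro!: mult_left_le)
    then show "AE x in lborel. integrable lborel (\<lambda>y. case (x, y) of (p, y) \<Rightarrow> ?f p y)"
      by simp
  qed measurable
  have "(\<integral>p. complex_of_real (2 * pi) * (complex_of_real (fejer p) * (complex_of_real (exp (- (\<epsilon> * p)\<^sup>2 / 2)) * iexp (p * u))) \<partial>lborel)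
    = (\<integral>p. \<integral>y. ?f p y \<partial>lborel \<partial>lborel)"
  proof (rule integral_cong_AE)
    have *: "(\<integral>y. ?f p y \<partial>lborel) = complex_of_real (2 * pi) * (complex_of_real (fejer p) * (complex_of_real (exp (- (\<epsilon> * p)\<^sup>2 / 2)) * iexp (p * u)))"
      if "p \<noteq> 0" for p
    proof -
      have "?f p y = (complex_of_real (exp (- (\<epsilon> * p)\<^sup>2 / 2)) * iexp (p * u)) * (complex_of_real (tent y) * iexp (- (p * y)))" for y
        by (simp add: algebra_simps exp_diff exp_minus field_simps)
      then have "(\<integral>y. ?f p y \<partial>lborel) = (\<integral>y. (complex_of_real (exp (- (\<epsilon> * p)\<^sup>2 / 2)) * iexp (p * u)) * (complex_of_real (tent y) * iexp (- (p * y))) \<partial>lborel)"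
        by (rule Bochner_Integration.integral_cong[OF refl])
      also have "\<dots> = (complex_of_real (exp (- (\<epsilon> * p)\<^sup>2 / 2)) * iexp (p * u)) * (\<integral>y. complex_of_real (tent y) * iexp (- (p * y)) \<partial>lborel)"
        by (rule integral_mult_right_zero)
      also have "\<dots> = (complex_of_real (exp (- (\<epsilon> * p)\<^sup>2 / 2)) * iexp (p * u)) * complex_of_real (2 * pi * fejer p)"
        unfolding integral_tent_iexp[OF that] ..
      finally show ?thesis by (simp add: mult_ac)
    qed
    show "AE p in lborel. complex_of_real (2 * pi) * (complex_of_real (fejer p) * (complex_of_real (exp (- (\<epsilon> * p)\<^sup>2 / 2)) * iexp (p * u)))
      = (\<integral>y. ?f p y \<partial>lborel)"
      using AE_lborel_singleton[of "0::real"] by eventually_elim (rule *[symmetric])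
  qed measurable
  also have "\<dots> = (\<integral>y. \<integral>p. ?f p y \<partial>lborel \<partial>lborel)"
    using lborel_pair.Fubini_integral[OF int] by simp
  also have "\<dots> = (\<integral>y. complex_of_real (tent y * (sqrt (2 * pi) / \<epsilon> * exp (- ((u - y) / \<epsilon>)\<^sup>2 / 2))) \<partial>lborel)"
    by (intro Bochner_Integration.integral_cong refl)
       (subst integral_mult_right_zero, subst integral_gauss_iexp[OF assms], simp)
  also have "\<dots> = complex_of_real (\<integral>y. tent y * (sqrt (2 * pi) / \<epsilon> * exp (- ((u - y) / \<epsilon>)\<^sup>2 / 2)) \<partial>lborel)"
    by (rule integral_complex_of_real)
  also have "(\<integral>y. tent y * (sqrt (2 * pi) / \<epsilon> * exp (- ((u - y) / \<epsilon>)\<^sup>2 / 2)) \<partial>lborel)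
     = \<bar>\<epsilon>\<bar> *\<^sub>R (\<integral>z. tent (u + \<epsilon> * z) * (sqrt (2 * pi) / \<epsilon> * exp (- ((u - (u + \<epsilon> * z)) / \<epsilon>)\<^sup>2 / 2)) \<partial>lborel)"
    using assms by (intro lborel_integral_real_affine) auto
  also have "(\<lambda>z. tent (u + \<epsilon> * z) * (sqrt (2 * pi) / \<epsilon> * exp (- ((u - (u + \<epsilon> * z)) / \<epsilon>)\<^sup>2 / 2)))
     = (\<lambda>z. 2 * pi / \<epsilon> * (tent (u + \<epsilon> * z) * std_normal_density z))"
    using assms by (auto simp: std_normal_density_def fun_eq_iff field_simps)
  finally show ?thesis
    using assms by simp
qed

text \<open>The damping is removed by dominated convergence: \<open>fejer\<close> dominates on one
  side, and on the other the smoothed tent converges to the tent by continuity.\<close>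

lemma integral_fejer_iexp:
  "(\<integral>p. complex_of_real (fejer p) * iexp (p * u) \<partial>lborel) = complex_of_real (tent u)"
proof (rule LIMSEQ_unique)
  define e :: "nat \<Rightarrow> real" where "e n = 1 / real (Suc n)" for n
  have e: "e \<longlonglongrightarrow> 0" "e n > 0" for n
    unfolding e_def using LIMSEQ_Suc[OF lim_1_over_n[where 'a=real]] by auto
  let ?L = "\<lambda>n. \<integral>p. complex_of_real (fejer p) * (complex_of_real (exp (- (e n * p)\<^sup>2 / 2)) * iexp (p * u)) \<partial>lborel"
  show "?L \<longlonglongrightarrow> (\<integral>p. complex_of_real (fejer p) * iexp (p * u) \<partial>lborel)"
  proof (rule integral_dominated_convergence[OF _ _ fejer_integrable])
    have "(\<lambda>n. complex_of_real (fejer p) * (complex_of_real (exp (- (e n * p)\<^sup>2 / 2)) * iexp (p * u)))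
      \<longlonglongrightarrow> complex_of_real (fejer p) * (complex_of_real (exp (- (0 * p)\<^sup>2 / 2)) * iexp (p * u))" for p
      by (intro tendsto_intros e) auto
    then show "AE p in lborel. (\<lambda>n. complex_of_real (fejer p) * (complex_of_real (exp (- (e n * p)\<^sup>2 / 2)) * iexp (p * u)))
      \<longlonglongrightarrow> complex_of_real (fejer p) * iexp (p * u)"
      by simp
  qed (auto simp: norm_mult fejer_nonneg intro!: mult_left_le)
  have "(\<lambda>n. \<integral>z. tent (u + e n * z) * std_normal_density z \<partial>lborel) \<longlonglongrightarrow> (\<integral>z. tent u * std_normal_density z \<partial>lborel)"
  proof (rule integral_dominated_convergence[where w = std_normal_density])
    have "(\<lambda>n. tent (u + e n * z) * std_normal_density z) \<longlonglongrightarrow> tent (u + 0 * z) * std_normal_density z" for z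
      by (intro tendsto_intros isCont_tendsto_compose[OF isCont_tent] e)
    then show "AE z in lborel. (\<lambda>n. tent (u + e n * z) * std_normal_density z) \<longlonglongrightarrow> tent u * std_normal_density z"
      by simp
  qed (auto simp: abs_mult tent_nonneg tent_le_1 intro!: mult_left_le_one_le)
  then have "(\<lambda>n. complex_of_real (\<integral>z. tent (u + e n * z) * std_normal_density z \<partial>lborel)) \<longlonglongrightarrow> complex_of_real (tent u)"
    by (intro tendsto_of_real) simp
  then show "?L \<longlonglongrightarrow> complex_of_real (tent u)"
    using integral_fejer_gauss_iexp[OF e(2)] by simp
qed

definition fejer_distribution :: "real measure" where
  "fejer_distribution = density lborel fejer"

lemma sets_fejer_distribution [simp, measurable_cong]: "sets fejer_distribution = sets borel"
  by (simp add: fejer_distribution_def)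

lemma space_fejer_distribution [simp]: "space fejer_distribution = UNIV"
  by (simp add: fejer_distribution_def)

lemma prob_space_fejer: "prob_space fejer_distribution"
proof
  \<comment> \<open>The total mass is the inversion formula at \<open>u = 0\<close>.\<close>
  have "(\<integral>p. fejer p \<partial>lborel) = 1"
    using integral_fejer_iexp[of 0] integral_complex_of_real[of lborel fejer] by (simp add: tent_def)
  then show "emeasure fejer_distribution (space fejer_distribution) = 1"
    unfolding fejer_distribution_def
    by (simp add: emeasure_density nn_integral_eq_integral fejer_integrable fejer_nonneg)
qed

lemma char_fejer: "char fejer_distribution u = complex_of_real (tent u)"
  unfolding char_def fejer_distribution_def
  using integral_fejer_iexp[of u]
  by (subst integral_density) (auto simp: fejer_nonneg scaleR_conv_of_real mult.commute)

text \<open>After \<open>fejer_le\<close> only a Gaussian integral over the line remains. The 8 in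
  the exponent is what \<open>abs_exp_quadratic_diff_le\<close> leaves over.\<close>

lemma integral_fejer_gauss_le:
  assumes "s > 0"
  shows "(\<integral>p. exp (- (s * p)\<^sup>2 / 8) \<partial>fejer_distribution) \<le> 1 / s"
proof -
  have e: "exp (- (s * p)\<^sup>2 / 8) = exp (- ((s / 2) * p)\<^sup>2 / 2)" for p
    by (simp add: power_divide power_mult_distrib)
  have "(\<integral>p. exp (- (s * p)\<^sup>2 / 8) \<partial>fejer_distribution) = (\<integral>p. fejer p * exp (- ((s / 2) * p)\<^sup>2 / 2) \<partial>lborel)"
    unfolding fejer_distribution_def e by (subst integral_density) (auto simp: fejer_nonneg)
  also have "\<dots> \<le> (\<integral>p. 1 / (2 * pi) * exp (- ((s / 2) * p)\<^sup>2 / 2) \<partial>lborel)"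
    using integrable_gauss[of "s / 2"] assms
    by (intro integral_mono mult_right_mono fejer_le integrable_mult_right
        Bochner_Integration.integrable_bound[OF fejer_integrable, of "\<lambda>p. fejer p * exp (- ((s / 2) * p)\<^sup>2 / 2)"])
       (auto simp: fejer_nonneg intro!: mult_left_le)
  also have "\<dots> = 1 / (2 * pi) * (sqrt (2 * pi) / (s / 2))"
    using integral_gauss[of "s / 2"] assms by simp
  also have "\<dots> = 2 / (sqrt (2 * pi) * s)"
    using assms by (simp add: field_simps)
  also have "\<dots> \<le> 1 / s"
  proof -
    have "2 \<le> sqrt (2 * pi)" using pi_ge_two by (intro real_le_rsqrt) auto
    then show ?thesis using assms by (simp add: field_simps)
  qed
  finally show ?thesis .
qed

lemma norm_integral_le:
  fixes f :: "'a \<Rightarrow> 'b::{banach, second_countable_topology}"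
  assumes "integrable M f" "integrable M g" "\<And>x. norm (f x) \<le> g x"
  shows "norm (\<integral>x. f x \<partial>M) \<le> (\<integral>x. g x \<partial>M)"
  by (rule order_trans[OF integral_norm_bound integral_mono]) (use assms in auto)

section \<open>Stability of Gaussian exponentials under nearly diagonal quadratic forms\<close>

lemma abs_exp_minus_diff_le:
  fixes a b :: real
  shows "\<bar>exp (- a) - exp (- b)\<bar> \<le> \<bar>a - b\<bar> * exp (- min a b)"
proof -
  have *: "\<bar>exp (- a) - exp (- b)\<bar> \<le> \<bar>a - b\<bar> * exp (- min a b)" if "a \<le> b" for a b :: real
  proof -
    have "exp (- a) - exp (- b) = exp (- a) * (1 - exp (- (b - a)))"
      by (simp add: algebra_simps flip: exp_add)
    also have "\<dots> \<le> exp (- a) * (b - a)"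
      using exp_ge_add_one_self[of "- (b - a)"] by (intro mult_left_mono) (linarith, simp)
    finally show ?thesis using that by (simp add: mult.commute)
  qed
  show ?thesis
    using *[of a b] *[of b a] by (cases "a \<le> b") (simp_all add: abs_minus_commute min.commute)
qed

text \<open>Since \<theta> is at most 1/2, \<open>Q\<close> is at least \<open>S / 2\<close>, and
  the mean value bound gives \<open>\<theta> * S / 2 * exp (- S / 4)\<close>. Half of this decay
  absorbs the factor \<open>S\<close> through \<open>x * exp (- x) \<le> 1\<close>; the other half
  stays integrable.\<close>

lemma abs_exp_quadratic_diff_le:
  fixes Q S \<theta> :: real
  assumes "\<bar>Q - S\<bar> \<le> \<theta> * S" "\<theta> \<le> 1/2" "0 \<le> S" "0 \<le> \<theta>"
  shows "\<bar>exp (- Q / 2) - exp (- S / 2)\<bar> \<le> 4 * \<theta> * exp (- S / 8)"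
proof -
  have "\<theta> * S \<le> 1/2 * S" using assms by (intro mult_right_mono) auto
  then have Q: "S / 2 \<le> Q" using assms by linarith
  have \<theta>S: "0 \<le> \<theta> * S" using assms(1) by linarith
  have "\<bar>exp (- Q / 2) - exp (- S / 2)\<bar> \<le> \<bar>Q / 2 - S / 2\<bar> * exp (- min (Q / 2) (S / 2))"
    using abs_exp_minus_diff_le[of "Q / 2" "S / 2"] by simp
  also have "\<dots> \<le> (\<theta> * S / 2) * exp (- (S / 4))"
  proof (intro mult_mono)
    show "\<bar>Q / 2 - S / 2\<bar> \<le> \<theta> * S / 2" using assms(1) by linarith
  qed (use Q \<theta>S assms(3) in auto)
  also have "\<dots> = 4 * \<theta> * (S / 8 * exp (- (S / 8))) * exp (- S / 8)"
    by (simp add: mult.assoc flip: exp_add)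
  also have "\<dots> \<le> 4 * \<theta> * 1 * exp (- S / 8)"
  proof -
    have "S / 8 * exp (- (S / 8)) \<le> 1"
      using exp_ge_add_one_self[of "S / 8"] by (simp add: exp_minus field_simps)
    then show ?thesis using assms(4) by (intro mult_mono) (use assms(3) in auto)
  qed
  finally show ?thesis by simp
qed

text \<open>Diagonal dominance: by the arithmetic-geometric mean inequality each off-diagonal term
  is at most \<eta> times half the sum of two squares, and each square meets \<open>card I\<close>
  partners in either position. The error is relative to the diagonal form, so no lower bound on the
  \<open>s i\<close> enters.\<close>

lemma quadratic_form_near_diagonal:
  fixes C :: "'i \<Rightarrow> 'i \<Rightarrow> real" and s p :: "'i \<Rightarrow> real" and \<eta> :: real
  assumes "finite I"
    and diag: "\<And>i. i \<in> I \<Longrightarrow> C i i = (s i)\<^sup>2"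
    and off: "\<And>i j. i \<in> I \<Longrightarrow> j \<in> I \<Longrightarrow> i \<noteq> j \<Longrightarrow> \<bar>C i j\<bar> \<le> \<eta> * s i * s j"
    and s: "\<And>i. i \<in> I \<Longrightarrow> 0 < s i" and "0 \<le> \<eta>"
  shows "\<bar>(\<Sum>i\<in>I. \<Sum>j\<in>I. p i * p j * C i j) - (\<Sum>i\<in>I. (s i * p i)\<^sup>2)\<bar>
    \<le> (card I * \<eta>) * (\<Sum>i\<in>I. (s i * p i)\<^sup>2)"
proof -
  have "(\<Sum>i\<in>I. \<Sum>j\<in>I. p i * p j * C i j) - (\<Sum>i\<in>I. (s i * p i)\<^sup>2)
      = (\<Sum>i\<in>I. \<Sum>j\<in>I. if i = j then 0 else p i * p j * C i j)"
  proof -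
    have "(\<Sum>j\<in>I. p i * p j * C i j) = (\<Sum>j\<in>I. if i = j then 0 else p i * p j * C i j) + (s i * p i)\<^sup>2"
      if "i \<in> I" for i
    proof -
      have "(\<Sum>j\<in>I. p i * p j * C i j) = (\<Sum>j\<in>I. (if i = j then 0 else p i * p j * C i j) + (if i = j then (s i * p i)\<^sup>2 else 0))"
        using diag[OF that] by (intro sum.cong) (auto simp: power2_eq_square)
      then show ?thesis using assms(1) that by (simp add: sum.distrib)
    qed
    then show ?thesis by (simp add: sum.distrib)
  qed
  also have "\<bar>\<dots>\<bar> \<le> (\<Sum>i\<in>I. \<Sum>j\<in>I. \<bar>if i = j then 0 else p i * p j * C i j\<bar>)"
    by (intro order_trans[OF sum_abs] sum_mono order_refl)
  also have "\<dots> \<le> (\<Sum>i\<in>I. \<Sum>j\<in>I. \<eta> * ((s i * p i)\<^sup>2 / 2 + (s j * p j)\<^sup>2 / 2))"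
  proof (intro sum_mono)
    fix i j assume ij: "i \<in> I" "j \<in> I"
    have "\<bar>if i = j then 0 else p i * p j * C i j\<bar> \<le> \<bar>p i * p j\<bar> * (\<eta> * s i * s j)"
      using off[OF ij] s[OF ij(1)] s[OF ij(2)] \<open>0 \<le> \<eta>\<close>
      by (auto simp: abs_mult intro!: mult_left_mono)
    also have "\<dots> = \<eta> * (\<bar>s i * p i\<bar> * \<bar>s j * p j\<bar>)"
      using s[OF ij(1)] s[OF ij(2)] by (simp add: abs_mult)
    also have "\<bar>s i * p i\<bar> * \<bar>s j * p j\<bar> \<le> (s i * p i)\<^sup>2 / 2 + (s j * p j)\<^sup>2 / 2"
      using sum_squares_bound[of "\<bar>s i * p i\<bar>" "\<bar>s j * p j\<bar>"] by simp
    finally show "\<bar>if i = j then 0 else p i * p j * C i j\<bar> \<le> \<eta> * ((s i * p i)\<^sup>2 / 2 + (s j * p j)\<^sup>2 / 2)"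
      using \<open>0 \<le> \<eta>\<close> by (simp add: mult_left_mono)
  qed
  also have "\<dots> = (card I * \<eta>) * (\<Sum>i\<in>I. (s i * p i)\<^sup>2)"
  proof -
    have "(\<Sum>i\<in>I. \<Sum>j\<in>I. \<eta> * ((s i * p i)\<^sup>2 / 2 + (s j * p j)\<^sup>2 / 2))
       = \<eta> * (card I * (\<Sum>i\<in>I. (s i * p i)\<^sup>2 / 2) + card I * (\<Sum>j\<in>I. (s j * p j)\<^sup>2 / 2))"
      by (simp only: sum_distrib_left[symmetric] sum.distrib sum_constant)
    then show ?thesis by (simp add: sum_divide_distrib[symmetric])
  qed
  finally show ?thesis .
qed

text \<open>Writing each tent as the characteristic function of a law with bounded density turns
  both expectations into integrals of exponentials of quadratic forms, which can be compared
  pointwise. No joint density is needed.\<close>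

lemma (in prob_space) gaussian_tent_decoupling:
  fixes X :: "'i \<Rightarrow> 'a \<Rightarrow> real" and C :: "'i \<Rightarrow> 'i \<Rightarrow> real" and s y :: "'i \<Rightarrow> real" and \<eta> :: real
  assumes I: "finite I"
    and X[measurable]: "\<And>i. i \<in> I \<Longrightarrow> X i \<in> borel_measurable M"
    and char: "\<And>p. (\<integral>\<omega>. iexp (\<Sum>i\<in>I. p i * X i \<omega>) \<partial>M) = complex_of_real (exp (- (\<Sum>i\<in>I. \<Sum>j\<in>I. p i * p j * C i j) / 2))"
    and diag: "\<And>i. i \<in> I \<Longrightarrow> C i i = (s i)\<^sup>2"
    and off: "\<And>i j. i \<in> I \<Longrightarrow> j \<in> I \<Longrightarrow> i \<noteq> j \<Longrightarrow> \<bar>C i j\<bar> \<le> \<eta> * s i * s j"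
    and s: "\<And>i. i \<in> I \<Longrightarrow> 0 < s i" and \<eta>: "0 \<le> \<eta>" "card I * \<eta> \<le> 1/2"
  shows "\<bar>expectation (\<lambda>\<omega>. \<Prod>i\<in>I. tent (X i \<omega> - y i)) - (\<Prod>i\<in>I. expectation (\<lambda>\<omega>. tent (X i \<omega> - y i)))\<bar>
     \<le> 4 * (card I * \<eta>) * (\<Prod>i\<in>I. 1 / s i)"
    and "\<And>i. i \<in> I \<Longrightarrow> expectation (\<lambda>\<omega>. tent (X i \<omega> - y i)) \<le> 1 / s i"
proof -
  let ?K = "fejer_distribution"
  interpret K: prob_space ?K by (rule prob_space_fejer)
  interpret KI: product_prob_space "\<lambda>_. ?K" I by unfold_locales
  interpret KI': finite_product_prob_space "\<lambda>_. ?K" I by unfold_locales (rule I)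
  let ?P = "Pi\<^sub>M I (\<lambda>_. ?K)"
  interpret PM: pair_prob_space ?P M by unfold_locales
  interpret MK: pair_prob_space ?K M by unfold_locales
  have tent_char: "complex_of_real (tent u) = (\<integral>p. iexp (p * u) \<partial>?K)" for u
    using char_fejer[of u] by (simp add: char_def mult.commute)
  have iexp_meas: "(\<lambda>p. exp (\<i> * (complex_of_real p * c))) \<in> borel_measurable ?K" for c
    by measurable
  have gauss_meas: "(\<lambda>a. exp (- (\<i> * (complex_of_real a * c))) * complex_of_real (exp (- ((d * a)\<^sup>2 / 2)))) \<in> borel_measurable ?K"
      "(\<lambda>a. exp (- ((d * a)\<^sup>2 / 8))) \<in> borel_measurable ?K" for c d
    by measurable
  have comp [measurable]: "(\<lambda>p. p i) \<in> borel_measurable ?P" if "i \<in> I" for i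
    using measurable_component_singleton[OF that, of "\<lambda>_. ?K"]
    by (simp cong: measurable_cong_sets)
  define Q where "Q p = (\<Sum>i\<in>I. \<Sum>j\<in>I. p i * p j * C i j)" for p
  define S where "S p = (\<Sum>i\<in>I. (s i * p i)\<^sup>2)" for p
  have [measurable]: "Q \<in> borel_measurable ?P" "S \<in> borel_measurable ?P"
    unfolding Q_def S_def by measurable
  define ph where "ph p = iexp (- (\<Sum>i\<in>I. p i * y i))" for p
  have [measurable]: "ph \<in> borel_measurable ?P"
    unfolding ph_def by measurable
  have ph_norm: "norm (ph p) = 1" for p unfolding ph_def by simp
  \<comment> \<open>Independent frequencies drawn from the Fejer law turn each tent into an average
    of exponentials. After Fubini, \<open>X\<close> enters only through its joint characteristic
    function, and the centres \<open>y\<close> only through the phase \<open>ph\<close>.\<close>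
  have 1: "complex_of_real (expectation (\<lambda>\<omega>. \<Prod>i\<in>I. tent (X i \<omega> - y i)))
      = (\<integral>p. ph p * complex_of_real (exp (- Q p / 2)) \<partial>?P)"
  proof -
    have "complex_of_real (expectation (\<lambda>\<omega>. \<Prod>i\<in>I. tent (X i \<omega> - y i)))
       = (\<integral>\<omega>. (\<Prod>i\<in>I. complex_of_real (tent (X i \<omega> - y i))) \<partial>M)"
      by (simp flip: integral_complex_of_real)
    also have "\<dots> = (\<integral>\<omega>. (\<integral>p. (\<Prod>i\<in>I. iexp (p i * (X i \<omega> - y i))) \<partial>?P) \<partial>M)"
      unfolding tent_char
      by (intro Bochner_Integration.integral_cong refl, subst KI.product_integral_prod)
         (auto intro!: I K.integrable_const_bound[where B = 1] iexp_meas)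
    also have "\<dots> = (\<integral>\<omega>. (\<integral>p. ph p * iexp (\<Sum>i\<in>I. p i * X i \<omega>) \<partial>?P) \<partial>M)"
      unfolding ph_def
      by (intro Bochner_Integration.integral_cong refl)
         (simp add: I exp_sum[symmetric] exp_add[symmetric] sum_distrib_left algebra_simps sum_subtractf)
    also have "\<dots> = (\<integral>p. (\<integral>\<omega>. ph p * iexp (\<Sum>i\<in>I. p i * X i \<omega>) \<partial>M) \<partial>?P)"
      by (intro PM.Fubini_integral PM.integrable_const_bound[where B = 1])
         (auto simp: norm_mult ph_norm)
    also have "\<dots> = (\<integral>p. ph p * complex_of_real (exp (- Q p / 2)) \<partial>?P)"
      by (intro Bochner_Integration.integral_cong refl)
         (subst integral_mult_right_zero, subst char, simp add: Q_def)
    finally show ?thesis .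
  qed
  have single: "(\<integral>\<omega>. iexp (t * X i \<omega>) \<partial>M) = complex_of_real (exp (- (s i * t)\<^sup>2 / 2))" if i: "i \<in> I" for i t
  proof -
    let ?e = "\<lambda>j. if j = i then t else 0"
    have "(\<Sum>j\<in>I. ?e j * X j \<omega>) = t * X i \<omega>" for \<omega>
    proof -
      have "(\<Sum>j\<in>I. ?e j * X j \<omega>) = (\<Sum>j\<in>I. if j = i then t * X i \<omega> else 0)"
        by (intro sum.cong) auto
      then show ?thesis using I i by simp
    qed
    moreover have "(\<Sum>j\<in>I. \<Sum>k\<in>I. ?e j * ?e k * C j k) = (s i * t)\<^sup>2"
    proof -
      have "(\<Sum>j\<in>I. \<Sum>k\<in>I. ?e j * ?e k * C j k) = (\<Sum>j\<in>I. \<Sum>k\<in>I. if k = i then (if j = i then (s i * t)\<^sup>2 else 0) else 0)"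
        using diag[OF i] by (intro sum.cong) (auto simp: power2_eq_square)
      then show ?thesis using I i by simp
    qed
    ultimately show ?thesis using char[of ?e] by simp
  qed
  have E1: "complex_of_real (expectation (\<lambda>\<omega>. tent (X i \<omega> - y i)))
     = (\<integral>q. iexp (- (q * y i)) * complex_of_real (exp (- (s i * q)\<^sup>2 / 2)) \<partial>?K)" if i: "i \<in> I" for i
  proof -
    note [measurable] = X[OF i]
    have "complex_of_real (expectation (\<lambda>\<omega>. tent (X i \<omega> - y i)))
       = (\<integral>\<omega>. (\<integral>q. iexp (- (q * y i)) * iexp (q * X i \<omega>) \<partial>?K) \<partial>M)"
      by (simp flip: integral_complex_of_real exp_add add: tent_char algebra_simps)
    also have "\<dots> = (\<integral>q. (\<integral>\<omega>. iexp (- (q * y i)) * iexp (q * X i \<omega>) \<partial>M) \<partial>?K)"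
      by (intro MK.Fubini_integral MK.integrable_const_bound[where B = 1]) (auto simp: norm_mult)
    also have "\<dots> = (\<integral>q. iexp (- (q * y i)) * complex_of_real (exp (- (s i * q)\<^sup>2 / 2)) \<partial>?K)"
      by (intro Bochner_Integration.integral_cong refl)
         (subst integral_mult_right_zero, subst single[OF i], simp)
    finally show ?thesis .
  qed
  \<comment> \<open>The product of the separate means is the same integral with the diagonal form
    \<open>S\<close> in place of \<open>Q\<close>.\<close>
  have 2: "complex_of_real (\<Prod>i\<in>I. expectation (\<lambda>\<omega>. tent (X i \<omega> - y i)))
      = (\<integral>p. ph p * complex_of_real (exp (- S p / 2)) \<partial>?P)"
  proof -
    have "complex_of_real (\<Prod>i\<in>I. expectation (\<lambda>\<omega>. tent (X i \<omega> - y i)))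
      = (\<Prod>i\<in>I. (\<integral>q. iexp (- (q * y i)) * complex_of_real (exp (- (s i * q)\<^sup>2 / 2)) \<partial>?K))"
      by (simp add: E1)
    also have "\<dots> = (\<integral>p. (\<Prod>i\<in>I. iexp (- (p i * y i)) * complex_of_real (exp (- (s i * p i)\<^sup>2 / 2))) \<partial>?P)"
      by (subst KI.product_integral_prod)
         (auto intro!: I K.integrable_const_bound[where B = 1] gauss_meas simp: norm_mult)
    also have "\<dots> = (\<integral>p. ph p * complex_of_real (exp (- S p / 2)) \<partial>?P)"
    proof (intro Bochner_Integration.integral_cong refl)
      fix p
      have "(\<Prod>i\<in>I. iexp (- (p i * y i))) = ph p"
        unfolding ph_def by (simp add: I exp_sum[symmetric] sum_distrib_left sum_negf)
      moreover have "(\<Prod>i\<in>I. complex_of_real (exp (- (s i * p i)\<^sup>2 / 2))) = complex_of_real (exp (- S p / 2))"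
        unfolding S_def of_real_prod[symmetric]
        by (simp add: I exp_sum[symmetric] sum_negf sum_divide_distrib)
      ultimately show "(\<Prod>i\<in>I. iexp (- (p i * y i)) * complex_of_real (exp (- (s i * p i)\<^sup>2 / 2))) = ph p * complex_of_real (exp (- S p / 2))"
        by (simp add: prod.distrib)
    qed
    finally show ?thesis .
  qed
  have QS: "\<bar>Q p - S p\<bar> \<le> (card I * \<eta>) * S p" for p
    unfolding Q_def S_def by (rule quadratic_form_near_diagonal[OF I diag off s \<eta>(1)])
  have S0: "0 \<le> S p" for p unfolding S_def by (intro sum_nonneg) auto
  have Q0: "0 \<le> Q p" for p
  proof -
    have "(card I * \<eta>) * S p \<le> 1/2 * S p" using \<eta> S0 by (intro mult_right_mono) auto
    then show ?thesis using QS[of p] S0[of p] by linarith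
  qed
  have int: "integrable ?P (\<lambda>p. ph p * complex_of_real (exp (- Q p / 2)))"
    "integrable ?P (\<lambda>p. ph p * complex_of_real (exp (- S p / 2)))"
    by (rule KI.P.integrable_const_bound[where B = 1]; simp add: norm_mult ph_norm Q0 S0)+
  \<comment> \<open>The phase has modulus 1, so the centres drop out and the bound is uniform in
    \<open>y\<close>.\<close>
  have "\<bar>expectation (\<lambda>\<omega>. \<Prod>i\<in>I. tent (X i \<omega> - y i)) - (\<Prod>i\<in>I. expectation (\<lambda>\<omega>. tent (X i \<omega> - y i)))\<bar>
     = norm (complex_of_real (expectation (\<lambda>\<omega>. \<Prod>i\<in>I. tent (X i \<omega> - y i))) - complex_of_real (\<Prod>i\<in>I. expectation (\<lambda>\<omega>. tent (X i \<omega> - y i))))"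
    by (simp only: of_real_diff[symmetric] norm_of_real)
  also have "\<dots> = norm (\<integral>p. ph p * complex_of_real (exp (- Q p / 2)) - ph p * complex_of_real (exp (- S p / 2)) \<partial>?P)"
    unfolding 1 2 Bochner_Integration.integral_diff[OF int] ..
  also have "\<dots> \<le> (\<integral>p. 4 * (card I * \<eta>) * exp (- S p / 8) \<partial>?P)"
  proof (rule norm_integral_le[OF Bochner_Integration.integrable_diff[OF int]])
    show "integrable ?P (\<lambda>p. 4 * (card I * \<eta>) * exp (- S p / 8))"
      by (intro integrable_mult_right KI.P.integrable_const_bound[where B = 1]) (auto simp: S0)
    show "norm (ph p * complex_of_real (exp (- Q p / 2)) - ph p * complex_of_real (exp (- S p / 2)))
       \<le> 4 * (card I * \<eta>) * exp (- S p / 8)" for p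
    proof -
      have "ph p * complex_of_real (exp (- Q p / 2)) - ph p * complex_of_real (exp (- S p / 2))
        = ph p * complex_of_real (exp (- Q p / 2) - exp (- S p / 2))"
        by (simp add: algebra_simps)
      then show ?thesis
        using abs_exp_quadratic_diff_le[OF QS \<eta>(2) S0, of p] \<eta>(1) by (simp only: norm_mult ph_norm norm_of_real) simp
    qed
  qed
  also have "\<dots> = 4 * (card I * \<eta>) * (\<Prod>i\<in>I. (\<integral>q. exp (- (s i * q)\<^sup>2 / 8) \<partial>?K))"
  proof -
    have "(\<Prod>i\<in>I. (\<integral>q. exp (- (s i * q)\<^sup>2 / 8) \<partial>?K)) = (\<integral>p. (\<Prod>i\<in>I. exp (- (s i * p i)\<^sup>2 / 8)) \<partial>?P)"
      by (subst KI.product_integral_prod) (auto intro!: I K.integrable_const_bound[where B = 1] gauss_meas)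
    also have "(\<lambda>p. \<Prod>i\<in>I. exp (- (s i * p i)\<^sup>2 / 8)) = (\<lambda>p. exp (- S p / 8))"
      unfolding S_def by (simp add: I exp_sum[symmetric] sum_negf sum_divide_distrib)
    finally show ?thesis by simp
  qed
  also have "\<dots> \<le> 4 * (card I * \<eta>) * (\<Prod>i\<in>I. 1 / s i)"
    using \<eta> by (intro mult_left_mono prod_mono conjI integral_fejer_gauss_le s) auto
  finally show "\<bar>expectation (\<lambda>\<omega>. \<Prod>i\<in>I. tent (X i \<omega> - y i)) - (\<Prod>i\<in>I. expectation (\<lambda>\<omega>. tent (X i \<omega> - y i)))\<bar>
     \<le> 4 * (card I * \<eta>) * (\<Prod>i\<in>I. 1 / s i)" .
  show "expectation (\<lambda>\<omega>. tent (X i \<omega> - y i)) \<le> 1 / s i" if i: "i \<in> I" for i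
  proof -
    have "expectation (\<lambda>\<omega>. tent (X i \<omega> - y i)) \<le> norm (complex_of_real (expectation (\<lambda>\<omega>. tent (X i \<omega> - y i))))"
      by simp
    also have "\<dots> \<le> (\<integral>q. exp (- (s i * q)\<^sup>2 / 8) \<partial>?K)"
      unfolding E1[OF i]
      by (rule norm_integral_le)
         (auto intro!: K.integrable_const_bound[where B = 1] gauss_meas simp: norm_mult)
    also have "\<dots> \<le> 1 / s i" by (rule integral_fejer_gauss_le[OF s[OF i]])
    finally show ?thesis .
  qed
qed

section \<open>Increments of fractional Brownian motion\<close>

lemma distributed_normal_char:
  assumes "distributed M lborel Z (normal_density 0 \<sigma>)" "\<sigma> > 0"
  shows "(\<integral>\<omega>. iexp (Z \<omega>) \<partial>M) = complex_of_real (exp (- \<sigma>\<^sup>2 / 2))"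
proof -
  have Z [measurable]: "Z \<in> borel_measurable M"
    using distributed_measurable[OF assms(1)] by simp
  have "(\<integral>\<omega>. iexp (Z \<omega>) \<partial>M) = (\<integral>x. iexp x \<partial>distr M lborel Z)"
    by (rule integral_distr[symmetric]) auto
  also have "\<dots> = (\<integral>x. normal_density 0 \<sigma> x *\<^sub>R iexp x \<partial>lborel)"
    unfolding distributed_distr_eq_density[OF assms(1)] by (subst integral_density) auto
  also have "\<dots> = \<bar>\<sigma>\<bar> *\<^sub>R (\<integral>z. normal_density 0 \<sigma> (0 + \<sigma> * z) *\<^sub>R iexp (0 + \<sigma> * z) \<partial>lborel)"
    using assms by (intro lborel_integral_real_affine) auto
  also have "\<dots> = (\<integral>z. complex_of_real (std_normal_density z) * iexp (\<sigma> * z) \<partial>lborel)"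
  proof -
    have "\<sigma> * normal_density 0 \<sigma> (\<sigma> * z) = std_normal_density z" for z
      using assms(2) by (simp add: normal_density_def real_sqrt_mult field_simps power2_eq_square)
    then have "\<bar>\<sigma>\<bar> *\<^sub>R (normal_density 0 \<sigma> (0 + \<sigma> * z) *\<^sub>R iexp (0 + \<sigma> * z)) = complex_of_real (std_normal_density z) * iexp (\<sigma> * z)" for z
      using assms(2) by (simp only: scaleR_scaleR) (simp add: scaleR_conv_of_real flip: of_real_mult)
    then show ?thesis by (simp only: integral_scaleR_right[symmetric])
  qed
  also have "\<dots> = complex_of_real (exp (- \<sigma>\<^sup>2 / 2))"
    by (rule integral_std_normal_iexp)
  finally show ?thesis .
qed

lemma distributed_normal_even_moment:
  assumes "distributed M lborel Z (normal_density 0 \<sigma>)" "\<sigma> > 0"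
  shows "integrable M (\<lambda>\<omega>. Z \<omega> ^ (2 * q))"
    and "(\<integral>\<omega>. Z \<omega> ^ (2 * q) \<partial>M) = fact (2 * q) / (2 ^ q * fact q) * (\<sigma>\<^sup>2) ^ q"
proof -
  have m: "has_bochner_integral lborel (\<lambda>x. normal_density 0 \<sigma> x * x ^ (2 * q)) (fact (2 * q) / ((2 / \<sigma>\<^sup>2) ^ q * fact q))"
    using normal_moment_even[OF assms(2), of 0 q] by simp
  show "integrable M (\<lambda>\<omega>. Z \<omega> ^ (2 * q))"
    using m by (subst distributed_integrable[OF assms(1), symmetric]) (auto simp: has_bochner_integral_iff)
  have "(\<integral>\<omega>. Z \<omega> ^ (2 * q) \<partial>M) = (\<integral>x. normal_density 0 \<sigma> x * x ^ (2 * q) \<partial>lborel)"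
    by (rule distributed_integral[OF assms(1), symmetric]) auto
  also have "\<dots> = fact (2 * q) / (2 ^ q * fact q) * (\<sigma>\<^sup>2) ^ q"
    using m assms(2) by (simp add: has_bochner_integral_iff power_divide)
  finally show "(\<integral>\<omega>. Z \<omega> ^ (2 * q) \<partial>M) = fact (2 * q) / (2 ^ q * fact q) * (\<sigma>\<^sup>2) ^ q" .
qed

text \<open>Both cases of \<open>centered_gaussian_rv\<close> fit one formula: if \<open>Z\<close>
  vanishes almost surely the variance is 0, and \<open>0 ^ 0 = 1\<close> settles
  \<open>q = 0\<close>.\<close>

lemma (in prob_space) centered_gaussian_even_moment:
  assumes "centered_gaussian_rv M Z"
  shows "integrable M (\<lambda>\<omega>. Z \<omega> ^ (2 * q))"
    and "expectation (\<lambda>\<omega>. Z \<omega> ^ (2 * q)) = fact (2 * q) / (2 ^ q * fact q) * (expectation (\<lambda>\<omega>. (Z \<omega>)\<^sup>2)) ^ q"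
proof -
  have [measurable]: "Z \<in> borel_measurable M" using assms by (simp add: centered_gaussian_rv_def)
  consider "AE \<omega> in M. Z \<omega> = 0" | \<sigma> where "\<sigma> > 0" "distributed M lborel Z (normal_density 0 \<sigma>)"
    using assms by (auto simp: centered_gaussian_rv_def)
  then have "integrable M (\<lambda>\<omega>. Z \<omega> ^ (2 * q)) \<and>
     expectation (\<lambda>\<omega>. Z \<omega> ^ (2 * q)) = fact (2 * q) / (2 ^ q * fact q) * (expectation (\<lambda>\<omega>. (Z \<omega>)\<^sup>2)) ^ q"
  proof cases
    case 1
    then have ae: "AE \<omega> in M. Z \<omega> ^ (2 * n) = 0 ^ (2 * n)" for n by auto
    have "integrable M (\<lambda>\<omega>. Z \<omega> ^ (2 * n))" "expectation (\<lambda>\<omega>. Z \<omega> ^ (2 * n)) = 0 ^ (2 * n)" for n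
      using integrable_cong_AE[OF _ _ ae] integral_cong_AE[OF _ _ ae] by (auto simp: prob_space)
    from this[of q] this(2)[of 1] show ?thesis by (cases q) auto
  next
    case 2
    from distributed_normal_even_moment[OF 2(2,1), of q] distributed_normal_even_moment[OF 2(2,1), of 1]
    show ?thesis by simp
  qed
  then show "integrable M (\<lambda>\<omega>. Z \<omega> ^ (2 * q))"
    and "expectation (\<lambda>\<omega>. Z \<omega> ^ (2 * q)) = fact (2 * q) / (2 ^ q * fact q) * (expectation (\<lambda>\<omega>. (Z \<omega>)\<^sup>2)) ^ q"
    by auto
qed

lemma (in prob_space) centered_gaussian_char:
  assumes "centered_gaussian_rv M Z"
  shows "(\<integral>\<omega>. iexp (Z \<omega>) \<partial>M) = complex_of_real (exp (- expectation (\<lambda>\<omega>. (Z \<omega>)\<^sup>2) / 2))"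
proof -
  have [measurable]: "Z \<in> borel_measurable M" using assms by (simp add: centered_gaussian_rv_def)
  consider "AE \<omega> in M. Z \<omega> = 0" | \<sigma> where "\<sigma> > 0" "distributed M lborel Z (normal_density 0 \<sigma>)"
    using assms by (auto simp: centered_gaussian_rv_def)
  then show ?thesis
  proof cases
    case 1
    have "(\<integral>\<omega>. iexp (Z \<omega>) \<partial>M) = (\<integral>\<omega>. 1 \<partial>M)"
      by (rule integral_cong_AE) (use 1 in auto)
    moreover have "expectation (\<lambda>\<omega>. (Z \<omega>)\<^sup>2) = expectation (\<lambda>\<omega>. 0)"
      by (rule integral_cong_AE) (use 1 in auto)
    ultimately show ?thesis by (simp add: prob_space)
  next
    case 2
    from distributed_normal_even_moment(2)[OF 2(2,1), of 1] distributed_normal_char[OF 2(2,1)]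
    show ?thesis by simp
  qed
qed

text \<open>The covariance of the increments over \<open>[a, b]\<close> and \<open>[c, d]\<close>.
  The terms that involve a single time cancel, so only time differences remain: the increments are
  stationary.\<close>

definition incr_cov :: "real \<Rightarrow> real \<Rightarrow> real \<Rightarrow> real \<Rightarrow> real \<Rightarrow> real" where
  "incr_cov H a b c d = (\<bar>a - d\<bar> powr (2*H) + \<bar>b - c\<bar> powr (2*H) - \<bar>b - d\<bar> powr (2*H) - \<bar>a - c\<bar> powr (2*H)) / 2"

lemma incr_cov_self: "incr_cov H a b a b = (\<bar>b - a\<bar> powr H)\<^sup>2"
  by (simp add: incr_cov_def abs_minus_commute power2_eq_square flip: powr_add)

lemma incr_cov_sym: "incr_cov H c d a b = incr_cov H a b c d"
  by (simp add: incr_cov_def abs_minus_commute)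

locale fractional_brownian_motion =
  fixes M :: "'a measure" and H :: real and B :: "real \<Rightarrow> 'a \<Rightarrow> real"
  assumes H_pos: "0 < H" and H_less_1: "H < 1" and fbm: "fbm M H B"
begin

sublocale prob_space M
  using fbm by (simp add: fbm_def)

lemma B_measurable: "0 \<le> t \<Longrightarrow> B t \<in> borel_measurable M"
  using fbm by (simp add: fbm_def)

lemma gaussian_sum:
  "finite T \<Longrightarrow> T \<subseteq> {0..} \<Longrightarrow> centered_gaussian_rv M (\<lambda>\<omega>. \<Sum>t\<in>T. c t * B t \<omega>)"
  using fbm by (simp add: fbm_def)

lemma B_covariance:
  "0 \<le> s \<Longrightarrow> 0 \<le> t \<Longrightarrow> expectation (\<lambda>\<omega>. B s \<omega> * B t \<omega>)
     = (\<bar>s\<bar> powr (2*H) + \<bar>t\<bar> powr (2*H) - \<bar>s - t\<bar> powr (2*H)) / 2"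
  using fbm by (simp add: fbm_def)

text \<open>The value of a Bochner integral does not imply integrability; this comes from the
  Gaussian second moments. Expanding the covariance of two increments depends on it.\<close>

lemma B_prod_integrable:
  assumes "0 \<le> s" "0 \<le> t"
  shows "integrable M (\<lambda>\<omega>. B s \<omega> * B t \<omega>)"
proof -
  note [measurable] = B_measurable[OF assms(1)] B_measurable[OF assms(2)]
  have sq: "integrable M (\<lambda>\<omega>. (B t \<omega>)\<^sup>2)" if "0 \<le> t" for t
    using centered_gaussian_even_moment(1)[OF gaussian_sum[of "{t}" "\<lambda>_. 1"], of 1] that by simp
  show ?thesis
  proof (rule Bochner_Integration.integrable_bound)
    show "integrable M (\<lambda>\<omega>. (B s \<omega>)\<^sup>2 + (B t \<omega>)\<^sup>2)"
      using sq assms by simp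
    show "AE \<omega> in M. norm (B s \<omega> * B t \<omega>) \<le> norm ((B s \<omega>)\<^sup>2 + (B t \<omega>)\<^sup>2)"
    proof (rule AE_I2)
      fix \<omega>
      have "2 * (\<bar>B s \<omega>\<bar> * \<bar>B t \<omega>\<bar>) \<le> \<bar>B s \<omega>\<bar>\<^sup>2 + \<bar>B t \<omega>\<bar>\<^sup>2"
        using sum_squares_bound[of "\<bar>B s \<omega>\<bar>" "\<bar>B t \<omega>\<bar>"] by simp
      moreover have "0 \<le> \<bar>B s \<omega>\<bar> * \<bar>B t \<omega>\<bar>" by simp
      ultimately have "\<bar>B s \<omega>\<bar> * \<bar>B t \<omega>\<bar> \<le> (B s \<omega>)\<^sup>2 + (B t \<omega>)\<^sup>2"
        unfolding power2_abs by linarith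
      then show "norm (B s \<omega> * B t \<omega>) \<le> norm ((B s \<omega>)\<^sup>2 + (B t \<omega>)\<^sup>2)" by (simp add: abs_mult)
    qed
  qed measurable
qed

definition incr :: "real \<Rightarrow> real \<Rightarrow> 'a \<Rightarrow> real" where
  "incr s t \<omega> = B t \<omega> - B s \<omega>"

lemma incr_measurable: "0 \<le> s \<Longrightarrow> 0 \<le> t \<Longrightarrow> incr s t \<in> borel_measurable M"
  unfolding incr_def[abs_def] using B_measurable by (intro borel_measurable_diff) auto

lemma incr_prod_integrable:
  assumes "0 \<le> a" "0 \<le> b" "0 \<le> c" "0 \<le> d"
  shows "integrable M (\<lambda>\<omega>. incr a b \<omega> * incr c d \<omega>)"
    and incr_covariance: "expectation (\<lambda>\<omega>. incr a b \<omega> * incr c d \<omega>) = incr_cov H a b c d"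
proof -
  have e: "incr a b \<omega> * incr c d \<omega> = B b \<omega> * B d \<omega> - B b \<omega> * B c \<omega> - (B a \<omega> * B d \<omega> - B a \<omega> * B c \<omega>)" for \<omega>
    by (simp add: incr_def algebra_simps)
  note int = B_prod_integrable
  show "integrable M (\<lambda>\<omega>. incr a b \<omega> * incr c d \<omega>)"
    unfolding e using assms by (intro Bochner_Integration.integrable_diff int) auto
  have "expectation (\<lambda>\<omega>. incr a b \<omega> * incr c d \<omega>) = 
     expectation (\<lambda>\<omega>. B b \<omega> * B d \<omega>) - expectation (\<lambda>\<omega>. B b \<omega> * B c \<omega>) - (expectation (\<lambda>\<omega>. B a \<omega> * B d \<omega>) - expectation (\<lambda>\<omega>. B a \<omega> * B c \<omega>))"
    unfolding e using assms by (simp add: int)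
  then show "expectation (\<lambda>\<omega>. incr a b \<omega> * incr c d \<omega>) = incr_cov H a b c d"
    using assms by (simp add: B_covariance incr_cov_def field_simps)
qed

text \<open>The Gaussian hypothesis concerns sums over distinct times, whereas endpoints of
  increments may coincide. The coefficient of \<open>t\<close> therefore collects all increments
  that end or start at \<open>t\<close>.\<close>

lemma incr_gaussian:
  fixes a b p :: "'i \<Rightarrow> real"
  assumes I: "finite I" and ab: "\<And>i. i \<in> I \<Longrightarrow> 0 \<le> a i" "\<And>i. i \<in> I \<Longrightarrow> 0 \<le> b i"
  shows "centered_gaussian_rv M (\<lambda>\<omega>. \<Sum>i\<in>I. p i * incr (a i) (b i) \<omega>)"
proof -
  let ?T = "a ` I \<union> b ` I"
  let ?c = "\<lambda>t. \<Sum>i\<in>I. (if t = b i then p i else 0) - (if t = a i then p i else 0)"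
  have "(\<Sum>t\<in>?T. ?c t * B t \<omega>) = (\<Sum>i\<in>I. p i * incr (a i) (b i) \<omega>)" for \<omega>
  proof -
    have "(\<Sum>t\<in>?T. ?c t * B t \<omega>) = (\<Sum>i\<in>I. \<Sum>t\<in>?T. ((if t = b i then p i else 0) - (if t = a i then p i else 0)) * B t \<omega>)"
      by (simp only: sum_distrib_right) (rule sum.swap)
    also have "\<dots> = (\<Sum>i\<in>I. p i * incr (a i) (b i) \<omega>)"
    proof (rule sum.cong[OF refl])
      fix i assume i: "i \<in> I"
      have "(\<Sum>t\<in>?T. ((if t = b i then p i else 0) - (if t = a i then p i else 0)) * B t \<omega>)
        = (\<Sum>t\<in>?T. (if t = b i then p i * B t \<omega> else 0) - (if t = a i then p i * B t \<omega> else 0))"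
        by (intro sum.cong) (auto simp: algebra_simps)
      also have "\<dots> = p i * B (b i) \<omega> - p i * B (a i) \<omega>"
        using I i by (simp add: sum_subtractf)
      finally show "(\<Sum>t\<in>?T. ((if t = b i then p i else 0) - (if t = a i then p i else 0)) * B t \<omega>) = p i * incr (a i) (b i) \<omega>"
        by (simp add: incr_def algebra_simps)
    qed
    finally show ?thesis .
  qed
  with gaussian_sum[of ?T ?c] I ab show ?thesis by (simp add: image_subset_iff)
qed

lemma incr_char:
  fixes a b p :: "'i \<Rightarrow> real"
  assumes I: "finite I" and ab: "\<And>i. i \<in> I \<Longrightarrow> 0 \<le> a i" "\<And>i. i \<in> I \<Longrightarrow> 0 \<le> b i"
  shows "(\<integral>\<omega>. iexp (\<Sum>i\<in>I. p i * incr (a i) (b i) \<omega>) \<partial>M)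
     = complex_of_real (exp (- (\<Sum>i\<in>I. \<Sum>j\<in>I. p i * p j * incr_cov H (a i) (b i) (a j) (b j)) / 2))"
proof -
  have "expectation (\<lambda>\<omega>. (\<Sum>i\<in>I. p i * incr (a i) (b i) \<omega>)\<^sup>2)
     = expectation (\<lambda>\<omega>. \<Sum>i\<in>I. \<Sum>j\<in>I. p i * p j * (incr (a i) (b i) \<omega> * incr (a j) (b j) \<omega>))"
    by (simp add: power2_eq_square sum_product mult_ac)
  also have "\<dots> = (\<Sum>i\<in>I. \<Sum>j\<in>I. p i * p j * incr_cov H (a i) (b i) (a j) (b j))"
    by (subst Bochner_Integration.integral_sum, force simp: ab intro!: incr_prod_integrable Bochner_Integration.integrable_sum integrable_mult_right)
       (simp add: ab incr_prod_integrable incr_covariance)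
  finally show ?thesis using centered_gaussian_char[OF incr_gaussian[OF assms]] by simp
qed

text \<open>The scale \<open>w i\<close> fixes the width of the window for the increment. The
  hypothesis on covariances is a bound on correlations, which is unaffected by scaling; only the
  bounds on the right carry \<open>w\<close>.\<close>

lemma incr_tent_decoupling:
  fixes a b w y :: "'i \<Rightarrow> real" and \<eta> :: real
  assumes I: "finite I" and ab: "\<And>i. i \<in> I \<Longrightarrow> 0 \<le> a i" "\<And>i. i \<in> I \<Longrightarrow> 0 \<le> b i" "\<And>i. i \<in> I \<Longrightarrow> a i \<noteq> b i"
    and w: "\<And>i. i \<in> I \<Longrightarrow> 0 < w i"
    and off: "\<And>i j. i \<in> I \<Longrightarrow> j \<in> I \<Longrightarrow> i \<noteq> j \<Longrightarrow>
      \<bar>incr_cov H (a i) (b i) (a j) (b j)\<bar> \<le> \<eta> * \<bar>b i - a i\<bar> powr H * \<bar>b j - a j\<bar> powr H"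
    and \<eta>: "0 \<le> \<eta>" "card I * \<eta> \<le> 1/2"
  shows "\<bar>expectation (\<lambda>\<omega>. \<Prod>i\<in>I. tent (w i * incr (a i) (b i) \<omega> - y i)) - (\<Prod>i\<in>I. expectation (\<lambda>\<omega>. tent (w i * incr (a i) (b i) \<omega> - y i)))\<bar>
     \<le> 4 * (card I * \<eta>) * (\<Prod>i\<in>I. 1 / (w i * \<bar>b i - a i\<bar> powr H))"
    and "\<And>i. i \<in> I \<Longrightarrow> expectation (\<lambda>\<omega>. tent (w i * incr (a i) (b i) \<omega> - y i)) \<le> 1 / (w i * \<bar>b i - a i\<bar> powr H)"
proof -
  let ?C = "\<lambda>i j. w i * w j * incr_cov H (a i) (b i) (a j) (b j)"
  have 1: "(\<lambda>\<omega>. w i * incr (a i) (b i) \<omega>) \<in> borel_measurable M" if "i \<in> I" for i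
    using incr_measurable[of "a i" "b i"] ab that by simp
  have 2: "(\<integral>\<omega>. iexp (\<Sum>i\<in>I. p i * (w i * incr (a i) (b i) \<omega>)) \<partial>M)
     = complex_of_real (exp (- (\<Sum>i\<in>I. \<Sum>j\<in>I. p i * p j * ?C i j) / 2))" for p
    using incr_char[OF I ab(1,2), where p = "\<lambda>i. p i * w i"] by (simp add: mult_ac)
  have 3: "?C i i = (w i * \<bar>b i - a i\<bar> powr H)\<^sup>2" for i
    by (simp add: incr_cov_self power_mult_distrib power2_eq_square mult_ac)
  have 4: "\<bar>?C i j\<bar> \<le> \<eta> * (w i * \<bar>b i - a i\<bar> powr H) * (w j * \<bar>b j - a j\<bar> powr H)"
    if "i \<in> I" "j \<in> I" "i \<noteq> j" for i j
    using mult_left_mono[OF off[OF that], of "w i * w j"] w[OF that(1)] w[OF that(2)]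
    by (simp add: abs_mult mult_ac)
  have 5: "0 < w i * \<bar>b i - a i\<bar> powr H" if "i \<in> I" for i
    using w[OF that] ab(3)[OF that] by simp
  note * = gaussian_tent_decoupling[OF I 1 2 3 4 5 \<eta>, where y = y]
  show "\<bar>expectation (\<lambda>\<omega>. \<Prod>i\<in>I. tent (w i * incr (a i) (b i) \<omega> - y i)) - (\<Prod>i\<in>I. expectation (\<lambda>\<omega>. tent (w i * incr (a i) (b i) \<omega> - y i)))\<bar>
     \<le> 4 * (card I * \<eta>) * (\<Prod>i\<in>I. 1 / (w i * \<bar>b i - a i\<bar> powr H))"
    using *(1) by simp
  show "\<And>i. i \<in> I \<Longrightarrow> expectation (\<lambda>\<omega>. tent (w i * incr (a i) (b i) \<omega> - y i)) \<le> 1 / (w i * \<bar>b i - a i\<bar> powr H)"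
    using *(2) by simp
qed

end

section \<open>Covariance estimates for pairs of increments\<close>

lemma powr_one_plus_bounds:
  fixes r s :: real
  assumes "0 \<le> r" "r \<le> 1" "0 \<le> s" "s \<le> 2"
  shows "1 \<le> (1 + r) powr s" "(1 + r) powr s \<le> 1 + 3 * r"
proof -
  show "1 \<le> (1 + r) powr s" using assms by (intro ge_one_powr_ge_zero) auto
  have "(1 + r) powr s \<le> (1 + r) powr 2" using assms by (intro powr_mono) auto
  also have "\<dots> = (1 + r)\<^sup>2" using assms by simp
  also have "\<dots> = 1 + (2 + r) * r" by (simp add: power2_eq_square algebra_simps)
  also have "\<dots> \<le> 1 + 3 * r" using assms by (intro add_left_mono mult_right_mono) auto
  finally show "(1 + r) powr s \<le> 1 + 3 * r" .
qed

text \<open>Let \<open>r = m / k\<close>. The difference is of first order in \<open>r\<close>,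
  hence at most \<open>3 * r powr (1 - H)\<close> in units of \<open>k powr H * m powr H\<close>,
  and \<open>m powr (2*H)\<close> equals \<open>r powr H\<close> in these units. The worse of the
  two exponents is \<open>min H (1 - H)\<close>.\<close>

lemma powr_shift_diff_bound:
  fixes k m H :: real
  assumes "0 < H" "H < 1" "0 < m" "m \<le> k"
  shows "\<bar>(k + m) powr (2*H) - k powr (2*H)\<bar> + m powr (2*H)
    \<le> 4 * (m / k) powr (min H (1 - H)) * (k powr H * m powr H)"
proof -
  let ?r = "m / k" and ?d = "min H (1 - H)"
  have k: "0 < k" and r: "0 < ?r" "?r \<le> 1" using assms by auto
  have km: "k + m = k * (1 + ?r)" using k by (simp add: field_simps)
  have "(k + m) powr (2*H) = k powr (2*H) * (1 + ?r) powr (2*H)"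
    using km powr_mult[of k "1 + ?r" "2*H"] k assms(3) by simp
  then have "(k + m) powr (2*H) - k powr (2*H) = k powr (2*H) * ((1 + ?r) powr (2*H) - 1)"
    by (simp add: algebra_simps)
  then have "\<bar>(k + m) powr (2*H) - k powr (2*H)\<bar> = k powr (2*H) * ((1 + ?r) powr (2*H) - 1)"
    using powr_one_plus_bounds(1)[of ?r "2*H"] assms r by (simp add: abs_mult)
  also have "\<dots> \<le> k powr (2*H) * (3 * ?r)"
    using powr_one_plus_bounds(2)[of ?r "2*H"] assms r by (intro mult_left_mono) auto
  also have "\<dots> = 3 * ?r powr (1 - H) * (k powr H * m powr H)"
  proof -
    have "m powr H = k powr H * ?r powr H" using powr_mult[of k ?r H] k r assms by simp
    moreover have "?r powr (1 - H) * ?r powr H = ?r" using k assms(3) by (simp flip: powr_add)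
    moreover have "k powr (2*H) = k powr H * k powr H" by (simp flip: powr_add)
    ultimately show ?thesis by (simp add: mult_ac)
  qed
  also have "\<dots> \<le> 3 * ?r powr ?d * (k powr H * m powr H)"
    using r by (intro mult_right_mono mult_left_mono powr_mono') auto
  finally have 1: "\<bar>(k + m) powr (2*H) - k powr (2*H)\<bar> \<le> 3 * ?r powr ?d * (k powr H * m powr H)" .
  have "m powr (2*H) = ?r powr H * (k powr H * m powr H)"
  proof -
    have "m powr H = k powr H * ?r powr H" using powr_mult[of k ?r H] k r assms by simp
    moreover have "m powr (2*H) = m powr H * m powr H" by (simp flip: powr_add)
    ultimately show ?thesis by (simp add: mult_ac)
  qed
  also have "\<dots> \<le> ?r powr ?d * (k powr H * m powr H)"
    using r by (intro mult_right_mono powr_mono') auto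
  finally show ?thesis using 1 by (simp add: algebra_simps)
qed

lemma incr_cov_adjacent:
  assumes "0 < H" "H < 1" "0 < m" "m \<le> k"
  shows "\<bar>incr_cov H 0 k k (k + m)\<bar> \<le> 2 * (m / k) powr (min H (1 - H)) * (k powr H * m powr H)"
  using powr_shift_diff_bound[OF assms] assms
  by (simp add: incr_cov_def add.commute) (use powr_ge_zero[of m "2*H"] in linarith)

lemma incr_cov_origin_bound:
  assumes "0 < H" "H < 1" "0 < a" "2 * a \<le> l"
  shows "\<bar>incr_cov H 0 a 0 l\<bar> \<le> 2 * (a / (l - a)) powr (min H (1 - H)) * (a powr H * l powr H)"
proof -
  have "2 * \<bar>incr_cov H 0 a 0 l\<bar> \<le> \<bar>((l - a) + a) powr (2*H) - (l - a) powr (2*H)\<bar> + a powr (2*H)"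
    using assms by (simp add: incr_cov_def abs_minus_commute) (use powr_ge_zero[of a "2*H"] in linarith)
  also have "\<dots> \<le> 4 * (a / (l - a)) powr (min H (1 - H)) * ((l - a) powr H * a powr H)"
    using assms by (intro powr_shift_diff_bound) auto
  also have "\<dots> \<le> 4 * (a / (l - a)) powr (min H (1 - H)) * (l powr H * a powr H)"
    using assms by (intro mult_left_mono mult_right_mono powr_mono2) auto
  finally show ?thesis by (simp add: mult_ac)
qed

text \<open>Up to sign and the factor 1/2 the covariance is a mixed second difference of
  \<open>x powr (2*H)\<close>, so the mean value theorem applies twice. The exponent
  \<open>2*H - 2\<close> is negative for every \<open>H < 1\<close>, so the bound tends to 0 as
  \<open>l\<close> grows even under long-range dependence.\<close>

lemma incr_cov_origin_step_bound:
  assumes "0 < H" "H < 1" "0 < a" "a < l"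
  shows "\<bar>incr_cov H 0 a l (l + 1)\<bar> \<le> a * (l - a) powr (2*H - 2)"
proof -
  define \<phi> where "\<phi> x = x powr (2*H) - (x - a) powr (2*H)" for x
  define \<phi>' where "\<phi>' x = 2*H * (x powr (2*H - 1) - (x - a) powr (2*H - 1))" for x
  have d1: "DERIV \<phi> x :> \<phi>' x" if "x > a" for x
    unfolding \<phi>_def \<phi>'_def using that assms
    by (auto intro!: derivative_eq_intros simp: powr_diff field_simps)
  obtain \<xi> where \<xi>: "l < \<xi>" "\<xi> < l + 1" "\<phi> (l + 1) - \<phi> l = \<phi>' \<xi>"
    using MVT2[of l "l + 1" \<phi> \<phi>'] d1 assms by auto
  have "DERIV (\<lambda>x. x powr (2*H - 1)) x :> (2*H - 1) * x powr (2*H - 2)" if "x > 0" for x :: real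
    using has_real_derivative_powr[OF that, of "2*H - 1"] by simp
  then obtain \<zeta> where \<zeta>: "\<xi> - a < \<zeta>" "\<zeta> < \<xi>" "\<xi> powr (2*H - 1) - (\<xi> - a) powr (2*H - 1) = a * ((2*H - 1) * \<zeta> powr (2*H - 2))"
    using MVT2[of "\<xi> - a" \<xi> "\<lambda>x. x powr (2*H - 1)" "\<lambda>x. (2*H - 1) * x powr (2*H - 2)"] assms \<xi> by auto
  have "2 * \<bar>incr_cov H 0 a l (l + 1)\<bar> = \<bar>\<phi> (l + 1) - \<phi> l\<bar>"
    using assms by (simp add: incr_cov_def \<phi>_def abs_minus_commute algebra_simps)
  also have "\<dots> = 2*H * \<bar>2*H - 1\<bar> * (a * \<zeta> powr (2*H - 2))"
    unfolding \<xi>(3) \<phi>'_def \<zeta>(3) using assms by (simp add: abs_mult)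
  also have "\<dots> \<le> 2 * 1 * (a * \<zeta> powr (2*H - 2))"
    using assms by (intro mult_right_mono mult_mono) auto
  also have "\<dots> \<le> 2 * 1 * (a * (l - a) powr (2*H - 2))"
    using assms \<zeta> \<xi> by (intro mult_left_mono powr_mono2') auto
  finally show ?thesis by simp
qed

section \<open>Lower and upper bounds for covering sums\<close>

text \<open>Distances are measured in units of the shell size \<open>N\<close>; the added 1 keeps
  the diagonal finite, at the resolution of unit intervals. The lower bound drawn from it is a
  discrete energy method in the style of Frostman.\<close>

definition riesz_energy :: "real \<Rightarrow> real \<Rightarrow> nat set \<Rightarrow> (nat \<Rightarrow> real) \<Rightarrow> real" where
  "riesz_energy N \<rho> T \<xi> = (\<Sum>k\<in>T. \<Sum>l\<in>T. \<xi> k * \<xi> l * ((\<bar>real k - real l\<bar> + 1) / N) powr (- \<rho>))"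

lemma riesz_energy_nonneg: "(\<And>k. 0 \<le> \<xi> k) \<Longrightarrow> 0 \<le> riesz_energy N \<rho> T \<xi>"
  unfolding riesz_energy_def by (intro sum_nonneg mult_nonneg_nonneg) auto

text \<open>A point of \<open>E\<close> in \<open>[k, k+1]\<close> and in an integer interval \<open>I\<close> puts \<open>k\<close> within one unit of \<open>I\<close>;
  the factor 3 absorbs this, since \<open>I\<close> has length at least one.\<close>

lemma nu_ge_energy:
  assumes \<rho>: "0 \<le> \<rho>" "\<rho> \<le> 1" and T: "finite T"
    and shell: "\<And>k. k \<in> T \<Longrightarrow> {real k .. real k + 1} \<subseteq> shell n"
    and \<xi>: "\<And>k. 0 \<le> \<xi> k"
    and hit: "\<And>k. k \<in> T \<Longrightarrow> 0 < \<xi> k \<Longrightarrow> \<exists>t\<in>E. real k \<le> t \<and> t \<le> real k + 1"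
  shows "ennreal ((\<Sum>k\<in>T. \<xi> k)\<^sup>2 / (3 * riesz_energy (2 powr real_of_int n) \<rho> T \<xi>)) \<le> nu n \<rho> E"
  unfolding nu_def
proof (rule INF_greatest)
  fix F assume F: "F \<in> admissible_covers n E"
  define N where "N = 2 powr real_of_int n"
  have N: "0 < N" by (simp add: N_def)
  let ?En = "riesz_energy N \<rho> T \<xi>"
  define d where "d I = real (snd I) - real (fst I)" for I :: "nat \<times> nat"
  have finF: "finite F" and dF: "1 \<le> d I" if "I \<in> F" for I
    using F that by (auto simp: admissible_covers_def d_def)
  have finF: "finite F" using F by (simp add: admissible_covers_def)
  have cover: "E \<inter> shell n \<subseteq> (\<Union>(x,y)\<in>F. {real x .. real y})"
    using F by (simp add: admissible_covers_def)
  define T' where "T' = {k \<in> T. 0 < \<xi> k}"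
  have finT': "finite T'" using T by (simp add: T'_def)
  have "\<exists>I\<in>F. real (fst I) \<le> real k + 1 \<and> real k \<le> real (snd I)" if k: "k \<in> T'" for k
  proof -
    from k hit obtain t where t: "t \<in> E" "real k \<le> t" "t \<le> real k + 1" by (auto simp: T'_def)
    with shell[of k] k have "t \<in> E \<inter> shell n" by (auto simp: T'_def)
    with cover obtain I where "I \<in> F" "real (fst I) \<le> t" "t \<le> real (snd I)" by auto
    with t show ?thesis by (intro bexI[of _ I]) auto
  qed
  \<comment> \<open>Each index of positive weight is assigned to a single interval of the cover, so
    overlapping intervals cause no double counting in the sums over \<open>TI\<close>.\<close>
  then obtain J where J: "\<And>k. k \<in> T' \<Longrightarrow> J k \<in> F"
    "\<And>k. k \<in> T' \<Longrightarrow> real (fst (J k)) \<le> real k + 1"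
    "\<And>k. k \<in> T' \<Longrightarrow> real k \<le> real (snd (J k))" by metis
  define TI where "TI I = {k \<in> T'. J k = I}" for I
  have finTI: "finite (TI I)" for I using finT' by (simp add: TI_def)
  define e where "e I = (\<Sum>k\<in>TI I. \<Sum>l\<in>TI I. \<xi> k * \<xi> l * ((\<bar>real k - real l\<bar> + 1) / N) powr (- \<rho>))" for I
  have e0: "0 \<le> e I" for I unfolding e_def by (intro sum_nonneg mult_nonneg_nonneg \<xi>) auto
  \<comment> \<open>Two indices assigned to the same interval are so close that the kernel is at
    least \<open>(3 * d I / N) powr (- \<rho>)\<close>; hence the squared local mass is controlled
    by the local energy.\<close>
  have local_bound: "(\<Sum>k\<in>TI I. \<xi> k)\<^sup>2 \<le> e I * (3 * d I / N) powr \<rho>" if I: "I \<in> F" for I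
  proof -
    have "(\<Sum>k\<in>TI I. \<xi> k)\<^sup>2 = (\<Sum>k\<in>TI I. \<Sum>l\<in>TI I. \<xi> k * \<xi> l)"
      by (simp add: power2_eq_square sum_product)
    also have "\<dots> \<le> (\<Sum>k\<in>TI I. \<Sum>l\<in>TI I. \<xi> k * \<xi> l * (((\<bar>real k - real l\<bar> + 1) / N) powr (- \<rho>) * (3 * d I / N) powr \<rho>))"
    proof (intro sum_mono)
      fix k l assume kl: "k \<in> TI I" "l \<in> TI I"
      have kl': "k \<in> T'" "l \<in> T'" "J k = I" "J l = I" using kl by (auto simp: TI_def)
      have "\<bar>real k - real l\<bar> \<le> d I + 1"
        using J(2,3)[OF kl'(1)] J(2,3)[OF kl'(2)] kl'(3,4) by (auto simp: d_def)
      then have "\<bar>real k - real l\<bar> + 1 \<le> 3 * d I" using dF[OF I] by linarith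
      then have "((\<bar>real k - real l\<bar> + 1) / N) powr \<rho> \<le> (3 * d I / N) powr \<rho>"
        using N \<rho> by (intro powr_mono2 divide_right_mono) auto
      moreover have "0 < ((\<bar>real k - real l\<bar> + 1) / N) powr \<rho>" using N by simp
      ultimately have "1 \<le> ((\<bar>real k - real l\<bar> + 1) / N) powr (- \<rho>) * (3 * d I / N) powr \<rho>"
        by (simp add: powr_minus field_simps)
      then show "\<xi> k * \<xi> l \<le> \<xi> k * \<xi> l * (((\<bar>real k - real l\<bar> + 1) / N) powr (- \<rho>) * (3 * d I / N) powr \<rho>)"
        using \<xi>[of k] \<xi>[of l] mult_left_mono[of 1 _ "\<xi> k * \<xi> l"] by simp
    qed
    also have "\<dots> = e I * (3 * d I / N) powr \<rho>"
      by (simp add: e_def sum_distrib_right mult.assoc)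
    finally show ?thesis .
  qed
  have "(\<Sum>k\<in>T. \<xi> k) = (\<Sum>k\<in>T'. \<xi> k)"
    using T \<xi> by (intro sum.mono_neutral_right) (auto simp: T'_def less_le)
  also have "\<dots> = (\<Sum>I\<in>F. \<Sum>k\<in>TI I. \<xi> k)"
    unfolding TI_def using finT' finF J(1) by (intro sum.group[symmetric]) auto
  also have "\<dots> \<le> (\<Sum>I\<in>F. sqrt (e I) * sqrt ((3 * d I / N) powr \<rho>))"
    using local_bound by (intro sum_mono) (simp add: real_le_rsqrt flip: real_sqrt_mult)
  finally have "(\<Sum>k\<in>T. \<xi> k)\<^sup>2 \<le> (\<Sum>I\<in>F. sqrt (e I) * sqrt ((3 * d I / N) powr \<rho>))\<^sup>2"
    using \<xi> by (intro power_mono sum_nonneg) auto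
  also have "\<dots> \<le> (\<Sum>I\<in>F. (sqrt (e I))\<^sup>2) * (\<Sum>I\<in>F. (sqrt ((3 * d I / N) powr \<rho>))\<^sup>2)"
    by (rule Cauchy_Schwarz_ineq_sum)
  also have "\<dots> = (\<Sum>I\<in>F. e I) * (\<Sum>I\<in>F. (3 * d I / N) powr \<rho>)"
    using e0 by simp
  also have "\<dots> \<le> ?En * (3 * (\<Sum>I\<in>F. (d I / N) powr \<rho>))"
  proof (intro mult_mono)
    have "(\<Sum>I\<in>F. e I) = (\<Sum>I\<in>F. \<Sum>k\<in>TI I. \<Sum>l\<in>{l \<in> T'. J l = J k}. \<xi> k * \<xi> l * ((\<bar>real k - real l\<bar> + 1) / N) powr (- \<rho>))"
      unfolding e_def by (intro sum.cong refl) (auto simp: TI_def)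
    also have "\<dots> = (\<Sum>k\<in>T'. \<Sum>l\<in>{l \<in> T'. J l = J k}. \<xi> k * \<xi> l * ((\<bar>real k - real l\<bar> + 1) / N) powr (- \<rho>))"
      unfolding TI_def using finT' finF J(1) by (intro sum.group) auto
    also have "\<dots> \<le> (\<Sum>k\<in>T'. \<Sum>l\<in>T. \<xi> k * \<xi> l * ((\<bar>real k - real l\<bar> + 1) / N) powr (- \<rho>))"
      using T \<xi> by (intro sum_mono sum_mono2) (auto simp: T'_def)
    also have "\<dots> \<le> ?En"
      unfolding riesz_energy_def using T \<xi> by (intro sum_mono2 sum_nonneg mult_nonneg_nonneg) (auto simp: T'_def)
    finally show "(\<Sum>I\<in>F. e I) \<le> ?En" .
    have "(3 * d I / N) powr \<rho> \<le> 3 * (d I / N) powr \<rho>" if "I \<in> F" for I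
    proof -
      have "(3 * d I / N) powr \<rho> = 3 powr \<rho> * (d I / N) powr \<rho>" by (simp add: powr_mult flip: times_divide_eq_right)
      also have "\<dots> \<le> 3 powr 1 * (d I / N) powr \<rho>" using \<rho> by (intro mult_right_mono powr_mono) auto
      finally show ?thesis by simp
    qed
    then show "(\<Sum>I\<in>F. (3 * d I / N) powr \<rho>) \<le> 3 * (\<Sum>I\<in>F. (d I / N) powr \<rho>)"
      unfolding sum_distrib_left by (rule sum_mono)
  qed (auto intro!: sum_nonneg riesz_energy_nonneg \<xi>)
  finally have main: "(\<Sum>k\<in>T. \<xi> k)\<^sup>2 \<le> ?En * (3 * (\<Sum>I\<in>F. (d I / N) powr \<rho>))" .
  \<comment> \<open>If the energy vanishes, the quotient is 0 by division by zero.\<close>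
  have "(\<Sum>k\<in>T. \<xi> k)\<^sup>2 / (3 * ?En) \<le> (\<Sum>I\<in>F. (d I / N) powr \<rho>)"
  proof (cases "?En = 0")
    case False
    then have "0 < ?En" using riesz_energy_nonneg[of \<xi> N \<rho> T, OF \<xi>] by linarith
    then show ?thesis using main by (simp add: divide_le_eq mult_ac)
  qed (auto intro!: sum_nonneg)
  then have "ennreal ((\<Sum>k\<in>T. \<xi> k)\<^sup>2 / (3 * ?En)) \<le> ennreal (\<Sum>I\<in>F. (d I / N) powr \<rho>)"
    by (rule ennreal_leI)
  also have "\<dots> = (\<Sum>I\<in>F. ennreal ((d I / N) powr \<rho>))" by (simp add: sum_ennreal)
  also have "\<dots> = (\<Sum>(x,y)\<in>F. ennreal (((real y - real x) / N) powr \<rho>))"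
    by (simp add: d_def case_prod_beta)
  finally show "ennreal ((\<Sum>k\<in>T. \<xi> k)\<^sup>2 / (3 * riesz_energy (2 powr real_of_int n) \<rho> T \<xi>))
    \<le> (\<Sum>(x,y)\<in>F. ennreal (((real y - real x) / 2 powr real_of_int n) powr \<rho>))"
    unfolding N_def .
qed

lemma nu_le_card:
  assumes "0 \<le> \<rho>" and K: "finite K"
    and shell: "\<And>k. k \<in> K \<Longrightarrow> {real k .. real k + 1} \<subseteq> closure (shell n)"
    and cover: "E \<inter> shell n \<subseteq> (\<Union>k\<in>K. {real k .. real k + 1})"
  shows "nu n \<rho> E \<le> ennreal (real (card K) * (2 powr real_of_int n) powr (- \<rho>))"
proof -
  let ?F = "(\<lambda>k. (k, Suc k)) ` K"
  have inj: "inj_on (\<lambda>k. (k, Suc k)) K" by (auto simp: inj_on_def)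
  have "?F \<in> admissible_covers n E"
    using K shell cover by (auto simp: admissible_covers_def add.commute)
  then have "nu n \<rho> E \<le> (\<Sum>(x,y)\<in>?F. ennreal (((real y - real x) / 2 powr (real_of_int n)) powr \<rho>))"
    unfolding nu_def by (rule INF_lower)
  also have "\<dots> = (\<Sum>k\<in>K. ennreal ((1 / 2 powr (real_of_int n)) powr \<rho>))"
    by (subst sum.reindex[OF inj]) simp
  also have "\<dots> = ennreal (real (card K) * (2 powr real_of_int n) powr (- \<rho>))"
    by (simp add: ennreal_of_nat_eq_real_of_nat powr_minus powr_divide inverse_eq_divide flip: ennreal_mult')
  finally show ?thesis .
qed

lemma shell_eq: "shell (int (Suc n)) = {2 ^ n ..< 2 ^ Suc n}"
  by (simp add: shell_def powr_realpow[symmetric] powr_add)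

lemma closure_shell: "closure (shell (int (Suc n))) = {2 ^ n .. 2 ^ Suc n}"
  unfolding shell_eq by (rule closure_atLeastLessThan) simp

text \<open>An admissible interval lies in the closure of the shell, so its normalized length is at
  most 1. Monotonicity in the exponent allows the dimension to be read off along countably many
  exponents.\<close>

lemma nu_antimono_exponent:
  assumes "\<rho>' \<le> \<rho>" 
  shows "nu (int n) \<rho> E \<le> nu (int n) \<rho>' E"
  unfolding nu_def
proof (rule INF_mono)
  fix F assume F: "F \<in> admissible_covers (int n) E"
  have "(case I of (x, y) \<Rightarrow> ennreal (((real y - real x) / 2 powr real_of_int (int n)) powr \<rho>))
     \<le> (case I of (x, y) \<Rightarrow> ennreal (((real y - real x) / 2 powr real_of_int (int n)) powr \<rho>'))" if I: "I \<in> F" for I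
  proof -
    obtain x y where xy: "I = (x, y)" by (cases I)
    have "x < y" "{real x .. real y} \<subseteq> closure (shell (int n))" using F I xy by (auto simp: admissible_covers_def)
    moreover have "closure (shell (int n)) \<subseteq> {0 .. 2 powr n}"
      by (rule closure_minimal) (auto simp: shell_def intro: order_trans[OF powr_ge_zero])
    moreover have "real y \<in> {real x .. real y}" using \<open>x < y\<close> by simp
    ultimately have "real y \<in> {0 .. 2 powr n}" "x < y" by (blast, simp)
    then have "real y \<le> 2 powr n" "x < y" by auto
    then show ?thesis unfolding xy using assms
      by (auto intro!: ennreal_leI powr_mono' simp: divide_simps)
  qed
  with F show "\<exists>G\<in>admissible_covers (int n) E.
      (\<Sum>(x, y)\<in>G. ennreal (((real y - real x) / 2 powr real_of_int (int n)) powr \<rho>))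
      \<le> (\<Sum>(x, y)\<in>F. ennreal (((real y - real x) / 2 powr real_of_int (int n)) powr \<rho>'))"
    by (intro bexI[of _ F] sum_mono) auto
qed

section \<open>Crossing weights\<close>

lemma ratio_powr_tendsto_0:
  fixes a d :: real
  assumes "0 < d" "0 < a"
  shows "(\<lambda>l::nat. (a / (real l - a)) powr d) \<longlonglongrightarrow> 0"
  using assms by real_asymp

lemma shifted_powr_tendsto_0:
  fixes a d :: real
  assumes "d < 0"
  shows "(\<lambda>l::nat. (real l - a) powr d) \<longlonglongrightarrow> 0"
  using assms by real_asymp

lemma inverse_powr_tendsto_0:
  fixes d :: real
  assumes "0 < d"
  shows "(\<lambda>l::nat. (1 / real l) powr d) \<longlonglongrightarrow> 0"
  using assms by real_asymp

context fractional_brownian_motion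
begin

lemma incr_normal:
  assumes "0 \<le> s" "0 \<le> t" "s \<noteq> t"
  shows "distributed M lborel (incr s t) (normal_density 0 (\<bar>t - s\<bar> powr H))"
proof -
  have g: "centered_gaussian_rv M (incr s t)"
    using incr_gaussian[of "{()}" "\<lambda>_. s" "\<lambda>_. t" "\<lambda>_. 1"] assms by simp
  note m[measurable] = incr_measurable[OF assms(1,2)]
  have v: "expectation (\<lambda>\<omega>. (incr s t \<omega>)\<^sup>2) = (\<bar>t - s\<bar> powr H)\<^sup>2"
    using incr_covariance[of s t s t] assms by (simp add: power2_eq_square[of "incr s t _"] incr_cov_self)
  have "\<not> (AE \<omega> in M. incr s t \<omega> = 0)"
  proof
    assume *: "AE \<omega> in M. incr s t \<omega> = 0"
    have "expectation (\<lambda>\<omega>. (incr s t \<omega>)\<^sup>2) = expectation (\<lambda>\<omega>. 0)"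
      by (rule integral_cong_AE) (use * in auto)
    with v assms show False by simp
  qed
  with g obtain \<sigma> where \<sigma>: "\<sigma> > 0" "distributed M lborel (incr s t) (normal_density 0 \<sigma>)"
    by (auto simp: centered_gaussian_rv_def)
  from distributed_normal_even_moment(2)[OF \<sigma>(2,1), of 1] v have "\<sigma>\<^sup>2 = (\<bar>t - s\<bar> powr H)\<^sup>2" by simp
  then have "\<sigma> = \<bar>t - s\<bar> powr H" using \<sigma>(1) by (simp add: power2_eq_iff_nonneg)
  with \<sigma>(2) show ?thesis by simp
qed

lemma expectation_tent_le:
  assumes "0 \<le> s" "0 \<le> t" "s \<noteq> t" "0 < w"
  shows "expectation (\<lambda>\<omega>. tent (w * incr s t \<omega> - y)) \<le> 1 / (w * \<bar>t - s\<bar> powr H)"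
  using incr_tent_decoupling(2)[of "{()}" "\<lambda>_. s" "\<lambda>_. t" "\<lambda>_. w" 0 "()" "\<lambda>_. y"] assms by simp

text \<open>Within distance 1/2 of \<open>y\<close> the tent is at least 1/2. Because the standard
  deviation is at least 1, the Gaussian factor there is at least its value at
  \<open>\<bar>y\<bar> + 1\<close> for standard deviation 1.\<close>

lemma expectation_tent_ge:
  assumes "0 \<le> s" "0 \<le> t" "1 \<le> \<bar>t - s\<bar>"
  shows "1 / (2 * sqrt (2 * pi)) * exp (- (\<bar>y\<bar> + 1)\<^sup>2 / 2) / \<bar>t - s\<bar> powr H
    \<le> expectation (\<lambda>\<omega>. tent (incr s t \<omega> - y))"
proof -
  let ?\<sigma> = "\<bar>t - s\<bar> powr H"
  have \<sigma>: "1 \<le> ?\<sigma>" using assms H_pos by (simp add: ge_one_powr_ge_zero)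
  have D: "distributed M lborel (incr s t) (normal_density 0 ?\<sigma>)"
    using assms by (intro incr_normal) auto
  let ?c = "1 / (sqrt (2 * pi) * ?\<sigma>) * exp (- (\<bar>y\<bar> + 1)\<^sup>2 / 2)"
  have "?c / 2 = (\<integral>x. ?c / 2 * indicator {y - 1/2 .. y + 1/2} x \<partial>lborel)" by simp
  also have "\<dots> \<le> (\<integral>x. normal_density 0 ?\<sigma> x * tent (x - y) \<partial>lborel)"
  proof (rule integral_mono)
    show "integrable lborel (\<lambda>x. normal_density 0 ?\<sigma> x * tent (x - y))"
      using \<sigma> by (intro Bochner_Integration.integrable_bound[OF integrable_normal_density[of ?\<sigma> 0]])
         (auto simp: tent_nonneg tent_le_1 intro!: mult_left_le)
    fix x
    show "?c / 2 * indicator {y - 1/2 .. y + 1/2} x \<le> normal_density 0 ?\<sigma> x * tent (x - y)"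
    proof (cases "x \<in> {y - 1/2 .. y + 1/2}")
      case True
      then have "\<bar>x\<bar> \<le> \<bar>y\<bar> + 1" by auto
      then have "\<bar>x\<bar> / ?\<sigma> \<le> (\<bar>y\<bar> + 1) / 1" using \<sigma> by (intro frac_le) auto
      then have "(\<bar>x\<bar> / ?\<sigma>)\<^sup>2 \<le> (\<bar>y\<bar> + 1)\<^sup>2" by (intro power_mono) auto
      then have "x\<^sup>2 / (2 * ?\<sigma>\<^sup>2) \<le> (\<bar>y\<bar> + 1)\<^sup>2 / 2" by (simp add: power_divide field_simps)
      then have "?c \<le> normal_density 0 ?\<sigma> x"
        using \<sigma> by (auto simp: normal_density_def real_sqrt_mult intro!: divide_right_mono)
      moreover have "\<bar>x - y\<bar> \<le> 1/2" unfolding abs_le_iff using True by auto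
      then have "1/2 \<le> tent (x - y)" by (auto simp: tent_def)
      ultimately show ?thesis using True mult_mono[of ?c "normal_density 0 ?\<sigma> x" "1/2" "tent (x - y)"] by simp
    next
      case False then show ?thesis by (simp add: tent_nonneg)
    qed
  qed auto
  also have "\<dots> = expectation (\<lambda>\<omega>. tent (incr s t \<omega> - y))"
    by (rule distributed_integral[OF D]) auto
  finally show ?thesis by (simp add: mult_ac)
qed

text \<open>The weight is supported on the event that the path crosses all of \<open>[-L, L]\<close> between
  times \<open>k\<close> and \<open>k+1\<close>, so one weight serves every level in that interval.\<close>

definition crossing :: "real \<Rightarrow> nat \<Rightarrow> 'a \<Rightarrow> real" where
  "crossing L k \<omega> = tent (incr 0 k \<omega> - (- L - 2)) * tent (incr k (real k + 1) \<omega> - (2 * L + 5))"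

lemma crossing_nonneg: "0 \<le> crossing L k \<omega>" and crossing_le_1: "crossing L k \<omega> \<le> 1"
  by (auto simp: crossing_def tent_nonneg tent_le_1 intro!: mult_le_one)

lemma crossing_measurable [measurable]: "crossing L k \<in> borel_measurable M"
proof -
  note [measurable] = incr_measurable
  show ?thesis unfolding crossing_def[abs_def] by measurable
qed

lemma crossing_integrable: "integrable M (crossing L k)"
  by (rule integrable_const_bound[where B = 1]) (auto simp: crossing_nonneg crossing_le_1)

lemma crossing_prod_integrable: "integrable M (\<lambda>\<omega>. crossing L k \<omega> * crossing L l \<omega>)"
  by (rule integrable_const_bound[where B = 1]) (auto simp: crossing_nonneg crossing_le_1 mult_le_one)

text \<open>The constants in \<open>crossing\<close> are chosen for this: the path is in
  \<open>(-L-3, -L-1)\<close> at time \<open>k\<close>, its increment is in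
  \<open>(2*L+4, 2*L+6)\<close>, and so it is in \<open>(L+1, L+5)\<close> at time
  \<open>k+1\<close>. Since \<open>incr 0 k\<close> is the displacement from \<open>B 0\<close>, the
  start at 0 is needed.\<close>

lemma crossing_pos:
  assumes "0 < crossing L k \<omega>" "B 0 \<omega> = 0"
  shows "B k \<omega> < - L" "L < B (real k + 1) \<omega>"
  using assms by (auto simp: crossing_def tent_def incr_def zero_less_mult_iff max_def split: if_splits)

lemma expectation_crossing_le:
  assumes "1 \<le> k" shows "expectation (crossing L k) \<le> 1 / real k powr H"
proof -
  note [measurable] = incr_measurable
  have "expectation (crossing L k) \<le> expectation (\<lambda>\<omega>. tent (1 * incr 0 k \<omega> - (- L - 2)))"
    by (intro integral_mono crossing_integrable integrable_const_bound[where B = 1])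
       (auto simp: crossing_def tent_nonneg tent_le_1 mult_left_le)
  also have "\<dots> \<le> 1 / (1 * \<bar>real k - 0\<bar> powr H)"
    using assms by (intro expectation_tent_le) auto
  finally show ?thesis by simp
qed

text \<open>Decoupling of two increments, the second with standard deviation 1. The error has the
  order \<open>k powr (- H)\<close> of the mean itself, so a small \<eta> makes it relatively
  negligible.\<close>

lemma crossing_factorization:
  assumes "1 \<le> k" "0 \<le> \<eta>" "\<eta> \<le> 1/4" "2 * (1 / real k) powr (min H (1 - H)) \<le> \<eta>"
  shows "\<bar>expectation (crossing L k) - expectation (\<lambda>\<omega>. tent (incr 0 k \<omega> - (- L - 2))) * expectation (\<lambda>\<omega>. tent (incr k (real k + 1) \<omega> - (2 * L + 5)))\<bar>
    \<le> 8 * \<eta> / real k powr H"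
proof -
  let ?a = "nth [0, real k]" and ?b = "nth [real k, real k + 1]" and ?y = "nth [- L - 2, 2 * L + 5]"
  have "\<bar>incr_cov H 0 k k (real k + 1)\<bar> \<le> 2 * (1 / real k) powr (min H (1 - H)) * (real k powr H * 1 powr H)"
    using assms H_pos H_less_1 by (intro incr_cov_adjacent) auto
  also have "\<dots> \<le> \<eta> * (real k powr H * 1 powr H)"
    using assms by (intro mult_right_mono) auto
  finally have c: "\<bar>incr_cov H 0 k k (real k + 1)\<bar> \<le> \<eta> * real k powr H" by simp
  have "\<bar>expectation (\<lambda>\<omega>. \<Prod>i\<in>{0, 1::nat}. tent (1 * incr (?a i) (?b i) \<omega> - ?y i)) - (\<Prod>i\<in>{0, 1::nat}. expectation (\<lambda>\<omega>. tent (1 * incr (?a i) (?b i) \<omega> - ?y i)))\<bar>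
     \<le> 4 * (card {0, 1::nat} * \<eta>) * (\<Prod>i\<in>{0, 1::nat}. 1 / (1 * \<bar>?b i - ?a i\<bar> powr H))"
    using assms c incr_cov_sym[of H k "real k + 1" 0 k] by (intro incr_tent_decoupling(1)[where I = "{0, 1::nat}" and a = ?a and b = ?b and w = "\<lambda>_. 1" and y = ?y and \<eta> = \<eta>]) auto
  then show ?thesis using assms by (simp add: crossing_def[abs_def])
qed

lemma crossing_lower_bound:
  "\<exists>c>0. \<forall>\<^sub>F k in sequentially. c / real k powr H \<le> expectation (crossing L k)"
proof -
  define c where "c y = 1 / (2 * sqrt (2 * pi)) * exp (- (\<bar>y\<bar> + 1)\<^sup>2 / 2)" for y :: real
  define C where "C = c (- L - 2) * c (2 * L + 5)"
  have c: "0 < c y" for y by (simp add: c_def)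
  have C: "0 < C" using c by (simp add: C_def)
  \<comment> \<open>The factor 1/16 lets the decoupling error \<open>8 * \<eta>\<close> consume at
    most half of the lower bound \<open>C\<close>.\<close>
  define \<eta> where "\<eta> = min (1/4) (C / 16)"
  have \<eta>: "0 < \<eta>" "\<eta> \<le> 1/4" "8 * \<eta> \<le> C / 2" using C by (auto simp: \<eta>_def)
  have "(\<lambda>k::nat. 2 * (1 / real k) powr (min H (1 - H))) \<longlonglongrightarrow> 2 * 0"
    using H_pos H_less_1 by (intro tendsto_intros inverse_powr_tendsto_0) auto
  then have "\<forall>\<^sub>F k in sequentially. 2 * (1 / real k) powr (min H (1 - H)) < \<eta>"
    using \<eta> by (intro order_tendstoD(2)) auto
  then have "\<forall>\<^sub>F k in sequentially. C / 2 / real k powr H \<le> expectation (crossing L k)"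
    using eventually_ge_at_top[of 1]
  proof eventually_elim
    case (elim k)
    let ?p = "expectation (\<lambda>\<omega>. tent (incr 0 k \<omega> - (- L - 2)))" and ?q = "expectation (\<lambda>\<omega>. tent (incr k (real k + 1) \<omega> - (2 * L + 5)))"
    have 1: "c (- L - 2) / real k powr H \<le> ?p"
      using expectation_tent_ge[of 0 "real k" "- L - 2"] elim by (simp add: c_def)
    have 2: "c (2 * L + 5) \<le> ?q"
      using expectation_tent_ge[of "real k" "real k + 1" "2 * L + 5"] elim by (simp add: c_def add.commute)
    have "C / real k powr H \<le> ?p * ?q"
      using mult_mono[OF 1 2 order_trans[OF _ 1]] c by (simp add: C_def less_imp_le)
    moreover have "\<bar>expectation (crossing L k) - ?p * ?q\<bar> \<le> 8 * \<eta> / real k powr H"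
      using elim \<eta> by (intro crossing_factorization) auto
    moreover have "8 * \<eta> / real k powr H \<le> C / 2 / real k powr H"
      using \<eta> by (intro divide_right_mono) auto
    ultimately have "C / real k powr H - C / 2 / real k powr H \<le> expectation (crossing L k)" by linarith
    moreover have "C / real k powr H - C / 2 / real k powr H = C / 2 / real k powr H" by (simp add: field_simps)
    ultimately show ?case by simp
  qed
  with C show ?thesis by (intro exI[of _ "C / 2"]) auto
qed

text \<open>If both weights are positive, the displacements at \<open>k\<close> and
  \<open>k + m\<close> both lie within 1 of \<open>-L-2\<close> and differ by less than 2, so the
  tent of a quarter of the difference is at least 1/2. This replaces two strongly dependent values
  by an early value and a later increment, to which decoupling applies with \<eta> = 1/4. The
  constant is 24 = 2 * (4 + 8): the factor 2 for the replacement, 4 for the product of means, 8 for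
  the error.\<close>

lemma crossing_pair_bound:
  assumes "0 < m" "m \<le> k" "8 * (real m / real k) powr (min H (1 - H)) \<le> 1"
  shows "expectation (\<lambda>\<omega>. crossing L k \<omega> * crossing L (k + m) \<omega>) \<le> 24 / (real k powr H * real m powr H)"
proof -
  note [measurable] = incr_measurable
  let ?a = "nth [0, real k]" and ?b = "nth [real k, real k + real m]" and ?y = "nth [- L - 2, 0]"
    and ?w = "nth [1, 1/4]"
  have c: "\<bar>incr_cov H 0 k k (real k + m)\<bar> \<le> 1/4 * (real k powr H * real m powr H)"
  proof -
    have "\<bar>incr_cov H 0 k k (real k + m)\<bar> \<le> 2 * (real m / real k) powr (min H (1 - H)) * (real k powr H * real m powr H)"
      using assms H_pos H_less_1 by (intro incr_cov_adjacent) auto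
    also have "\<dots> \<le> 1/4 * (real k powr H * real m powr H)"
      using assms by (intro mult_right_mono) auto
    finally show ?thesis .
  qed
  have "\<bar>expectation (\<lambda>\<omega>. \<Prod>i\<in>{0, 1::nat}. tent (?w i * incr (?a i) (?b i) \<omega> - ?y i)) - (\<Prod>i\<in>{0, 1::nat}. expectation (\<lambda>\<omega>. tent (?w i * incr (?a i) (?b i) \<omega> - ?y i)))\<bar>
     \<le> 4 * (card {0, 1::nat} * (1/4)) * (\<Prod>i\<in>{0, 1::nat}. 1 / (?w i * \<bar>?b i - ?a i\<bar> powr H))"
    using assms c incr_cov_sym[of H k "real k + real m" 0 k] by (intro incr_tent_decoupling(1)[where I = "{0, 1::nat}" and a = ?a and b = ?b and w = ?w and y = ?y and \<eta> = "1/4"]) (auto simp: mult_ac)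
  then have "expectation (\<lambda>\<omega>. tent (incr 0 k \<omega> - (- L - 2)) * tent (incr k (real k + m) \<omega> / 4))
    \<le> expectation (\<lambda>\<omega>. tent (incr 0 k \<omega> - (- L - 2))) * expectation (\<lambda>\<omega>. tent (incr k (real k + m) \<omega> / 4)) + 8 / (real k powr H * real m powr H)"
    using assms by simp
  also have "expectation (\<lambda>\<omega>. tent (incr 0 k \<omega> - (- L - 2))) * expectation (\<lambda>\<omega>. tent (incr k (real k + m) \<omega> / 4))
      \<le> 1 / real k powr H * (4 / real m powr H)"
    using expectation_tent_le[of 0 "real k" 1 "- L - 2"] expectation_tent_le[of "real k" "real k + real m" "1/4" 0] assms
    by (intro mult_mono) (auto intro!: Bochner_Integration.integral_nonneg tent_nonneg)
  finally have main: "expectation (\<lambda>\<omega>. tent (incr 0 k \<omega> - (- L - 2)) * tent (incr k (real k + m) \<omega> / 4))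
     \<le> 12 / (real k powr H * real m powr H)" by simp
  have "expectation (\<lambda>\<omega>. crossing L k \<omega> * crossing L (k + m) \<omega>)
     \<le> expectation (\<lambda>\<omega>. 2 * (tent (incr 0 k \<omega> - (- L - 2)) * tent (incr k (real k + m) \<omega> / 4)))"
  proof (intro integral_mono crossing_prod_integrable integrable_mult_right integrable_const_bound[where B = 1])
    fix \<omega>
    let ?u = "incr 0 k \<omega> - (- L - 2)" and ?v = "incr 0 (real k + m) \<omega> - (- L - 2)"
    have d: "incr k (real k + m) \<omega> = ?v - ?u" by (simp add: incr_def)
    have "tent ?u * tent ?v \<le> 2 * (tent ?u * tent ((?v - ?u) / 4))"
    proof (cases "\<bar>?u\<bar> < 1 \<and> \<bar>?v\<bar> < 1")
      case True
      then have "1/2 \<le> tent ((?v - ?u) / 4)" by (auto simp: tent_def)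
      then have "tent ?u * tent ?v \<le> tent ?u * (2 * tent ((?v - ?u) / 4))"
        using tent_le_1[of ?v] by (intro mult_left_mono) (auto simp: tent_nonneg)
      then show ?thesis by (simp add: mult_ac)
    next
      case False
      then have "tent ?u * tent ?v = 0" by (auto simp: tent_def)
      moreover have "0 \<le> 2 * (tent ?u * tent ((?v - ?u) / 4))"
        by (intro mult_nonneg_nonneg tent_nonneg) simp
      ultimately show ?thesis by linarith
    qed
    moreover have "crossing L k \<omega> * crossing L (k + m) \<omega> \<le> tent ?u * tent ?v"
    proof (intro mult_mono crossing_nonneg tent_nonneg)
      show "crossing L k \<omega> \<le> tent ?u" "crossing L (k + m) \<omega> \<le> tent ?v"
        unfolding crossing_def of_nat_add by (rule mult_left_le[OF tent_le_1 tent_nonneg])+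
    qed
    ultimately show "crossing L k \<omega> * crossing L (k + m) \<omega> \<le> 2 * (tent ?u * tent (incr k (real k + m) \<omega> / 4))"
      unfolding d by linarith
  qed (auto simp: tent_nonneg tent_le_1 mult_le_one)
  also have "\<dots> \<le> 24 / (real k powr H * real m powr H)"
    using main by simp
  finally show ?thesis .
qed

text \<open>For a fixed starting time the covariances with a late value and with a late unit step
  become negligible on the scales of their standard deviations, \<open>l powr H\<close> and
  1.\<close>

lemma far_correlations:
  fixes k :: nat
  assumes "1 \<le> k" "0 < \<eta>"
  shows "\<forall>\<^sub>F l::nat in sequentially. k + 2 \<le> l \<and> \<bar>incr_cov H 0 k 0 l\<bar> \<le> \<eta> * real l powr H
     \<and> \<bar>incr_cov H 0 k l (real l + 1)\<bar> \<le> \<eta>"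
proof -
  let ?d = "min H (1 - H)"
  have "(\<lambda>l::nat. 2 * (real k / (real l - real k)) powr ?d * real k powr H) \<longlonglongrightarrow> 2 * 0 * real k powr H"
    using H_pos H_less_1 assms by (intro tendsto_intros ratio_powr_tendsto_0) auto
  then have 1: "\<forall>\<^sub>F l::nat in sequentially. 2 * (real k / (real l - real k)) powr ?d * real k powr H < \<eta>"
    using assms by (intro order_tendstoD(2)) auto
  have "(\<lambda>l::nat. real k * (real l - real k) powr (2*H - 2)) \<longlonglongrightarrow> real k * 0"
    using H_less_1 by (intro tendsto_intros shifted_powr_tendsto_0) auto
  then have 2: "\<forall>\<^sub>F l::nat in sequentially. real k * (real l - real k) powr (2*H - 2) < \<eta>"
    using assms by (intro order_tendstoD(2)) auto
  show ?thesis
    using 1 2 eventually_ge_at_top[of "2 * k + 2"]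
  proof eventually_elim
    case (elim l)
    have "\<bar>incr_cov H 0 k 0 l\<bar> \<le> 2 * (real k / (real l - real k)) powr ?d * (real k powr H * real l powr H)"
      using elim assms H_pos H_less_1 by (intro incr_cov_origin_bound) auto
    also have "\<dots> = (2 * (real k / (real l - real k)) powr ?d * real k powr H) * real l powr H" by simp
    also have "\<dots> \<le> \<eta> * real l powr H" using elim by (intro mult_right_mono) auto
    finally have "\<bar>incr_cov H 0 k 0 l\<bar> \<le> \<eta> * real l powr H" .
    moreover have "\<bar>incr_cov H 0 k l (real l + 1)\<bar> \<le> real k * (real l - real k) powr (2*H - 2)"
      using elim assms H_pos H_less_1 by (intro incr_cov_origin_step_bound) auto
    ultimately show ?case using elim by auto
  qed
qed

text \<open>The joint mean and the product of means are both compared with the product of four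
  single-tent means: the former by decoupling four increments, the latter by decoupling two
  increments for each factor. Each comparison costs \<open>16 * \<eta>\<close>. The quantifiers are
  nested because \<open>k\<close> must be large for the correlation within its own pair, and then
  \<open>l\<close> large depending on \<open>k\<close>.\<close>

lemma crossing_covariance:
  assumes "0 < \<delta>"
  shows "\<forall>\<^sub>F k in sequentially. \<forall>\<^sub>F l in sequentially.
    \<bar>expectation (\<lambda>\<omega>. crossing L k \<omega> * crossing L l \<omega>) - expectation (crossing L k) * expectation (crossing L l)\<bar>
      \<le> \<delta> / (real k powr H * real l powr H)"
proof -
  define \<eta> where "\<eta> = min (1/8) (\<delta> / 32)"
  have \<eta>: "0 < \<eta>" "\<eta> \<le> 1/8" "32 * \<eta> \<le> \<delta>" using assms by (auto simp: \<eta>_def)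
  let ?d = "min H (1 - H)"
  have "(\<lambda>k::nat. 2 * (1 / real k) powr ?d) \<longlonglongrightarrow> 2 * 0"
    using H_pos H_less_1 by (intro tendsto_intros inverse_powr_tendsto_0) auto
  then have ev: "\<forall>\<^sub>F k::nat in sequentially. 2 * (1 / real k) powr ?d < \<eta>"
    using \<eta> by (intro order_tendstoD(2)) auto
  have adj: "\<bar>incr_cov H 0 k k (real k + 1)\<bar> \<le> \<eta> * real k powr H" if "1 \<le> k" "2 * (1 / real k) powr ?d < \<eta>" for k :: nat
  proof -
    have "\<bar>incr_cov H 0 k k (real k + 1)\<bar> \<le> 2 * (1 / real k) powr ?d * (real k powr H * 1 powr H)"
      using that H_pos H_less_1 by (intro incr_cov_adjacent) auto
    also have "\<dots> \<le> \<eta> * (real k powr H * 1 powr H)"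
      using that by (intro mult_right_mono) auto
    finally show ?thesis by simp
  qed
  show ?thesis
    using ev eventually_ge_at_top[of 1]
  proof eventually_elim
    case (elim k)
    note k = this
    have k1: "1 \<le> real k powr H" using k H_pos by (simp add: ge_one_powr_ge_zero)
    \<comment> \<open>The bound is used at \<open>k\<close> and at \<open>k + 1\<close>: the unit
      step after \<open>k\<close> is the difference of two increments from the origin, so half of
      \<eta> is allotted to each.\<close>
    have far: "\<forall>\<^sub>F l::nat in sequentially. k' + 2 \<le> l \<and> \<bar>incr_cov H 0 k' 0 l\<bar> \<le> \<eta> / 2 * real l powr H
     \<and> \<bar>incr_cov H 0 k' l (real l + 1)\<bar> \<le> \<eta> / 2" if "1 \<le> k'" for k' :: nat
      using that \<eta> by (intro far_correlations) auto
    have k1': "1 \<le> k + 1" by simp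
    show ?case
      using ev far[OF k(2)] far[OF k1'] eventually_ge_at_top[of 1]
    proof eventually_elim
      case (elim l)
      let ?a = "nth [0, real k, 0, real l]" and ?b = "nth [real k, real k + 1, real l, real l + 1]"
        and ?y = "nth [- L - 2, 2 * L + 5, - L - 2, 2 * L + 5]"
      let ?I = "{0, 1, 2, 3::nat}"
      have c02: "\<bar>incr_cov H 0 k 0 l\<bar> \<le> \<eta> * real k powr H * real l powr H"
      proof -
        have "\<bar>incr_cov H 0 k 0 l\<bar> \<le> \<eta> / 2 * real l powr H" using elim by auto
        also have "\<dots> \<le> (\<eta> * real k powr H) * real l powr H"
          using \<eta> mult_mono[of "\<eta> / 2" \<eta> 1 "real k powr H"] k1 by (intro mult_right_mono) auto
        finally show ?thesis .
      qed
      have c03: "\<bar>incr_cov H 0 k l (real l + 1)\<bar> \<le> \<eta> * real k powr H"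
      proof -
        have "\<bar>incr_cov H 0 k l (real l + 1)\<bar> \<le> \<eta> / 2 * 1" using elim by auto
        also have "\<dots> \<le> \<eta> * real k powr H"
          using \<eta> k1 by (intro mult_mono) auto
        finally show ?thesis .
      qed
      have c12: "\<bar>incr_cov H k (real k + 1) 0 l\<bar> \<le> \<eta> * real l powr H"
      proof -
        have "incr_cov H k (real k + 1) 0 l = incr_cov H 0 (real (k + 1)) 0 l - incr_cov H 0 k 0 l"
          by (simp add: incr_cov_def field_simps)
        then show ?thesis using elim by (auto simp: field_simps)
      qed
      have c13: "\<bar>incr_cov H k (real k + 1) l (real l + 1)\<bar> \<le> \<eta>"
      proof -
        have "incr_cov H k (real k + 1) l (real l + 1) = incr_cov H 0 (real (k + 1)) l (real l + 1) - incr_cov H 0 k l (real l + 1)"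
          by (simp add: incr_cov_def field_simps)
        then show ?thesis using elim by (auto simp: field_simps)
      qed
      have c01: "\<bar>incr_cov H 0 k k (real k + 1)\<bar> \<le> \<eta> * real k powr H"
        and c23: "\<bar>incr_cov H 0 l l (real l + 1)\<bar> \<le> \<eta> * real l powr H"
        using adj k elim by auto
      have c02': "\<bar>incr_cov H 0 k 0 l\<bar> \<le> \<eta> * real l powr H * real k powr H"
        using c02 by (simp only: mult_ac)
      have off: "\<bar>incr_cov H (?a i) (?b i) (?a j) (?b j)\<bar> \<le> \<eta> * \<bar>?b i - ?a i\<bar> powr H * \<bar>?b j - ?a j\<bar> powr H"
        if "i \<in> ?I" "j \<in> ?I" "i \<noteq> j" for i j
        using that
        by (elim insertE emptyE)
           (simp_all add: c01 c02 c03 c12 c13 c23 c02'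
             incr_cov_sym[of H "real k" "real k + 1" 0 "real k"] incr_cov_sym[of H 0 "real l" 0 "real k"]
             incr_cov_sym[of H "real l" "real l + 1" 0 "real k"] incr_cov_sym[of H 0 "real l" "real k" "real k + 1"]
             incr_cov_sym[of H "real l" "real l + 1" "real k" "real k + 1"]
             incr_cov_sym[of H "real l" "real l + 1" 0 "real l"])
      have "\<bar>expectation (\<lambda>\<omega>. \<Prod>i\<in>?I. tent (1 * incr (?a i) (?b i) \<omega> - ?y i)) - (\<Prod>i\<in>?I. expectation (\<lambda>\<omega>. tent (1 * incr (?a i) (?b i) \<omega> - ?y i)))\<bar>
        \<le> 4 * (card ?I * \<eta>) * (\<Prod>i\<in>?I. 1 / (1 * \<bar>?b i - ?a i\<bar> powr H))"
        using elim k \<eta>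
        by (intro incr_tent_decoupling(1)[where I = ?I and a = ?a and b = ?b and w = "\<lambda>_. 1" and y = ?y and \<eta> = \<eta>] off)
           (elim insertE emptyE; simp | simp)+
      moreover define pk where "pk = expectation (\<lambda>\<omega>. tent (incr 0 k \<omega> - (- L - 2))) * expectation (\<lambda>\<omega>. tent (incr k (real k + 1) \<omega> - (2 * L + 5)))"
      moreover define pl where "pl = expectation (\<lambda>\<omega>. tent (incr 0 l \<omega> - (- L - 2))) * expectation (\<lambda>\<omega>. tent (incr l (real l + 1) \<omega> - (2 * L + 5)))"
      ultimately have A: "\<bar>expectation (\<lambda>\<omega>. crossing L k \<omega> * crossing L l \<omega>) - pk * pl\<bar> \<le> 16 * \<eta> / (real k powr H * real l powr H)"
        by (simp add: crossing_def[abs_def] mult.assoc add.commute)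
      have Bk: "\<bar>expectation (crossing L k) - pk\<bar> \<le> 8 * \<eta> / real k powr H"
        unfolding pk_def using k \<eta> by (intro crossing_factorization) auto
      have Bl: "\<bar>expectation (crossing L l) - pl\<bar> \<le> 8 * \<eta> / real l powr H"
        unfolding pl_def using elim \<eta> by (intro crossing_factorization) auto
      have Ek: "0 \<le> expectation (crossing L l)" "expectation (crossing L l) \<le> 1 / real l powr H"
        using expectation_crossing_le[of l] elim by (auto intro!: Bochner_Integration.integral_nonneg crossing_nonneg)
      have pk: "0 \<le> pk" "pk \<le> 1 / real k powr H"
      proof -
        show "0 \<le> pk" unfolding pk_def by (intro mult_nonneg_nonneg Bochner_Integration.integral_nonneg tent_nonneg)
        have "pk \<le> 1 / real k powr H * 1" unfolding pk_def
          using expectation_tent_le[of 0 "real k" 1 "- L - 2"] expectation_tent_le[of "real k" "real k + 1" 1 "2 * L + 5"] k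
          by (intro mult_mono) (auto intro!: Bochner_Integration.integral_nonneg tent_nonneg simp: add.commute)
        then show "pk \<le> 1 / real k powr H" by simp
      qed
      have "expectation (crossing L k) * expectation (crossing L l) - pk * pl
         = (expectation (crossing L k) - pk) * expectation (crossing L l) + pk * (expectation (crossing L l) - pl)"
        by (simp add: algebra_simps)
      also have "\<bar>\<dots>\<bar> \<le> \<bar>expectation (crossing L k) - pk\<bar> * expectation (crossing L l) + pk * \<bar>expectation (crossing L l) - pl\<bar>"
        using Ek pk by (intro order_trans[OF abs_triangle_ineq]) (simp add: abs_mult)
      also have "\<dots> \<le> 8 * \<eta> / real k powr H * (1 / real l powr H) + 1 / real k powr H * (8 * \<eta> / real l powr H)"
        using Ek pk Bk Bl \<eta> by (intro add_mono mult_mono) auto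
      also have "\<dots> = 16 * \<eta> / (real k powr H * real l powr H)" by (simp add: field_simps)
      finally have "\<bar>expectation (crossing L k) * expectation (crossing L l) - pk * pl\<bar> \<le> 16 * \<eta> / (real k powr H * real l powr H)" .
      with A have "\<bar>expectation (\<lambda>\<omega>. crossing L k \<omega> * crossing L l \<omega>) - expectation (crossing L k) * expectation (crossing L l)\<bar>
        \<le> 16 * \<eta> / (real k powr H * real l powr H) + 16 * \<eta> / (real k powr H * real l powr H)" by linarith
      also have "\<dots> = 32 * \<eta> / (real k powr H * real l powr H)" by (simp add: field_simps)
      also have "\<dots> \<le> \<delta> / (real k powr H * real l powr H)" using \<eta> by (intro divide_right_mono) auto
      finally show ?case .
    qed
  qed
qed

end

section \<open>Sums over decorrelated scales\<close>

text \<open>Greedy selection. The last conjunct is carried through the induction because it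
  guarantees that a further element can be found beyond all chosen ones.\<close>

lemma eventually_decorrelated_subset:
  fixes R :: "nat \<Rightarrow> nat \<Rightarrow> bool"
  assumes R: "\<forall>\<^sub>F a in sequentially. \<forall>\<^sub>F b in sequentially. R a b"
  shows "\<exists>S. finite S \<and> card S = N \<and> S \<subseteq> {a0..} \<and> (\<forall>a\<in>S. \<forall>b\<in>S. a < b \<longrightarrow> R a b)
     \<and> (\<forall>a\<in>S. \<forall>\<^sub>F b in sequentially. R a b)"
proof (induction N)
  case 0
  show ?case by (intro exI[of _ "{}"]) auto
next
  case (Suc N)
  then obtain S where S: "finite S" "card S = N" "S \<subseteq> {a0..}" "\<forall>a\<in>S. \<forall>b\<in>S. a < b \<longrightarrow> R a b"
    "\<forall>a\<in>S. \<forall>\<^sub>F b in sequentially. R a b" by blast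
  have "\<forall>\<^sub>F b in sequentially. (\<forall>a\<in>S. R a b) \<and> (\<forall>\<^sub>F c in sequentially. R b c) \<and> a0 \<le> b \<and> Suc (Max (insert 0 S)) \<le> b"
    using S R by (intro eventually_conj eventually_ball_finite eventually_ge_at_top) auto
  from eventually_happens'[OF sequentially_bot this]
  obtain b where b: "\<forall>a\<in>S. R a b" "\<forall>\<^sub>F c in sequentially. R b c" "a0 \<le> b" "Suc (Max (insert 0 S)) \<le> b"
    by blast
  have lt: "a < b" if "a \<in> S" for a
  proof -
    have "a \<le> Max (insert 0 S)" using S(1) that by (intro Max_ge) auto
    then show ?thesis using b(4) by linarith
  qed
  have "R x y" if "x \<in> insert b S" "y \<in> insert b S" "x < y" for x y
    using that S(4) b(1) lt[of x] lt[of y] by (elim insertE) auto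
  moreover have "b \<notin> S" using lt by blast
  ultimately show ?case
    using S(1,2,3,5) b(2,3) by (intro exI[of _ "insert b S"]) simp
qed

text \<open>Cauchy-Schwarz for \<open>Y = sqrt (Y\<^sup>2 / En) * sqrt En\<close>. The hypothesis
  \<open>Y\<^sup>2 \<le> En\<close> keeps this factorization valid when \<open>En\<close> is
  0.\<close>

lemma sum_ratio_ge:
  fixes Y En :: "'i \<Rightarrow> real"
  assumes "finite S" "\<And>a. (Y a)\<^sup>2 \<le> En a" "\<And>a. 0 \<le> Y a"
    and "0 < y" "y \<le> (\<Sum>a\<in>S. Y a)" "(\<Sum>a\<in>S. En a) \<le> e" "0 < e"
  shows "y\<^sup>2 / e \<le> (\<Sum>a\<in>S. (Y a)\<^sup>2 / En a)"
proof -
  have E0: "0 \<le> En a" for a using assms(2)[of a] zero_le_power2[of "Y a"] by linarith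
  have eq: "Y a = sqrt ((Y a)\<^sup>2 / En a) * sqrt (En a)" for a
  proof (cases "En a = 0")
    case True then show ?thesis using assms(2)[of a] by simp
  next
    case False
    then have "sqrt ((Y a)\<^sup>2 / En a) * sqrt (En a) = sqrt ((Y a)\<^sup>2)" by (simp flip: real_sqrt_mult)
    then show ?thesis using assms(3)[of a] by simp
  qed
  have "y\<^sup>2 \<le> (\<Sum>a\<in>S. Y a)\<^sup>2" using assms by (intro power_mono) auto
  also have "\<dots> = (\<Sum>a\<in>S. sqrt ((Y a)\<^sup>2 / En a) * sqrt (En a))\<^sup>2" using eq by simp
  also have "\<dots> \<le> (\<Sum>a\<in>S. (sqrt ((Y a)\<^sup>2 / En a))\<^sup>2) * (\<Sum>a\<in>S. (sqrt (En a))\<^sup>2)"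
    by (rule Cauchy_Schwarz_ineq_sum)
  also have "\<dots> = (\<Sum>a\<in>S. (Y a)\<^sup>2 / En a) * (\<Sum>a\<in>S. En a)" using E0 by simp
  also have "\<dots> \<le> (\<Sum>a\<in>S. (Y a)\<^sup>2 / En a) * e"
    using assms E0 by (intro mult_left_mono sum_nonneg) auto
  finally show ?thesis using assms by (simp add: divide_le_eq)
qed

text \<open>A second-moment argument in place of independence or a zero-one law: for each bound
  \<open>K\<close> the event \<open>bad K\<close> that all partial sums stay below it has
  arbitrarily small probability, as seen on a sufficiently large decorrelated set of scales.\<close>

lemma (in prob_space) nonsummable_of_decorrelated:
  fixes Y En :: "nat \<Rightarrow> 'a \<Rightarrow> real"
  assumes Y_meas: "\<And>a. Y a \<in> borel_measurable M"
    and Y0: "\<And>a \<omega>. 0 \<le> Y a \<omega>" and YE: "\<And>a \<omega>. (Y a \<omega>)\<^sup>2 \<le> En a \<omega>"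
    and int: "\<And>a. integrable M (Y a)" "\<And>a b. integrable M (\<lambda>\<omega>. Y a \<omega> * Y b \<omega>)" "\<And>a. integrable M (En a)"
    and c: "0 < c" "\<forall>\<^sub>F a in sequentially. c \<le> expectation (Y a)"
    and C: "\<And>a. expectation (En a) \<le> C"
    and cov: "\<And>\<delta>. 0 < \<delta> \<Longrightarrow> \<forall>\<^sub>F a in sequentially. \<forall>\<^sub>F b in sequentially.
      \<bar>expectation (\<lambda>\<omega>. Y a \<omega> * Y b \<omega>) - expectation (Y a) * expectation (Y b)\<bar> \<le> \<delta>"
  shows "AE \<omega> in M. \<not> summable (\<lambda>a. (Y a \<omega>)\<^sup>2 / En a \<omega>)"
proof -
  note [measurable] = Y_meas borel_measurable_integrable[OF int(3)]
  have E0: "0 \<le> En a \<omega>" for a \<omega> using YE[of a \<omega>] zero_le_power2[of "Y a \<omega>"] by linarith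
  define Z where "Z a \<omega> = (Y a \<omega>)\<^sup>2 / En a \<omega>" for a \<omega>
  have Z0: "0 \<le> Z a \<omega>" for a \<omega> using E0 by (simp add: Z_def)
  have [measurable]: "Z a \<in> borel_measurable M" for a unfolding Z_def by measurable
  define bad where "bad K = {\<omega> \<in> space M. \<forall>n. (\<Sum>a<n. Z a \<omega>) \<le> K}" for K :: real
  have [measurable]: "bad K \<in> sets M" for K unfolding bad_def by measurable
  obtain a0 where a0: "\<And>a. a0 \<le> a \<Longrightarrow> c \<le> expectation (Y a)"
    using c(2) by (auto simp: eventually_sequentially)
  define C' where "C' = max C 1"
  have C': "0 < C'" "\<And>a. expectation (En a) \<le> C'" using C by (auto simp: C'_def intro: max.coboundedI1)
  have "prob (bad K) = 0" for K
  proof (rule antisym)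
    show "prob (bad K) \<le> 0"
    proof (rule field_le_epsilon)
      fix \<epsilon> :: real assume \<epsilon>: "0 < \<epsilon>"
      \<comment> \<open>Three errors of size \<open>\<epsilon> / 3\<close> are planned. Markov for
        the energies gives \<open>C' / A\<close>; Chebyshev for the masses gives
        \<open>4 * \<delta> / c\<^sup>2\<close> from the off-diagonal covariances and
        \<open>4 * C' / (c\<^sup>2 * N)\<close> from the diagonal. The second lower bound on
        \<open>N\<close> makes the resulting sum \<open>c\<^sup>2 * N / (4 * A)\<close> exceed
        \<open>K\<close>.\<close>
      define A where "A = 3 * C' / \<epsilon>"
      have A: "0 < A" using \<epsilon> C' by (simp add: A_def)
      define \<delta> where "\<delta> = \<epsilon> * c\<^sup>2 / 12"
      have \<delta>: "0 < \<delta>" using \<epsilon> c by (simp add: \<delta>_def)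
      obtain N :: nat where N: "12 * C' / (c\<^sup>2 * \<epsilon>) + 4 * A * \<bar>K\<bar> / c\<^sup>2 + 1 < real N"
        using reals_Archimedean2 by blast
      have "0 \<le> 12 * C' / (c\<^sup>2 * \<epsilon>)" "0 \<le> 4 * A * \<bar>K\<bar> / c\<^sup>2" using C' \<epsilon> A by auto
      with N have N0: "0 < real N" and N1: "12 * C' / (c\<^sup>2 * \<epsilon>) \<le> real N" and N2: "4 * A * \<bar>K\<bar> / c\<^sup>2 < real N" by linarith+
      obtain S where S: "finite S" "card S = N" "S \<subseteq> {a0..}" and
        S_cov: "\<forall>a\<in>S. \<forall>b\<in>S. a < b \<longrightarrow> \<bar>expectation (\<lambda>\<omega>. Y a \<omega> * Y b \<omega>) - expectation (Y a) * expectation (Y b)\<bar> \<le> \<delta>"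
        using eventually_decorrelated_subset[OF cov[OF \<delta>], of N a0] by blast
      define X where "X \<omega> = (\<Sum>a\<in>S. Y a \<omega>)" for \<omega>
      define W where "W \<omega> = (\<Sum>a\<in>S. En a \<omega>)" for \<omega>
      have [measurable]: "X \<in> borel_measurable M" "W \<in> borel_measurable M" unfolding X_def W_def by measurable
      have X2: "(X \<omega>)\<^sup>2 = (\<Sum>a\<in>S. \<Sum>b\<in>S. Y a \<omega> * Y b \<omega>)" for \<omega>
        by (simp add: X_def power2_eq_square sum_product)
      have intX: "integrable M X" "integrable M (\<lambda>\<omega>. (X \<omega>)\<^sup>2)"
        unfolding X2 unfolding X_def using int by auto
      have EX: "expectation X = (\<Sum>a\<in>S. expectation (Y a))" unfolding X_def using int by simp
      have EX_ge: "c * N \<le> expectation X"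
      proof -
        have "(\<Sum>a\<in>S. c) \<le> expectation X" unfolding EX using S a0 by (intro sum_mono) auto
        then show ?thesis using S by (simp add: mult.commute)
      qed
      have "variance X = (\<Sum>a\<in>S. \<Sum>b\<in>S. expectation (\<lambda>\<omega>. Y a \<omega> * Y b \<omega>) - expectation (Y a) * expectation (Y b))"
      proof -
        have "expectation (\<lambda>\<omega>. (X \<omega>)\<^sup>2) = (\<Sum>a\<in>S. \<Sum>b\<in>S. expectation (\<lambda>\<omega>. Y a \<omega> * Y b \<omega>))"
          unfolding X2 using int by simp
        moreover have "(expectation X)\<^sup>2 = (\<Sum>a\<in>S. \<Sum>b\<in>S. expectation (Y a) * expectation (Y b))"
          unfolding EX by (simp add: power2_eq_square sum_product)
        ultimately show ?thesis using variance_eq[OF intX] by (simp only: sum_subtractf)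
      qed
      \<comment> \<open>The diagonal needs no separate moment bound, since \<open>Y\<^sup>2\<close>
        is dominated by the energy, whose mean is at most \<open>C'\<close>.\<close>
      also have "\<dots> \<le> (\<Sum>a\<in>S. \<Sum>b\<in>S. \<delta> + (if b = a then C' else 0))"
      proof (intro sum_mono)
        fix a b assume ab: "a \<in> S" "b \<in> S"
        show "expectation (\<lambda>\<omega>. Y a \<omega> * Y b \<omega>) - expectation (Y a) * expectation (Y b) \<le> \<delta> + (if b = a then C' else 0)"
        proof (cases "a = b")
          case True
          have "expectation (\<lambda>\<omega>. Y a \<omega> * Y a \<omega>) \<le> expectation (En a)"
            using YE by (intro integral_mono int) (simp add: power2_eq_square)
          moreover have "0 \<le> expectation (Y a) * expectation (Y a)" by simp
          ultimately have "expectation (\<lambda>\<omega>. Y a \<omega> * Y a \<omega>) - expectation (Y a) * expectation (Y a) \<le> \<delta> + C'"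
            using C'(2)[of a] \<delta> by linarith
          then show ?thesis using True by simp
        next
          case False
          then consider "a < b" | "b < a" by linarith
          then have "\<bar>expectation (\<lambda>\<omega>. Y a \<omega> * Y b \<omega>) - expectation (Y a) * expectation (Y b)\<bar> \<le> \<delta>"
          proof cases
            case 1 then show ?thesis using S_cov ab by blast
          next
            case 2 then show ?thesis using S_cov[rule_format, OF ab(2,1)] by (simp add: mult.commute)
          qed
          then show ?thesis using False by simp
        qed
      qed
      also have "\<dots> = N * (N * \<delta> + C')" using S by (simp add: sum.distrib)
      finally have var: "variance X \<le> N * (N * \<delta> + C')" .
      have "prob {\<omega> \<in> space M. c * N / 2 \<le> \<bar>X \<omega> - expectation X\<bar>} \<le> variance X / (c * N / 2)\<^sup>2"
        using c N0 by (intro Chebyshev_inequality intX(2)) auto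
      also have "\<dots> \<le> N * (N * \<delta> + C') / (c * N / 2)\<^sup>2" using var by (intro divide_right_mono) auto
      also have "\<dots> = 4 * \<delta> / c\<^sup>2 + 4 * C' / (c\<^sup>2 * N)" using N0 c by (simp add: field_simps power2_eq_square)
      also have "\<dots> \<le> \<epsilon> / 3 + \<epsilon> / 3"
      proof (intro add_mono)
        show "4 * \<delta> / c\<^sup>2 \<le> \<epsilon> / 3" using c by (simp add: \<delta>_def)
        show "4 * C' / (c\<^sup>2 * N) \<le> \<epsilon> / 3" using N1 N0 c \<epsilon> by (simp add: field_simps)
      qed
      finally have p1: "prob {\<omega> \<in> space M. c * N / 2 \<le> \<bar>X \<omega> - expectation X\<bar>} \<le> \<epsilon> / 3 + \<epsilon> / 3" .
      have intW: "integrable M W" unfolding W_def using int by auto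
      have EW: "expectation W \<le> N * C'"
      proof -
        have "expectation W = (\<Sum>a\<in>S. expectation (En a))" unfolding W_def using int by simp
        also have "\<dots> \<le> (\<Sum>a\<in>S. C')" by (intro sum_mono C')
        finally show ?thesis using S by simp
      qed
      have "prob {\<omega> \<in> space M. A * N \<le> W \<omega>} \<le> expectation W / (A * N)"
        using A N0 E0 by (intro integral_Markov_inequality_measure[of _ _ "space M"] intW) (auto simp: W_def intro!: AE_I2 sum_nonneg)
      also have "\<dots> \<le> N * C' / (A * N)" using EW A by (intro divide_right_mono) auto
      also have "\<dots> = \<epsilon> / 3" using N0 C' \<epsilon> by (simp add: A_def field_simps)
      finally have p2: "prob {\<omega> \<in> space M. A * N \<le> W \<omega>} \<le> \<epsilon> / 3" .
      have sub: "bad K \<subseteq> {\<omega> \<in> space M. c * N / 2 \<le> \<bar>X \<omega> - expectation X\<bar>} \<union> {\<omega> \<in> space M. A * N \<le> W \<omega>}"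
      proof (rule ccontr)
        assume "\<not> ?thesis"
        then obtain \<omega> where "\<omega> \<in> bad K" "\<omega> \<notin> {\<omega> \<in> space M. c * N / 2 \<le> \<bar>X \<omega> - expectation X\<bar>}"
          "\<omega> \<notin> {\<omega> \<in> space M. A * N \<le> W \<omega>}"
          by blast
        then have \<omega>: "\<omega> \<in> bad K" "\<bar>X \<omega> - expectation X\<bar> < c * N / 2" "W \<omega> < A * N"
          by (simp_all add: bad_def not_le)
        from \<omega>(2) EX_ge have "c * N / 2 \<le> X \<omega>" by linarith
        then have "(c * N / 2)\<^sup>2 / (A * N) \<le> (\<Sum>a\<in>S. Z a \<omega>)"
          unfolding Z_def using S \<omega> YE Y0 c N0 A by (intro sum_ratio_ge) (auto simp: X_def W_def)
        also have "\<dots> \<le> (\<Sum>a<Suc (Max S). Z a \<omega>)"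
          using S Z0 by (intro sum_mono2) (auto simp: less_Suc_eq_le)
        also have "\<dots> \<le> K" using \<omega>(1) by (simp add: bad_def del: sum.lessThan_Suc)
        finally have "c\<^sup>2 * N / (4 * A) \<le> K" using N0 by (simp add: field_simps power2_eq_square)
        moreover have "\<bar>K\<bar> < c\<^sup>2 * N / (4 * A)" using N2 A c by (simp add: field_simps)
        ultimately show False by linarith
      qed
      have "prob (bad K) \<le> prob ({\<omega> \<in> space M. c * N / 2 \<le> \<bar>X \<omega> - expectation X\<bar>} \<union> {\<omega> \<in> space M. A * N \<le> W \<omega>})"
        by (intro finite_measure_mono sub) measurable
      also have "\<dots> \<le> prob {\<omega> \<in> space M. c * N / 2 \<le> \<bar>X \<omega> - expectation X\<bar>} + prob {\<omega> \<in> space M. A * N \<le> W \<omega>}"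
        by (rule measure_Un_le) measurable
      finally show "prob (bad K) \<le> 0 + \<epsilon>" using p1 p2 by linarith
    qed
  qed simp
  then have "AE \<omega> in M. \<omega> \<notin> bad K" for K
    using AE_iff_measurable[of "bad K" M "\<lambda>\<omega>. \<omega> \<notin> bad K"]
    by (simp add: emeasure_eq_measure bad_def)
  then have "AE \<omega> in M. \<forall>K::nat. \<omega> \<notin> bad (real K)" by (simp add: AE_all_countable)
  then show ?thesis
  proof (rule AE_mp, intro AE_I2 impI notI)
    fix \<omega> assume \<omega>: "\<omega> \<in> space M" "\<forall>K::nat. \<omega> \<notin> bad (real K)" "summable (\<lambda>a. (Y a \<omega>)\<^sup>2 / En a \<omega>)"
    obtain K :: nat where "(\<Sum>a. Z a \<omega>) \<le> real K" using real_arch_simple by blast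
    moreover have "summable (\<lambda>a. Z a \<omega>)" using \<omega>(3) by (simp add: Z_def)
    then have "(\<Sum>a<n. Z a \<omega>) \<le> (\<Sum>a. Z a \<omega>)" for n
      using Z0 by (intro sum_le_suminf) auto
    ultimately have "\<omega> \<in> bad (real K)" using \<omega>(1) by (auto simp: bad_def intro: order_trans)
    with \<omega> show False by blast
  qed
qed

section \<open>Expected Riesz energy of the crossing weights on a block\<close>

lemma sum_powr_le:
  fixes s :: real
  assumes "0 < s" "s < 1"
  shows "(\<Sum>d=1..m. real d powr (- s)) \<le> real m powr (1 - s) / (1 - s)"
proof (induction m)
  case (Suc m)
  have step: "(1 - s) * real (Suc m) powr (- s) \<le> real (Suc m) powr (1 - s) - real m powr (1 - s)"
  proof (cases "m = 0")
    case False
    have D: "DERIV (\<lambda>x. x powr (1 - s)) x :> (1 - s) * x powr (- s)" if "real m \<le> x" for x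
      using has_real_derivative_powr[of x "1 - s"] that False by simp
    from MVT2[of "real m" "real m + 1" "\<lambda>x. x powr (1 - s)" "\<lambda>x. (1 - s) * x powr (- s)"] D
    obtain z where z: "real m < z" "z < real m + 1" "(real m + 1) powr (1 - s) - real m powr (1 - s) = (1 - s) * z powr (- s)"
      by auto
    have "real (Suc m) powr (- s) \<le> z powr (- s)"
      using z False assms by (intro powr_mono2') auto
    then show ?thesis using z(3) assms by (simp add: add.commute)
  qed (use assms in simp)
  have "(\<Sum>d=1..Suc m. real d powr (- s)) \<le> real m powr (1 - s) / (1 - s) + real (Suc m) powr (- s)"
    using Suc by simp
  also have "\<dots> \<le> real (Suc m) powr (1 - s) / (1 - s)"
  proof -
    have "real (Suc m) powr (- s) \<le> (real (Suc m) powr (1 - s) - real m powr (1 - s)) / (1 - s)"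
      using step assms by (subst pos_le_divide_eq; simp add: mult.commute)
    then show ?thesis by (simp add: diff_divide_distrib)
  qed
  finally show ?case .
qed simp

text \<open>Each distance from \<open>k\<close> occurs at most once on either side. The case
  distinction expresses the distance despite truncated subtraction.\<close>

lemma sum_distance_kernel_le:
  fixes g :: "nat \<Rightarrow> real"
  assumes g: "\<And>d. 0 \<le> g d" and k: "k \<in> {b..<b + m}"
  shows "(\<Sum>l\<in>{b..<b + m}. g (if l \<le> k then k - l else l - k)) \<le> 2 * (\<Sum>d\<le>m. g d)"
proof -
  have "{b..<b + m} = {b..k} \<union> {k<..<b + m}" using k by auto
  then have "(\<Sum>l\<in>{b..<b + m}. g (if l \<le> k then k - l else l - k))
     = (\<Sum>l\<in>{b..k}. g (k - l)) + (\<Sum>l\<in>{k<..<b + m}. g (l - k))"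
    by (simp add: sum.union_disjoint ivl_disj_int)
  also have "(\<Sum>l\<in>{b..k}. g (k - l)) = sum g ((\<lambda>l. k - l) ` {b..k})"
    by (subst sum.reindex) (auto simp: inj_on_def)
  also have "\<dots> \<le> (\<Sum>d\<le>m. g d)" using k g by (intro sum_mono2) auto
  also have "(\<Sum>l\<in>{k<..<b + m}. g (l - k)) = sum g ((\<lambda>l. l - k) ` {k<..<b + m})"
    by (subst sum.reindex) (auto simp: inj_on_def)
  also have "\<dots> \<le> (\<Sum>d\<le>m. g d)" using k g by (intro sum_mono2) auto
  finally show ?thesis by simp
qed

context fractional_brownian_motion
begin

text \<open>At distance \<open>d\<close> the pair bound contributes \<open>d powr (- H)\<close> and
  the kernel \<open>d powr (- \<rho>)\<close>. The total exponent \<open>s = H + \<rho>\<close> is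
  below 1 precisely when \<rho> is below \<open>1 - H\<close>, and then the sum over distances is of
  order \<open>m powr (1 - s)\<close>. On the diagonal the weight is bounded by 1, so its square is
  bounded by the weight itself.\<close>

lemma crossing_energy_expectation_le:
  fixes q m :: nat
  assumes \<rho>: "0 < \<rho>" "\<rho> < 1 - H" and m: "1 \<le> m"
    and q: "8 * (1 / real (2 ^ q)) powr (min H (1 - H)) \<le> 1"
  defines "T \<equiv> {2 ^ q * m..<2 ^ q * m + m}"
  shows "real m powr (2 * H - 2) * expectation (\<lambda>\<omega>. riesz_energy (2 * 2 ^ q * real m) \<rho> T (\<lambda>k. crossing L k \<omega>))
    \<le> 24 * (2 * 2 ^ q) powr \<rho> * (2 + 2 / (1 - H - \<rho>))"
proof -
  define N where "N = 2 * 2 ^ q * real m"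
  define s where "s = H + \<rho>"
  have s: "0 < s" "s < 1" using \<rho> H_pos by (auto simp: s_def)
  have N: "0 < N" using m by (simp add: N_def)
  define g where "g d = (if d = 0 then 1 else real d powr (- s))" for d :: nat
  have g0: "0 \<le> g d" for d by (simp add: g_def)
  let ?dist = "\<lambda>k l::nat. if l \<le> k then k - l else l - k"
  have T_ge: "m \<le> k" if "k \<in> T" for k
  proof -
    have "m \<le> 2 ^ q * m" by simp
    moreover have "2 ^ q * m \<le> k" using that by (simp add: T_def)
    ultimately show ?thesis by linarith
  qed
  have pair: "expectation (\<lambda>\<omega>. crossing L k \<omega> * crossing L l \<omega>) * ((\<bar>real k - real l\<bar> + 1) / N) powr (- \<rho>)
     \<le> 24 * N powr \<rho> * real m powr (- H) * g (?dist k l)" if kl: "k \<in> T" "l \<in> T" for k l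
  proof -
    have le: "expectation (\<lambda>\<omega>. crossing L k \<omega> * crossing L l \<omega>) * ((\<bar>real k - real l\<bar> + 1) / N) powr (- \<rho>)
     \<le> 24 * N powr \<rho> * real m powr (- H) * g (l - k)" if kl: "k \<in> T" "l \<in> T" "k \<le> l" for k l
    proof (cases "k = l")
      case True
      have "expectation (\<lambda>\<omega>. crossing L k \<omega> * crossing L k \<omega>) \<le> expectation (crossing L k)"
        by (intro integral_mono crossing_integrable crossing_prod_integrable mult_left_le crossing_le_1 crossing_nonneg)
      also have "\<dots> \<le> 1 / real k powr H" using T_ge[OF kl(1)] m by (intro expectation_crossing_le) auto
      also have "\<dots> \<le> 1 / real m powr H" using T_ge[OF kl(1)] m H_pos by (intro divide_left_mono powr_mono2) auto
      also have "\<dots> \<le> 24 * real m powr (- H)" by (simp add: powr_minus_divide divide_right_mono)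
      finally have "expectation (\<lambda>\<omega>. crossing L k \<omega> * crossing L k \<omega>) * N powr \<rho> \<le> 24 * real m powr (- H) * N powr \<rho>"
        by (intro mult_right_mono) auto
      then show ?thesis using True N by (simp add: g_def powr_divide powr_minus field_simps)
    next
      case False
      define d where "d = l - k"
      have d: "0 < d" "l = k + d" using False kl by (auto simp: d_def)
      have dm: "d < m" using kl by (auto simp: T_def d_def)
      \<comment> \<open>This is why the block begins at \<open>2 ^ q\<close> times its length: every
        gap is at most \<open>1 / 2 ^ q\<close> of the time at which it starts, so
        \<open>crossing_pair_bound\<close> applies to all pairs.\<close>
      have "real d / real k \<le> 1 / real (2 ^ q)"
      proof -
        have "2 ^ q * d \<le> 2 ^ q * m" using dm by (intro mult_left_mono) auto
        also have "\<dots> \<le> k" using kl by (auto simp: T_def)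
        finally have "real (2 ^ q * d) \<le> real k" by (simp only: of_nat_le_iff)
        then show ?thesis using T_ge[OF kl(1)] m by (simp add: field_simps)
      qed
      then have "8 * (real d / real k) powr (min H (1 - H)) \<le> 8 * (1 / real (2 ^ q)) powr (min H (1 - H))"
        using H_pos H_less_1 by (intro mult_left_mono powr_mono2) auto
      with q have "8 * (real d / real k) powr (min H (1 - H)) \<le> 1" by linarith
      then have "expectation (\<lambda>\<omega>. crossing L k \<omega> * crossing L l \<omega>) \<le> 24 / (real k powr H * real d powr H)"
        unfolding d(2) using d dm T_ge[OF kl(1)] by (intro crossing_pair_bound) auto
      also have "\<dots> \<le> 24 / (real m powr H * real d powr H)"
        using d T_ge[OF kl(1)] m H_pos by (intro divide_left_mono mult_right_mono powr_mono2) auto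
      finally have 1: "expectation (\<lambda>\<omega>. crossing L k \<omega> * crossing L l \<omega>) \<le> 24 * real m powr (- H) * real d powr (- H)"
        by (simp add: powr_minus field_simps)
      have "((\<bar>real k - real l\<bar> + 1) / N) powr (- \<rho>) \<le> (real d / N) powr (- \<rho>)"
        using d N \<rho> by (intro powr_mono2' divide_right_mono) auto
      also have "\<dots> = N powr \<rho> * real d powr (- \<rho>)"
        using N d by (simp add: powr_divide powr_minus field_simps)
      finally have 2: "((\<bar>real k - real l\<bar> + 1) / N) powr (- \<rho>) \<le> N powr \<rho> * real d powr (- \<rho>)" .
      have "expectation (\<lambda>\<omega>. crossing L k \<omega> * crossing L l \<omega>) * ((\<bar>real k - real l\<bar> + 1) / N) powr (- \<rho>)
        \<le> (24 * real m powr (- H) * real d powr (- H)) * (N powr \<rho> * real d powr (- \<rho>))"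
        by (intro mult_mono 1 2) auto
      also have "real d powr (- H) * real d powr (- \<rho>) = g d"
        using d by (simp add: g_def s_def flip: powr_add)
      then have "(24 * real m powr (- H) * real d powr (- H)) * (N powr \<rho> * real d powr (- \<rho>)) = 24 * N powr \<rho> * real m powr (- H) * g d"
        by simp
      finally show ?thesis by (simp add: d_def)
    qed
    show ?thesis
      using le[OF kl] le[OF kl(2,1)] by (cases "k \<le> l") (auto simp: mult.commute abs_minus_commute)
  qed
  have "expectation (\<lambda>\<omega>. riesz_energy N \<rho> T (\<lambda>k. crossing L k \<omega>))
     = (\<Sum>k\<in>T. \<Sum>l\<in>T. expectation (\<lambda>\<omega>. crossing L k \<omega> * crossing L l \<omega>) * ((\<bar>real k - real l\<bar> + 1) / N) powr (- \<rho>))"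
    unfolding riesz_energy_def by (simp add: crossing_prod_integrable)
  also have "\<dots> \<le> (\<Sum>k\<in>T. \<Sum>l\<in>T. 24 * N powr \<rho> * real m powr (- H) * g (?dist k l))"
    by (intro sum_mono pair)
  also have "\<dots> = 24 * N powr \<rho> * real m powr (- H) * (\<Sum>k\<in>T. \<Sum>l\<in>T. g (?dist k l))"
    by (simp add: sum_distrib_left)
  also have "\<dots> \<le> 24 * N powr \<rho> * real m powr (- H) * (\<Sum>k\<in>T. (2 + 2 / (1 - s)) * real m powr (1 - s))"
  proof (intro mult_left_mono sum_mono)
    fix k assume "k \<in> T"
    then have "(\<Sum>l\<in>T. g (?dist k l)) \<le> 2 * (\<Sum>d\<le>m. g d)"
      unfolding T_def by (intro sum_distance_kernel_le g0)
    also have "(\<Sum>d\<le>m. g d) = 1 + (\<Sum>d=1..m. g d)"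
      by (simp add: atMost_atLeast0 sum.atLeast_Suc_atMost g_def)
    also have "(\<Sum>d=1..m. g d) = (\<Sum>d=1..m. real d powr (- s))"
      by (intro sum.cong) (auto simp: g_def)
    also have "1 + (\<Sum>d=1..m. real d powr (- s)) \<le> real m powr (1 - s) + real m powr (1 - s) / (1 - s)"
      using m s by (intro add_mono sum_powr_le ge_one_powr_ge_zero) auto
    finally show "(\<Sum>l\<in>T. g (?dist k l)) \<le> (2 + 2 / (1 - s)) * real m powr (1 - s)"
      by (simp add: algebra_simps)
  qed simp
  also have "(\<Sum>k\<in>T. (2 + 2 / (1 - s)) * real m powr (1 - s)) = real m * ((2 + 2 / (1 - s)) * real m powr (1 - s))" by (simp add: T_def)
  finally have "expectation (\<lambda>\<omega>. riesz_energy N \<rho> T (\<lambda>k. crossing L k \<omega>))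
    \<le> 24 * N powr \<rho> * real m powr (- H) * (real m * ((2 + 2 / (1 - s)) * real m powr (1 - s)))" .
  then have "real m powr (2 * H - 2) * expectation (\<lambda>\<omega>. riesz_energy N \<rho> T (\<lambda>k. crossing L k \<omega>))
    \<le> real m powr (2 * H - 2) * (24 * N powr \<rho> * real m powr (- H) * (real m * ((2 + 2 / (1 - s)) * real m powr (1 - s))))"
    by (intro mult_left_mono) auto
  \<comment> \<open>The exponents of \<open>m\<close> add up to
    \<open>(2*H - 2) + \<rho> - H + 1 + (1 - H - \<rho>) = 0\<close>.\<close>
  also have "\<dots> = 24 * (2 * 2 ^ q) powr \<rho> * (2 + 2 / (1 - s)) * (real m powr (2 * H - 2) * (real m powr \<rho> * (real m powr (- H) * (real m powr 1 * real m powr (1 - s)))))"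
    unfolding N_def using m by (simp add: powr_mult mult_ac)
  also have "real m powr (2 * H - 2) * (real m powr \<rho> * (real m powr (- H) * (real m powr 1 * real m powr (1 - s)))) = 1"
    using m by (simp only: powr_add[symmetric]) (simp add: s_def)
  finally show ?thesis by (simp add: N_def s_def algebra_simps)
qed

end

text \<open>Only a fraction of the shell is used: a block of \<open>2 ^ a\<close> indices near its
  left end, short compared with the times in it by the factor \<open>2 ^ q\<close>.\<close>

definition dyadic_block :: "nat \<Rightarrow> nat \<Rightarrow> nat set" where
  "dyadic_block q a = {2 ^ q * 2 ^ a ..< 2 ^ q * 2 ^ a + 2 ^ a}"

lemma dyadic_block:
  assumes "k \<in> dyadic_block q a"
  shows "2 ^ a \<le> k" "real (2 ^ a) \<le> real k" "real k \<le> 2 * 2 ^ q * real (2 ^ a)" "a < k"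
proof -
  have 1: "2 ^ a \<le> (2::nat) ^ q * 2 ^ a" by simp
  have b: "2 ^ q * 2 ^ a \<le> k" "k < 2 ^ q * 2 ^ a + 2 ^ a" using assms by (simp_all add: dyadic_block_def)
  from 1 b(1) show 2: "2 ^ a \<le> k" by linarith
  then show "real (2 ^ a) \<le> real k" by (simp only: of_nat_le_iff)
  have "k \<le> 2 * (2 ^ q * 2 ^ a)" using 1 b(2) by linarith
  then have "k \<le> 2 * 2 ^ q * 2 ^ a" by (simp only: mult.assoc)
  then have "real k \<le> real (2 * 2 ^ q * 2 ^ a)" by (simp only: of_nat_le_iff)
  then show "real k \<le> 2 * 2 ^ q * real (2 ^ a)" by simp
  have "a < 2 ^ a" by (rule less_exp)
  with 2 show "a < k" by linarith
qed

text \<open>For \<open>q = 0\<close> the last unit interval would reach the right end of the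
  half-open shell; \<open>q \<ge> 1\<close> leaves room.\<close>

lemma dyadic_block_shell:
  assumes "1 \<le> q" "k \<in> dyadic_block q a"
  shows "{real k .. real k + 1} \<subseteq> shell (int (Suc (a + q)))"
proof -
  have "(2::nat) ^ a < 2 ^ (a + q)" using assms(1) by simp
  moreover have "2 ^ (a + q) \<le> k" "k + 1 \<le> 2 ^ (a + q) + 2 ^ a"
    using assms(2) by (auto simp: dyadic_block_def power_add mult.commute)
  ultimately have "2 ^ (a + q) \<le> k" "k + 1 < 2 * 2 ^ (a + q)" by linarith+
  then have "real (2 ^ (a + q)) \<le> real k" "real (k + 1) < real (2 * 2 ^ (a + q))"
    by (simp_all only: of_nat_le_iff of_nat_less_iff)
  then have *: "2 ^ (a + q) \<le> real k" "real k + 1 < 2 ^ Suc (a + q)"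
    by (simp_all only: of_nat_power of_nat_numeral of_nat_mult of_nat_add of_nat_1 power_Suc)
  show ?thesis unfolding shell_eq
  proof
    fix t assume "t \<in> {real k .. real k + 1}"
    then have "real k \<le> t" "t \<le> real k + 1" by auto
    with * have "2 ^ (a + q) \<le> t" "t < 2 ^ Suc (a + q)" by linarith+
    then show "t \<in> {2 ^ (a + q) ..< 2 ^ Suc (a + q)}" by simp
  qed
qed

section \<open>Divergence of the covering sums below the exponent \<open>1 - H\<close>\<close>

context fractional_brownian_motion
begin

text \<open>The offset \<open>q\<close> is determined by \<open>H\<close> alone and is chosen before
  \<open>L\<close>, so the same blocks serve all crossing heights.\<close>

lemma crossing_ratio_nonsummable:
  assumes \<rho>: "0 < \<rho>" "\<rho> < 1 - H"
  shows "\<exists>q\<ge>1. \<forall>L. AE \<omega> in M. \<not> summable (\<lambda>a. (\<Sum>k\<in>dyadic_block q a. crossing L k \<omega>)\<^sup>2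
    / riesz_energy (2 * 2 ^ q * real (2 ^ a)) \<rho> (dyadic_block q a) (\<lambda>k. crossing L k \<omega>))"
proof -
  let ?d = "min H (1 - H)"
  have d: "0 < ?d" using H_pos H_less_1 by simp
  have "(\<lambda>q::nat. 8 * (1 / real (2 ^ q)) powr ?d) \<longlonglongrightarrow> 0"
    using d by real_asymp
  then have "\<forall>\<^sub>F q::nat in sequentially. 8 * (1 / real (2 ^ q)) powr ?d < 1"
    by (rule order_tendstoD(2)) simp
  then have "\<forall>\<^sub>F q::nat in sequentially. 1 \<le> q \<and> 8 * (1 / real (2 ^ q)) powr ?d < 1"
    using eventually_ge_at_top[of 1] by eventually_elim auto
  then obtain q :: nat where q: "1 \<le> q" "8 * (1 / real (2 ^ q)) powr ?d \<le> 1"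
    by (auto simp: eventually_sequentially intro: less_imp_le)
  have "AE \<omega> in M. \<not> summable (\<lambda>a. (\<Sum>k\<in>dyadic_block q a. crossing L k \<omega>)\<^sup>2
    / riesz_energy (2 * 2 ^ q * real (2 ^ a)) \<rho> (dyadic_block q a) (\<lambda>k. crossing L k \<omega>))" for L
  proof -
    define T where "T a = dyadic_block q a" for a
    note T = dyadic_block[of _ q, folded T_def]
    have finT: "finite (T a)" and cardT: "card (T a) = 2 ^ a" for a by (simp_all add: T_def dyadic_block_def)
    define m where "m a = real (2 ^ a)" for a :: nat
    have m: "0 < m a" "1 \<le> m a" for a by (simp_all add: m_def)
    have mk: "m a powr H \<le> real k powr H" if "k \<in> T a" for a k
      using T(2)[OF that] m[of a] H_pos by (intro powr_mono2) (auto simp: m_def)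
    \<comment> \<open>A block has \<open>m a\<close> indices with weights of mean about
      \<open>m a powr (- H)\<close>, so this factor brings the mean mass to order one.
      \<open>En\<close> receives the square of the factor and the quotient is unchanged.\<close>
    define Y where "Y a \<omega> = m a powr (H - 1) * (\<Sum>k\<in>T a. crossing L k \<omega>)" for a \<omega>
    define En where "En a \<omega> = m a powr (2 * H - 2) * riesz_energy (2 * 2 ^ q * m a) \<rho> (T a) (\<lambda>k. crossing L k \<omega>)" for a \<omega>
    have mH: "m a powr (H - 1) * m a = m a powr H" for a
      using m(1)[of a] by (metis abs_of_pos diff_add_cancel powr_add powr_one')
    have msq: "(m a powr (H - 1))\<^sup>2 = m a powr (2 * H - 2)" for a
      by (simp add: power2_eq_square flip: powr_add)
    have YY: "Y a \<omega> * Y b \<omega> = m a powr (H - 1) * m b powr (H - 1) * (\<Sum>k\<in>T a. \<Sum>l\<in>T b. crossing L k \<omega> * crossing L l \<omega>)" for a b \<omega>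
      by (simp add: Y_def sum_product)
    have EY: "expectation (Y a) = m a powr (H - 1) * (\<Sum>k\<in>T a. expectation (crossing L k))" for a
      unfolding Y_def by (simp add: crossing_integrable)
    have EYY: "expectation (\<lambda>\<omega>. Y a \<omega> * Y b \<omega>)
      = m a powr (H - 1) * m b powr (H - 1) * (\<Sum>k\<in>T a. \<Sum>l\<in>T b. expectation (\<lambda>\<omega>. crossing L k \<omega> * crossing L l \<omega>))" for a b
      unfolding YY by (simp add: crossing_prod_integrable)
    obtain c0 where c0: "0 < c0" "\<forall>\<^sub>F k in sequentially. c0 / real k powr H \<le> expectation (crossing L k)"
      using crossing_lower_bound by blast
    have "AE \<omega> in M. \<not> summable (\<lambda>a. (Y a \<omega>)\<^sup>2 / En a \<omega>)"
    proof (rule nonsummable_of_decorrelated)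
      show "Y a \<in> borel_measurable M" for a unfolding Y_def by measurable
      show "0 \<le> Y a \<omega>" for a \<omega> unfolding Y_def by (intro mult_nonneg_nonneg sum_nonneg crossing_nonneg) auto
      \<comment> \<open>Inside a block, distances plus one are at most the normalization
        \<open>2 * 2 ^ q * m a\<close>, so every kernel value is at least 1.\<close>
      show "(Y a \<omega>)\<^sup>2 \<le> En a \<omega>" for a \<omega>
      proof -
        have "(\<Sum>k\<in>T a. crossing L k \<omega>)\<^sup>2 = (\<Sum>k\<in>T a. \<Sum>l\<in>T a. crossing L k \<omega> * crossing L l \<omega> * 1)"
          by (simp add: power2_eq_square sum_product)
        also have "\<dots> \<le> riesz_energy (2 * 2 ^ q * m a) \<rho> (T a) (\<lambda>k. crossing L k \<omega>)"
          unfolding riesz_energy_def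
        proof (intro sum_mono mult_left_mono mult_nonneg_nonneg crossing_nonneg)
          fix k l assume kl: "k \<in> T a" "l \<in> T a"
          have "k < l + 2 ^ a" "l < k + 2 ^ a" using kl by (auto simp: T_def dyadic_block_def)
          then have "real (k + 1) \<le> real (l + 2 ^ a)" "real (l + 1) \<le> real (k + 2 ^ a)" by (simp_all only: of_nat_le_iff)
          then have "\<bar>real k - real l\<bar> + 1 \<le> 1 * m a" unfolding m_def by (simp add: abs_le_iff)
          also have "\<dots> \<le> 2 * 2 ^ q * m a"
          proof (rule mult_right_mono)
            have "(1::real) \<le> 2 ^ q" by simp
            then show "(1::real) \<le> 2 * 2 ^ q" by linarith
          qed (use m in \<open>auto intro: less_imp_le\<close>)
          finally have "(\<bar>real k - real l\<bar> + 1) / (2 * 2 ^ q * m a) \<le> 1"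
            using m[of a] by (simp add: divide_le_eq_1)
          then have "1 powr (- \<rho>) \<le> ((\<bar>real k - real l\<bar> + 1) / (2 * 2 ^ q * m a)) powr (- \<rho>)"
            using \<rho> m[of a] by (intro powr_mono2') auto
          then show "1 \<le> ((\<bar>real k - real l\<bar> + 1) / (2 * 2 ^ q * m a)) powr (- \<rho>)" by simp
        qed
        finally show ?thesis
          unfolding Y_def En_def by (simp add: power_mult_distrib msq mult_left_mono)
      qed
      show "integrable M (Y a)" for a unfolding Y_def by (simp add: crossing_integrable)
      show "integrable M (\<lambda>\<omega>. Y a \<omega> * Y b \<omega>)" for a b unfolding YY by (simp add: crossing_prod_integrable)
      show "integrable M (En a)" for a unfolding En_def riesz_energy_def by (simp add: crossing_prod_integrable)
      show "0 < c0 / (2 * 2 ^ q) powr H" using c0 by simp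
      from c0(2) obtain k0 where k0: "\<And>k. k0 \<le> k \<Longrightarrow> c0 / real k powr H \<le> expectation (crossing L k)"
        by (auto simp: eventually_sequentially)
      show "\<forall>\<^sub>F a in sequentially. c0 / (2 * 2 ^ q) powr H \<le> expectation (Y a)"
        using eventually_ge_at_top[of k0]
      proof eventually_elim
        case (elim a)
        have "(\<Sum>k\<in>T a. c0 / (2 * 2 ^ q * m a) powr H) \<le> (\<Sum>k\<in>T a. expectation (crossing L k))"
        proof (intro sum_mono)
          fix k assume k: "k \<in> T a"
          have "0 < real k" using T(4)[OF k] by simp
          then have "c0 / (2 * 2 ^ q * m a) powr H \<le> c0 / real k powr H"
            using T(3)[OF k] c0 H_pos m[of a] by (intro divide_left_mono powr_mono2) (auto simp: m_def)
          also have "\<dots> \<le> expectation (crossing L k)" using T(4)[OF k] elim by (intro k0) auto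
          finally show "c0 / (2 * 2 ^ q * m a) powr H \<le> expectation (crossing L k)" .
        qed
        then have "m a * (c0 / ((2 * 2 ^ q) powr H * m a powr H)) \<le> (\<Sum>k\<in>T a. expectation (crossing L k))"
          by (simp add: cardT m_def powr_mult)
        then have "m a powr (H - 1) * (m a * (c0 / ((2 * 2 ^ q) powr H * m a powr H))) \<le> expectation (Y a)"
          unfolding EY by (intro mult_left_mono) auto
        also have "m a powr (H - 1) * (m a * (c0 / ((2 * 2 ^ q) powr H * m a powr H))) = c0 / (2 * 2 ^ q) powr H"
          unfolding mult.assoc[symmetric] mH using m(1)[of a] by simp
        finally show ?case .
      qed
      show "expectation (En a) \<le> 24 * (2 * 2 ^ q) powr \<rho> * (2 + 2 / (1 - H - \<rho>))" for a
        using crossing_energy_expectation_le[OF \<rho>, of "2 ^ a" q L] q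
        unfolding En_def T_def m_def dyadic_block_def by simp
      fix \<delta> :: real assume \<delta>: "0 < \<delta>"
      let ?good = "\<lambda>k l. \<bar>expectation (\<lambda>\<omega>. crossing L k \<omega> * crossing L l \<omega>) - expectation (crossing L k) * expectation (crossing L l)\<bar>
          \<le> \<delta> / (real k powr H * real l powr H)"
      from crossing_covariance[OF \<delta>, of L] obtain k1 where k1: "\<And>k. k1 \<le> k \<Longrightarrow> \<forall>\<^sub>F l in sequentially. ?good k l"
        by (auto simp: eventually_sequentially)
      show "\<forall>\<^sub>F a in sequentially. \<forall>\<^sub>F b in sequentially.
        \<bar>expectation (\<lambda>\<omega>. Y a \<omega> * Y b \<omega>) - expectation (Y a) * expectation (Y b)\<bar> \<le> \<delta>"
        using eventually_ge_at_top[of k1]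
      proof eventually_elim
        case (elim a)
        have "\<forall>\<^sub>F l in sequentially. \<forall>k\<in>T a. ?good k l"
        proof (intro eventually_ball_finite ballI k1 finT)
          fix k assume "k \<in> T a"
          from T(4)[OF this] elim show "k1 \<le> k" by linarith
        qed
        then obtain l1 where l1: "\<And>k l. k \<in> T a \<Longrightarrow> l1 \<le> l \<Longrightarrow> ?good k l"
          by (auto simp: eventually_sequentially)
        show ?case
          using eventually_ge_at_top[of l1]
        proof eventually_elim
          case (elim b)
          have "expectation (\<lambda>\<omega>. Y a \<omega> * Y b \<omega>) - expectation (Y a) * expectation (Y b)
            = m a powr (H - 1) * m b powr (H - 1) * (\<Sum>k\<in>T a. \<Sum>l\<in>T b.
                expectation (\<lambda>\<omega>. crossing L k \<omega> * crossing L l \<omega>) - expectation (crossing L k) * expectation (crossing L l))"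
            unfolding EYY unfolding EY by (simp add: sum_product sum_subtractf algebra_simps)
          also have "\<bar>\<dots>\<bar> \<le> m a powr (H - 1) * m b powr (H - 1) * (\<Sum>k\<in>T a. \<Sum>l\<in>T b. \<delta> / (m a powr H * m b powr H))"
          proof -
            have "\<bar>\<Sum>k\<in>T a. \<Sum>l\<in>T b. expectation (\<lambda>\<omega>. crossing L k \<omega> * crossing L l \<omega>) - expectation (crossing L k) * expectation (crossing L l)\<bar>
              \<le> (\<Sum>k\<in>T a. \<Sum>l\<in>T b. \<bar>expectation (\<lambda>\<omega>. crossing L k \<omega> * crossing L l \<omega>) - expectation (crossing L k) * expectation (crossing L l)\<bar>)"
              by (intro order_trans[OF sum_abs] sum_mono order_refl)
            also have "\<dots> \<le> (\<Sum>k\<in>T a. \<Sum>l\<in>T b. \<delta> / (m a powr H * m b powr H))"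
            proof (intro sum_mono)
              fix k l assume kl: "k \<in> T a" "l \<in> T b"
              have "l1 \<le> l" using T(4)[OF kl(2)] elim by linarith
              then have "?good k l" by (rule l1[OF kl(1)])
              also have "\<delta> / (real k powr H * real l powr H) \<le> \<delta> / (m a powr H * m b powr H)"
                using mk[OF kl(1)] mk[OF kl(2)] T(4)[OF kl(1)] T(4)[OF kl(2)] \<delta> m(1)[of a] m(1)[of b]
                by (intro divide_left_mono mult_mono mult_pos_pos) auto
              finally show "\<bar>expectation (\<lambda>\<omega>. crossing L k \<omega> * crossing L l \<omega>) - expectation (crossing L k) * expectation (crossing L l)\<bar>
                \<le> \<delta> / (m a powr H * m b powr H)" .
            qed
            finally show ?thesis
              unfolding abs_mult abs_of_nonneg[OF powr_ge_zero] by (intro mult_left_mono) auto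
          qed
          also have "\<dots> = (m a powr (H - 1) * m a) * (m b powr (H - 1) * m b) * (\<delta> / (m a powr H * m b powr H))"
            by (simp add: cardT m_def)
          also have "\<dots> = \<delta>" unfolding mH using m(1)[of a] m(1)[of b] by simp
          finally show ?case .
        qed
      qed
    qed
    moreover have "(Y a \<omega>)\<^sup>2 / En a \<omega> = (\<Sum>k\<in>dyadic_block q a. crossing L k \<omega>)\<^sup>2
      / riesz_energy (2 * 2 ^ q * real (2 ^ a)) \<rho> (dyadic_block q a) (\<lambda>k. crossing L k \<omega>)" for a \<omega>
      unfolding Y_def En_def power_mult_distrib msq using m(1)[of a] by (simp add: T_def m_def)
    ultimately show ?thesis by simp
  qed
  with q(1) show ?thesis by blast
qed

lemma AE_B_0: "AE \<omega> in M. B 0 \<omega> = 0"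
proof -
  note [measurable] = B_measurable[of 0, simplified]
  have "expectation (\<lambda>\<omega>. (B 0 \<omega>)\<^sup>2) = 0" "integrable M (\<lambda>\<omega>. (B 0 \<omega>)\<^sup>2)"
    using B_covariance[of 0 0] B_prod_integrable[of 0 0] by (simp_all add: power2_eq_square)
  then have "AE \<omega> in M. (B 0 \<omega>)\<^sup>2 = 0"
    using integral_nonneg_eq_0_iff_AE[of M "\<lambda>\<omega>. (B 0 \<omega>)\<^sup>2"] by simp
  then show ?thesis by simp
qed

text \<open>The exceptional null set comes from \<open>B 0 = 0\<close> and from the natural numbers
  \<open>j\<close> as crossing heights, so one null set serves all real \<open>x\<close>: any
  \<open>j\<close> above \<open>\<bar>x\<bar>\<close> will do. By the intermediate value theorem a
  positive weight yields a point of the level set in the unit interval, as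
  \<open>nu_ge_energy\<close> requires.\<close>

lemma level_set_nu_sum_infinite:
  assumes \<rho>: "0 < \<rho>" "\<rho> < 1 - H"
    and cont: "\<forall>\<omega>\<in>space M. continuous_on {0..} (\<lambda>t. B t \<omega>)"
  shows "AE \<omega> in M. \<forall>x N. \<not> (\<Sum>k. nu (int (k + N)) \<rho> {t. t \<ge> 0 \<and> B t \<omega> = x}) < \<top>"
proof -
  obtain q where q: "1 \<le> q" and ae: "\<And>L. AE \<omega> in M. \<not> summable (\<lambda>a. (\<Sum>k\<in>dyadic_block q a. crossing L k \<omega>)\<^sup>2
    / riesz_energy (2 * 2 ^ q * real (2 ^ a)) \<rho> (dyadic_block q a) (\<lambda>k. crossing L k \<omega>))"
    using crossing_ratio_nonsummable[OF \<rho>] by blast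
  have "AE \<omega> in M. \<forall>j::nat. \<not> summable (\<lambda>a. (\<Sum>k\<in>dyadic_block q a. crossing (real j) k \<omega>)\<^sup>2
    / riesz_energy (2 * 2 ^ q * real (2 ^ a)) \<rho> (dyadic_block q a) (\<lambda>k. crossing (real j) k \<omega>))"
    using ae by (simp add: AE_all_countable)
  then show ?thesis
    using AE_B_0 AE_space
  proof eventually_elim
    case (elim \<omega>)
    show ?case
    proof (intro allI notI)
      fix x :: real and N :: nat
      let ?E = "{t. t \<ge> 0 \<and> B t \<omega> = x}"
      assume fin: "(\<Sum>k. nu (int (k + N)) \<rho> ?E) < \<top>"
      obtain j :: nat where j: "\<bar>x\<bar> \<le> real j" using real_arch_simple by blast
      define Z where "Z a = (\<Sum>k\<in>dyadic_block q a. crossing (real j) k \<omega>)\<^sup>2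
        / riesz_energy (2 * 2 ^ q * real (2 ^ a)) \<rho> (dyadic_block q a) (\<lambda>k. crossing (real j) k \<omega>)" for a
      have Z0: "0 \<le> Z a" for a unfolding Z_def by (intro divide_nonneg_nonneg riesz_energy_nonneg crossing_nonneg) auto
      have Z_le: "ennreal (Z a / 3) \<le> nu (int (Suc (a + q))) \<rho> ?E" for a
      proof -
        have "ennreal ((\<Sum>k\<in>dyadic_block q a. crossing (real j) k \<omega>)\<^sup>2
           / (3 * riesz_energy (2 powr real_of_int (int (Suc (a + q)))) \<rho> (dyadic_block q a) (\<lambda>k. crossing (real j) k \<omega>)))
           \<le> nu (int (Suc (a + q))) \<rho> ?E"
        proof (rule nu_ge_energy)
          fix k assume k: "k \<in> dyadic_block q a"
          show "{real k..real k + 1} \<subseteq> shell (int (Suc (a + q)))" by (rule dyadic_block_shell[OF q k])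
          assume pos: "0 < crossing (real j) k \<omega>"
          from crossing_pos[OF pos elim(2)] j have "B (real k) \<omega> \<le> x" "x \<le> B (real k + 1) \<omega>" by auto
          moreover have "continuous_on {real k..real k + 1} (\<lambda>t. B t \<omega>)"
            using cont[rule_format, OF elim(3)] by (rule continuous_on_subset) auto
          ultimately obtain t where "real k \<le> t" "t \<le> real k + 1" "B t \<omega> = x"
            using IVT'[of "\<lambda>t. B t \<omega>" "real k" x "real k + 1"] by auto
          then show "\<exists>t\<in>?E. real k \<le> t \<and> t \<le> real k + 1" by (intro bexI[of _ t]) auto
        qed (use \<rho> H_pos in \<open>auto simp: dyadic_block_def crossing_nonneg\<close>)
        also have "2 powr real_of_int (int (Suc (a + q))) = 2 * 2 ^ q * real (2 ^ a)"
          by (simp add: powr_add powr_realpow)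
        finally show ?thesis by (simp add: Z_def mult.commute)
      qed
      \<comment> \<open>Block \<open>a\<close> lies in shell \<open>a + q + 1\<close>, which
        explains the shift by \<open>Suc q\<close>; discarding the first terms of a nonnegative
        series only decreases it.\<close>
      have "(\<Sum>i. ennreal (Z (i + N) / 3)) \<le> (\<Sum>i. nu (int (i + Suc q + N)) \<rho> ?E)"
        using Z_le[of "_ + N"] by (intro suminf_le summableI) (simp add: add_ac)
      also have "\<dots> \<le> (\<Sum>k. nu (int (k + N)) \<rho> ?E)"
        using suminf_offset[of "\<lambda>k. nu (int (k + N)) \<rho> ?E" "Suc q"] by (simp add: summableI)
      finally have "(\<Sum>i. ennreal (Z (i + N) / 3)) \<noteq> \<top>" using fin by auto
      then have "summable (\<lambda>i. Z (i + N) / 3)" using Z0 by (intro summable_suminf_not_top) auto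
      then have "summable (\<lambda>i. Z (i + N))" using summable_mult[of "\<lambda>i. Z (i + N) / 3" 3] by simp
      then have "summable Z" by (simp add: summable_iff_shift)
      then show False using elim(1) unfolding Z_def by blast
    qed
  qed
qed

end

section \<open>Oscillation over unit intervals\<close>

lemma geometric_sum_le:
  fixes r :: real
  assumes "0 \<le> r" "r < 1"
  shows "(\<Sum>i<n. r ^ i) \<le> 1 / (1 - r)"
proof -
  have "(\<Sum>i<n. r ^ i) \<le> (\<Sum>i. r ^ i)"
    using assms by (intro sum_le_suminf summable_geometric) auto
  then show ?thesis using assms suminf_geometric[of r] by simp
qed

text \<open>The values at the dyadic approximations of \<open>t\<close> from below telescope:
  passing to the next level moves the point by 0 or by one dyadic step, so the geometric series
  bounds the total, and continuity passes to the limit.\<close>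

lemma dyadic_chaining:
  fixes f :: "real \<Rightarrow> real"
  assumes cont: "continuous_on {0..1} f" and r: "0 \<le> r" "r < 1" and a: "0 \<le> a"
    and step: "\<And>j i::nat. i < 2 ^ j \<Longrightarrow> \<bar>f ((real i + 1) / 2 ^ j) - f (real i / 2 ^ j)\<bar> \<le> a * r ^ j"
    and t: "0 \<le> t" "t \<le> 1"
  shows "\<bar>f t - f 0\<bar> \<le> a / (1 - r)"
\<comment> \<open>At \<open>t = 1\<close> the rounded index \<open>n j\<close> would be
  \<open>2 ^ j\<close>, outside the range of \<open>step\<close>; the step of level 0 handles this
  endpoint directly.\<close>
proof (cases "t = 1")
  case True
  have "\<bar>f 1 - f 0\<bar> \<le> a" using step[of 0 0] by simp
  also have "a \<le> a / (1 - r)" using a r by (simp add: le_divide_eq mult_left_le)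
  finally show ?thesis using True by simp
next
  case False
  define n where "n j = nat \<lfloor>t * 2 ^ j\<rfloor>" for j :: nat
  have n: "real (n j) \<le> t * 2 ^ j" "t * 2 ^ j < real (n j) + 1" for j
    using t by (simp_all add: n_def floor_le_iff of_nat_nat)
  have n_lt: "n j < 2 ^ j" for j
  proof -
    have "t * 2 ^ j < 1 * 2 ^ j" using t False by (intro mult_strict_right_mono) auto
    with n(1)[of j] have "real (n j) < 2 ^ j" by linarith
    then show ?thesis by simp
  qed
  define u where "u j = real (n j) / 2 ^ j" for j
  have n_Suc: "n (Suc j) = 2 * n j \<or> n (Suc j) = 2 * n j + 1" for j
  proof -
    have "real (n (Suc j)) < real (2 * n j + 2)" "real (2 * n j) < real (n (Suc j) + 1)"
      using n[of j] n[of "Suc j"] by (simp_all add: field_simps)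
    then have "n (Suc j) < 2 * n j + 2" "2 * n j < n (Suc j) + 1" by (simp_all only: of_nat_less_iff)
    then show ?thesis by linarith
  qed
  have u_step: "\<bar>f (u (Suc j)) - f (u j)\<bar> \<le> a * r ^ Suc j" for j
  proof (cases "n (Suc j) = 2 * n j")
    case True
    then show ?thesis using a r by (simp add: u_def)
  next
    case False
    with n_Suc[of j] have e: "n (Suc j) = 2 * n j + 1" by blast
    have "\<bar>f ((real (2 * n j) + 1) / 2 ^ Suc j) - f (real (2 * n j) / 2 ^ Suc j)\<bar> \<le> a * r ^ Suc j"
      using n_lt[of j] by (intro step) auto
    then show ?thesis using e by (simp add: u_def add.commute)
  qed
  have partial: "\<bar>f (u j) - f 0\<bar> \<le> a * (\<Sum>i<Suc j. r ^ i)" for j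
  proof (induction j)
    case 0
    then show ?case using n_lt[of 0] a by (simp add: u_def)
  next
    case (Suc j)
    then show ?case using u_step[of j] by (simp add: algebra_simps)
  qed
  have bound: "\<bar>f (u j) - f 0\<bar> \<le> a / (1 - r)" for j
  proof -
    have "a * (\<Sum>i<Suc j. r ^ i) \<le> a * (1 / (1 - r))"
      by (intro mult_left_mono geometric_sum_le r a)
    then show ?thesis using partial[of j] by simp
  qed
  have "u \<longlonglongrightarrow> t"
  proof (rule real_tendsto_sandwich)
    have "t - (1/2) ^ j \<le> u j" for j
    proof -
      have "t \<le> (real (n j) + 1) / 2 ^ j" using n(2)[of j] by (simp add: le_divide_eq less_imp_le)
      then show ?thesis by (simp add: u_def power_one_over add_divide_distrib)
    qed
    moreover have "u j \<le> t" for j using n(1)[of j] by (simp add: u_def divide_le_eq)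
    ultimately show "\<forall>\<^sub>F j in sequentially. t - (1/2) ^ j \<le> u j" "\<forall>\<^sub>F j in sequentially. u j \<le> t"
      by auto
    have "(\<lambda>j. t - (1/2) ^ j) \<longlonglongrightarrow> t - 0" by (intro tendsto_intros LIMSEQ_power_zero) auto
    then show "(\<lambda>j. t - (1/2) ^ j) \<longlonglongrightarrow> t" by simp
  qed simp
  moreover have "u j \<in> {0..1}" for j
    using n_lt[of j] by (auto simp: u_def)
  ultimately have "(\<lambda>j. f (u j)) \<longlonglongrightarrow> f t"
    by (intro continuous_on_tendsto_compose[OF cont]) (use t in auto)
  then have "(\<lambda>j. \<bar>f (u j) - f 0\<bar>) \<longlonglongrightarrow> \<bar>f t - f 0\<bar>" by (intro tendsto_intros)
  then show ?thesis by (rule LIMSEQ_le_const2) (use bound in auto)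
qed

context fractional_brownian_motion
begin

text \<open>Markov's inequality for the \<open>2 * p\<close>-th power. The free order
  \<open>p\<close> replaces Gaussian tails, since polynomial decay of a high degree is
  enough.\<close>

lemma incr_tail_bound:
  assumes "0 \<le> s" "0 \<le> t" "0 < \<tau>"
  shows "prob {\<omega> \<in> space M. \<tau> \<le> \<bar>incr s t \<omega>\<bar>}
    \<le> fact (2 * p) / (2 ^ p * fact p) * (\<bar>t - s\<bar> powr H / \<tau>) ^ (2 * p)"
proof -
  note [measurable] = incr_measurable[OF assms(1,2)]
  have g: "centered_gaussian_rv M (incr s t)"
    using incr_gaussian[of "{()}" "\<lambda>_. s" "\<lambda>_. t" "\<lambda>_. 1"] assms by simp
  have v: "expectation (\<lambda>\<omega>. (incr s t \<omega>)\<^sup>2) = (\<bar>t - s\<bar> powr H)\<^sup>2"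
    using incr_covariance[of s t s t] assms by (simp add: power2_eq_square[of "incr s t _"] incr_cov_self)
  have "prob {\<omega> \<in> space M. \<tau> \<le> \<bar>incr s t \<omega>\<bar>} \<le> prob {\<omega> \<in> space M. \<tau> ^ (2 * p) \<le> incr s t \<omega> ^ (2 * p)}"
  proof (rule finite_measure_mono)
    show "{\<omega> \<in> space M. \<tau> \<le> \<bar>incr s t \<omega>\<bar>} \<subseteq> {\<omega> \<in> space M. \<tau> ^ (2 * p) \<le> incr s t \<omega> ^ (2 * p)}"
      using assms(3) power_mono[of \<tau> "\<bar>incr s t _\<bar>" "2 * p"] by (auto simp: power_even_abs)
  qed measurable
  also have "\<dots> \<le> expectation (\<lambda>\<omega>. incr s t \<omega> ^ (2 * p)) / \<tau> ^ (2 * p)"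
    using assms centered_gaussian_even_moment(1)[OF g, of p]
    by (intro integral_Markov_inequality_measure[of _ _ "space M"]) (auto simp: zero_le_even_power)
  also have "\<dots> = fact (2 * p) / (2 ^ p * fact p) * (\<bar>t - s\<bar> powr H / \<tau>) ^ (2 * p)"
    unfolding centered_gaussian_even_moment(2)[OF g] v by (simp add: power_divide power_mult)
  finally show ?thesis .
qed

text \<open>The constant is \<open>1 / (1 - r)\<close> and is deterministic; this permits its use
  later in thresholds whose visits are counted in expectation.\<close>

lemma unit_oscillation:
  assumes cont: "\<forall>\<omega>\<in>space M. continuous_on {0..} (\<lambda>t. B t \<omega>)" and \<epsilon>: "0 < \<epsilon>"
  shows "\<exists>C>0. AE \<omega> in M. \<forall>\<^sub>F k::nat in sequentially. \<forall>t. real k \<le> t \<and> t \<le> real k + 1 \<longrightarrow>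
    \<bar>B t \<omega> - B (real k) \<omega>\<bar> \<le> C * (real k + 1) powr \<epsilon>"
proof -
  \<comment> \<open>The order is chosen so that \<open>H * p \<ge> 2\<close>, giving
    \<open>4 ^ (- j)\<close> per dyadic step against \<open>2 ^ j\<close> steps, and
    \<open>\<epsilon> * p \<ge> 1\<close>, giving the summable factor
    \<open>1 / (k + 1)\<^sup>2\<close>.\<close>
  obtain p0 :: nat where p0: "2 / H + 1 / \<epsilon> \<le> real p0" using real_arch_simple by blast
  define p where "p = p0"
  have "0 \<le> 2 / H" "0 \<le> 1 / \<epsilon>" using \<epsilon> H_pos by auto
  with p0 have "2 / H \<le> real p" "1 / \<epsilon> \<le> real p" unfolding p_def by linarith+
  then have p: "2 \<le> H * real p" "1 \<le> \<epsilon> * real p" using \<epsilon> H_pos by (simp_all add: field_simps)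
  define c where "c = fact (2 * p) / (2 ^ p * fact p :: real)"
  have c: "0 < c" by (simp add: c_def)
  \<comment> \<open>Half of the exponent \<open>H\<close> goes into the geometric decay of the
    allowed steps; the other half remains for the probability bound.\<close>
  define r where "r = (1/2 :: real) powr (H / 2)"
  have r: "0 < r" "r < 1" using H_pos powr_less_mono'[of "1/2" 0 "H / 2"] by (auto simp: r_def)
  have rj: "r ^ j = (1 / 2 ^ j) powr (H / 2)" for j
    by (simp add: r_def powr_power power_one_over powr_realpow[symmetric] powr_powr powr_divide mult.commute)
  define D where "D k j = (\<Union>i<2^j. {\<omega> \<in> space M. (real k + 1) powr \<epsilon> * r ^ j \<le> \<bar>incr (real k + real i / 2 ^ j) (real k + (real i + 1) / 2 ^ j) \<omega>\<bar>})" for k j :: nat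
  have meas: "{\<omega> \<in> space M. l \<le> \<bar>incr (real k + real i / 2 ^ j) (real k + (real i + 1) / 2 ^ j) \<omega>\<bar>} \<in> sets M" for l k i j
    using incr_measurable[of "real k + real i / 2 ^ j" "real k + (real i + 1) / 2 ^ j"] by simp
  have [measurable]: "D k j \<in> sets M" for k j unfolding D_def using meas by auto
  have D_prob: "prob (D k j) \<le> c * (1 / (real k + 1)\<^sup>2) * (1/2) ^ j" for k j
  proof -
    have "prob (D k j) \<le> (\<Sum>i<2^j. prob {\<omega> \<in> space M. (real k + 1) powr \<epsilon> * r ^ j \<le> \<bar>incr (real k + real i / 2 ^ j) (real k + (real i + 1) / 2 ^ j) \<omega>\<bar>})"
      unfolding D_def using meas by (intro finite_measure_subadditive_finite) auto
    also have "\<dots> \<le> (\<Sum>i<(2::nat)^j. c * (1 / (real k + 1)\<^sup>2) * (1 / 4) ^ j)"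
    proof (intro sum_mono)
      fix i :: nat
      let ?x = "1 / 2 ^ j :: real"
      have x: "0 < ?x" "?x \<le> 1" by simp_all
      have "prob {\<omega> \<in> space M. (real k + 1) powr \<epsilon> * r ^ j \<le> \<bar>incr (real k + real i / 2 ^ j) (real k + (real i + 1) / 2 ^ j) \<omega>\<bar>}
        \<le> c * (\<bar>(real k + (real i + 1) / 2 ^ j) - (real k + real i / 2 ^ j)\<bar> powr H / ((real k + 1) powr \<epsilon> * r ^ j)) ^ (2 * p)"
        unfolding c_def using r by (intro incr_tail_bound) (auto intro!: mult_pos_pos)
      also have "\<bar>(real k + (real i + 1) / 2 ^ j) - (real k + real i / 2 ^ j)\<bar> = ?x" by (simp add: field_simps)
      also have "?x powr H / ((real k + 1) powr \<epsilon> * r ^ j) = ?x powr (H / 2) * (real k + 1) powr (- \<epsilon>)"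
        unfolding rj using x powr_add[of ?x "H / 2" "H / 2"] by (simp add: powr_minus field_simps)
      also have "(?x powr (H / 2) * (real k + 1) powr (- \<epsilon>)) ^ (2 * p) = ?x powr (H * p) * (real k + 1) powr (- (2 * (\<epsilon> * p)))"
        by (simp add: power_mult_distrib powr_power mult_ac)
      also have "\<dots> \<le> ?x powr 2 * (real k + 1) powr (- 2)"
        using p x by (intro mult_mono powr_mono' powr_mono) auto
      also have "?x powr 2 = (1 / 4) ^ j"
        by (simp add: power_one_over power2_eq_square power_mult_distrib[symmetric] power_divide)
      also have "(real k + 1) powr (- 2) = 1 / (real k + 1)\<^sup>2"
        by (simp add: powr_minus_divide)
      finally show "prob {\<omega> \<in> space M. (real k + 1) powr \<epsilon> * r ^ j \<le> \<bar>incr (real k + real i / 2 ^ j) (real k + (real i + 1) / 2 ^ j) \<omega>\<bar>}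
        \<le> c * (1 / (real k + 1)\<^sup>2) * (1 / 4) ^ j"
        using c by (simp add: mult_ac mult_left_mono)
    qed
    also have "\<dots> = c * (1 / (real k + 1)\<^sup>2) * (2 ^ j * (1 / 4) ^ j)" by simp
    also have "(2::real) ^ j * (1 / 4) ^ j = (1/2) ^ j" by (simp flip: power_mult_distrib)
    finally show ?thesis .
  qed
  define A where "A k = (\<Union>j. D k j)" for k
  have [measurable]: "A k \<in> sets M" for k unfolding A_def by auto
  have A_prob: "prob (A k) \<le> 2 * c * (1 / (real k + 1)\<^sup>2)" for k
  proof -
    have s: "summable (\<lambda>j. c * (1 / (real k + 1)\<^sup>2) * (1/2) ^ j)"
      by (intro summable_mult summable_geometric) auto
    have sD: "summable (\<lambda>j. prob (D k j))"
      by (rule summable_comparison_test[OF _ s]) (use D_prob[of k] in simp)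
    have "prob (A k) \<le> (\<Sum>j. prob (D k j))"
      unfolding A_def by (intro finite_measure_subadditive_countably sD) auto
    also have "\<dots> \<le> (\<Sum>j. c * (1 / (real k + 1)\<^sup>2) * (1/2) ^ j)"
      by (intro suminf_le D_prob sD s)
    also have "\<dots> = c * (1 / (real k + 1)\<^sup>2) * (\<Sum>j. (1/2) ^ j)"
      by (intro suminf_mult summable_geometric) auto
    finally show ?thesis using suminf_geometric[of "1/2 :: real"] by (simp add: mult_ac)
  qed
  have "summable (\<lambda>k. prob (A k))"
  proof (rule summable_comparison_test)
    have "summable (\<lambda>k. inverse (real (Suc k) ^ 2))"
      using inverse_power_summable[of 2, where 'a = real] by (subst summable_Suc_iff) auto
    then show "summable (\<lambda>k. 2 * c * (1 / (real k + 1)\<^sup>2))"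
      by (intro summable_mult) (simp add: inverse_eq_divide add.commute)
  qed (use A_prob in auto)
  then have "AE \<omega> in M. \<forall>\<^sub>F k in sequentially. \<omega> \<in> space M - A k"
    by (intro borel_cantelli_AE1) (auto simp: less_top[symmetric])
  then have "AE \<omega> in M. \<forall>\<^sub>F k::nat in sequentially. \<forall>t. real k \<le> t \<and> t \<le> real k + 1 \<longrightarrow>
    \<bar>B t \<omega> - B (real k) \<omega>\<bar> \<le> 1 / (1 - r) * (real k + 1) powr \<epsilon>"
    using AE_space
  proof eventually_elim
    case (elim \<omega>)
    note \<omega> = this(2)
    from elim(1) show ?case
    proof eventually_elim
      case (elim k)
      have s: "\<bar>B (real k + (real i + 1) / 2 ^ j) \<omega> - B (real k + real i / 2 ^ j) \<omega>\<bar> \<le> (real k + 1) powr \<epsilon> * r ^ j"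
        if "i < 2 ^ j" for i j :: nat
        using elim that by (auto simp: A_def D_def incr_def not_le intro: less_imp_le)
      have "continuous_on {0..1} (\<lambda>t. B (real k + t) \<omega>)"
        by (rule continuous_on_compose2[OF cont[rule_format, OF \<omega>]]) (auto intro!: continuous_intros)
      from dyadic_chaining[OF this, of r "(real k + 1) powr \<epsilon>"] r s
      have ch: "\<bar>B (real k + t) \<omega> - B (real k + 0) \<omega>\<bar> \<le> (real k + 1) powr \<epsilon> / (1 - r)" if "0 \<le> t" "t \<le> 1" for t
        using that by auto
      show ?case
      proof (intro allI impI)
        fix t assume "real k \<le> t \<and> t \<le> real k + 1"
        then show "\<bar>B t \<omega> - B (real k) \<omega>\<bar> \<le> 1 / (1 - r) * (real k + 1) powr \<epsilon>"
          using ch[of "t - real k"] by simp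
      qed
    qed
  qed
  then show ?thesis using r by (intro exI[of _ "1 / (1 - r)"]) auto
qed

end

section \<open>The dimension of the level sets\<close>

lemma (in prob_space) AE_summable_of_geometric_expectation:
  fixes V :: "nat \<Rightarrow> 'a \<Rightarrow> real"
  assumes V: "\<And>n. integrable M (V n)" "\<And>n \<omega>. 0 \<le> V n \<omega>"
    and le: "\<And>n. expectation (V n) \<le> c * r ^ n" and r: "0 \<le> r" "r < 1"
  shows "AE \<omega> in M. (\<Sum>n. ennreal (V n \<omega>)) < \<top>"
proof -
  note [measurable] = borel_measurable_integrable[OF V(1)]
  have "0 \<le> expectation (V 0)" using V(2) by (intro Bochner_Integration.integral_nonneg) auto
  then have c: "0 \<le> c" using le[of 0] by simp
  have "(\<integral>\<^sup>+\<omega>. (\<Sum>n. ennreal (V n \<omega>)) \<partial>M) = (\<Sum>n. (\<integral>\<^sup>+\<omega>. ennreal (V n \<omega>) \<partial>M))"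
    by (rule nn_integral_suminf) measurable
  also have "\<dots> = (\<Sum>n. ennreal (expectation (V n)))"
    using V by (simp add: nn_integral_eq_integral)
  also have "\<dots> \<le> (\<Sum>n. ennreal (c * r ^ n))"
    using le by (intro suminf_le summableI ennreal_leI) auto
  also have "\<dots> = ennreal (\<Sum>n. c * r ^ n)"
    using c r by (intro suminf_ennreal2 summable_mult summable_geometric) auto
  also have "\<dots> < \<top>" by simp
  finally have "(\<integral>\<^sup>+\<omega>. (\<Sum>n. ennreal (V n \<omega>)) \<partial>M) \<noteq> \<infinity>" by simp
  then have "AE \<omega> in M. (\<Sum>n. ennreal (V n \<omega>)) \<noteq> \<infinity>"
    by (intro nn_integral_PInf_AE) measurable
  then show ?thesis by (simp add: less_top)
qed

section \<open>Convergence of the covering sums above the exponent \<open>1 - H\<close>\<close>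

context fractional_brownian_motion
begin

text \<open>Twice the tent of \<open>B k / (2 * R n)\<close> dominates the indicator that
  \<open>B k\<close> is at most \<open>R n\<close> in absolute value, so \<open>V n\<close>
  dominates the normalized number of unit intervals visited. Of the excess
  \<open>2 * \<epsilon>\<close> in \<rho>, one \<epsilon> pays for the radius and the other gives
  the geometric decay.\<close>

lemma expected_visits_le:
  fixes \<epsilon> \<rho> C :: real
  assumes \<epsilon>: "0 < \<epsilon>" "\<rho> = 1 - H + 2 * \<epsilon>" and C: "0 < C"
  defines "R \<equiv> \<lambda>n::nat. C * (2 ^ Suc n) powr \<epsilon>"
  defines "V \<equiv> \<lambda>n \<omega>. (2 ^ Suc n) powr (- \<rho>) * (\<Sum>k\<in>{2^n..<2^Suc n}. 2 * tent (incr 0 (real k) \<omega> / (2 * R n)))"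
  shows "expectation (V n) \<le> 4 * C * (2 powr (- \<epsilon>)) ^ n"
proof -
  have R: "0 < R n" using C by (simp add: R_def)
  note [measurable] = incr_measurable
  have int: "integrable M (\<lambda>\<omega>. tent (incr 0 (real k) \<omega> / (2 * R n)))" for k
    by (intro integrable_const_bound[where B = 1]) (auto simp: tent_nonneg tent_le_1)
  have "expectation (V n) = (2 ^ Suc n) powr (- \<rho>) * (\<Sum>k\<in>{2^n..<2^Suc n}. 2 * expectation (\<lambda>\<omega>. tent (incr 0 (real k) \<omega> / (2 * R n))))"
    unfolding V_def using int by simp
  also have "\<dots> \<le> (2 ^ Suc n) powr (- \<rho>) * (\<Sum>k\<in>{2^n..<2^Suc n::nat}. 2 * (2 * R n / (2 ^ n) powr H))"
  proof (intro mult_left_mono sum_mono)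
    fix k :: nat assume k: "k \<in> {2^n..<2^Suc n}"
    then have kn: "real (2 ^ n) \<le> real k" by (simp only: of_nat_le_iff) simp
    then have k0: "0 < real k" by (rule less_le_trans[rotated]) simp
    have "expectation (\<lambda>\<omega>. tent (1 / (2 * R n) * incr 0 (real k) \<omega> - 0)) \<le> 1 / (1 / (2 * R n) * \<bar>real k - 0\<bar> powr H)"
      using k0 R by (intro expectation_tent_le) auto
    then have "expectation (\<lambda>\<omega>. tent (incr 0 (real k) \<omega> / (2 * R n))) \<le> 2 * R n / real k powr H"
      by simp
    also have "\<dots> \<le> 2 * R n / (2 ^ n) powr H"
      using kn k0 R H_pos by (intro divide_left_mono powr_mono2) auto
    finally show "expectation (\<lambda>\<omega>. tent (incr 0 (real k) \<omega> / (2 * R n))) \<le> 2 * R n / (2 ^ n) powr H" .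
  qed auto
  also have "\<dots> = (2 ^ Suc n) powr (- \<rho>) * (2 ^ n * (2 * (2 * R n / (2 ^ n) powr H)))" by simp
  also have "\<dots> = 4 * C * (2 powr (- (real n + 1) * \<rho>) * 2 powr real n * 2 powr ((real n + 1) * \<epsilon>) * 2 powr (- (real n * H)))"
  proof -
    have 1: "((2::real) ^ Suc n) powr z = 2 powr ((real n + 1) * z)" "((2::real) ^ n) powr z = 2 powr (real n * z)" "(2::real) ^ n = 2 powr real n" for z
      by (simp_all add: powr_realpow[symmetric] powr_powr add.commute del: power_Suc)
    show ?thesis unfolding R_def 1 by (simp add: powr_minus powr_powr field_simps)
  qed
  also have "2 powr (- (real n + 1) * \<rho>) * 2 powr real n * 2 powr ((real n + 1) * \<epsilon>) * 2 powr (- (real n * H)) = 2 powr (- (real n + 1) * \<rho> + real n + (real n + 1) * \<epsilon> - real n * H)"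
    by (simp add: powr_add[symmetric])
  also have "- (real n + 1) * \<rho> + real n + (real n + 1) * \<epsilon> - real n * H = - (real n * \<epsilon>) - (1 - H) - \<epsilon>"
    unfolding \<epsilon>(2) by (simp add: algebra_simps)
  also have "4 * C * 2 powr \<dots> \<le> 4 * C * 2 powr (- (real n * \<epsilon>))"
    using \<epsilon>(1) C H_less_1 by (intro mult_left_mono powr_mono) auto
  also have "2 powr (- (real n * \<epsilon>)) = (2 powr (- \<epsilon>)) ^ n"
    by (simp add: powr_power mult.commute)
  finally show ?thesis .
qed

text \<open>The series of the \<open>V n\<close> does not involve \<open>x\<close>. The level
  affects only the index from which \<open>\<bar>x\<bar> \<le> (k + 1) powr \<epsilon>\<close>, so
  the starting index depends on \<open>x\<close> but the null set does not.\<close>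

lemma level_set_nu_sum_finite:
  assumes \<rho>: "1 - H < \<rho>"
    and cont: "\<forall>\<omega>\<in>space M. continuous_on {0..} (\<lambda>t. B t \<omega>)"
  shows "AE \<omega> in M. \<forall>x. \<exists>N. (\<Sum>k. nu (int (k + N)) \<rho> {t. t \<ge> 0 \<and> B t \<omega> = x}) < \<top>"
proof -
  define \<epsilon> where "\<epsilon> = (\<rho> - (1 - H)) / 2"
  have \<epsilon>: "0 < \<epsilon>" "\<rho> = 1 - H + 2 * \<epsilon>" using \<rho> by (auto simp: \<epsilon>_def field_simps)
  obtain C where C: "0 < C" and osc: "AE \<omega> in M. \<forall>\<^sub>F k::nat in sequentially. \<forall>t. real k \<le> t \<and> t \<le> real k + 1 \<longrightarrow>
    \<bar>B t \<omega> - B (real k) \<omega>\<bar> \<le> C * (real k + 1) powr \<epsilon>"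
    using unit_oscillation[OF cont \<epsilon>(1)] by blast
  \<comment> \<open>The summand \<open>C\<close> covers the oscillation over a unit interval, the
    summand 1 covers \<open>\<bar>x\<bar>\<close> at late times.\<close>
  define R where "R n = (C + 1) * (2 ^ Suc n) powr \<epsilon>" for n :: nat
  have R: "0 < R n" for n using C by (simp add: R_def)
  define V where "V n \<omega> = (2 ^ Suc n) powr (- \<rho>) * (\<Sum>k\<in>{2^n..<2^Suc n}. 2 * tent (incr 0 (real k) \<omega> / (2 * R n)))" for n \<omega>
  note [measurable] = incr_measurable
  have "AE \<omega> in M. (\<Sum>n. ennreal (V n \<omega>)) < \<top>"
  proof (rule AE_summable_of_geometric_expectation)
    show "integrable M (V n)" for n unfolding V_def
      by (intro integrable_mult_right Bochner_Integration.integrable_sum integrable_const_bound[where B = 1])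
         (auto simp: tent_nonneg tent_le_1)
    show "0 \<le> V n \<omega>" for n \<omega> unfolding V_def by (intro mult_nonneg_nonneg sum_nonneg) (auto simp: tent_nonneg)
    show "expectation (V n) \<le> 4 * (C + 1) * (2 powr (- \<epsilon>)) ^ n" for n
      unfolding V_def R_def using \<epsilon> C by (intro expected_visits_le) auto
    show "2 powr (- \<epsilon>) < 1" using powr_less_mono[of "- \<epsilon>" 0 2] \<epsilon> by simp
  qed simp
  then show ?thesis
    using osc AE_B_0
  proof eventually_elim
    case (elim \<omega>)
    show ?case
    proof
      fix x :: real
      let ?E = "{t. t \<ge> 0 \<and> B t \<omega> = x}"
      have "filterlim (\<lambda>k::nat. (real k + 1) powr \<epsilon>) at_top sequentially"
        using \<epsilon>(1) by real_asymp
      then have "\<forall>\<^sub>F k::nat in sequentially. \<bar>x\<bar> \<le> (real k + 1) powr \<epsilon>"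
        by (simp add: filterlim_at_top)
      with elim(2) have "\<forall>\<^sub>F k::nat in sequentially. \<forall>t. real k \<le> t \<and> t \<le> real k + 1 \<and> B t \<omega> = x \<longrightarrow>
          \<bar>B (real k) \<omega>\<bar> \<le> (C + 1) * (real k + 1) powr \<epsilon>"
      proof eventually_elim
        case (elim k)
        show ?case
        proof (intro allI impI)
          fix t assume t: "real k \<le> t \<and> t \<le> real k + 1 \<and> B t \<omega> = x"
          with elim(1) have "\<bar>x - B (real k) \<omega>\<bar> \<le> C * (real k + 1) powr \<epsilon>" by blast
          with elim(2) have "\<bar>B (real k) \<omega>\<bar> \<le> C * (real k + 1) powr \<epsilon> + (real k + 1) powr \<epsilon>" by linarith
          then show "\<bar>B (real k) \<omega>\<bar> \<le> (C + 1) * (real k + 1) powr \<epsilon>" by (simp add: algebra_simps)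
        qed
      qed
      then obtain k0 where k0: "\<And>k t. k0 \<le> k \<Longrightarrow> real k \<le> t \<Longrightarrow> t \<le> real k + 1 \<Longrightarrow> B t \<omega> = x \<Longrightarrow>
          \<bar>B (real k) \<omega>\<bar> \<le> (C + 1) * (real k + 1) powr \<epsilon>"
        by (auto simp: eventually_sequentially)
      have nu_le: "nu (int (Suc n)) \<rho> ?E \<le> ennreal (V n \<omega>)" if n: "k0 \<le> n" for n
      proof -
        define K where "K = {k \<in> {2^n..<2^Suc n}. \<exists>t. real k \<le> t \<and> t \<le> real k + 1 \<and> B t \<omega> = x}"
        have finK: "finite K" by (simp add: K_def)
        have "nu (int (Suc n)) \<rho> ?E \<le> ennreal (real (card K) * (2 powr real_of_int (int (Suc n))) powr (- \<rho>))"
        proof (rule nu_le_card[OF _ finK])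
          show "0 \<le> \<rho>" using \<rho> H_less_1 by linarith
          fix k assume "k \<in> K"
          then have "2 ^ n \<le> k" "k + 1 \<le> 2 ^ Suc n" by (auto simp: K_def)
          then have "real (2 ^ n) \<le> real k" "real (k + 1) \<le> real (2 ^ Suc n)" by (simp_all only: of_nat_le_iff)
          then show "{real k..real k + 1} \<subseteq> closure (shell (int (Suc n)))"
            unfolding closure_shell by simp
        next
          show "?E \<inter> shell (int (Suc n)) \<subseteq> (\<Union>k\<in>K. {real k..real k + 1})"
          proof
            fix t assume t: "t \<in> ?E \<inter> shell (int (Suc n))"
            then have t': "2 ^ n \<le> t" "t < 2 ^ Suc n" "B t \<omega> = x" "0 \<le> t" unfolding shell_eq by auto
            define k where "k = nat \<lfloor>t\<rfloor>"
            have k: "real k \<le> t" "t < real k + 1" using t'(4) by (simp_all add: k_def of_nat_nat)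
            have "real (2 ^ n) < real (k + 1)" "real k < real (2 ^ Suc n)" using k t' by simp_all
            then have "2 ^ n \<le> k" "k < 2 ^ Suc n" by (simp_all only: of_nat_less_iff)
            then have "k \<in> K" using k t' by (auto simp: K_def intro!: exI[of _ t])
            then show "t \<in> (\<Union>k\<in>K. {real k..real k + 1})" using k by (intro UN_I[of k]) auto
          qed
        qed
        also have "\<dots> \<le> ennreal (V n \<omega>)"
        proof (rule ennreal_leI)
          have "real (card K) = (\<Sum>k\<in>K. 1)" by simp
          also have "\<dots> \<le> (\<Sum>k\<in>K. 2 * tent (incr 0 (real k) \<omega> / (2 * R n)))"
          proof (rule sum_mono)
            fix k assume k: "k \<in> K"
            then have k': "2 ^ n \<le> k" "k + 1 \<le> 2 ^ Suc n" by (auto simp: K_def)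
            have "n < 2 ^ n" by (rule less_exp)
            with k' n have "k0 \<le> k" by linarith
            with k k0 have "\<bar>B (real k) \<omega>\<bar> \<le> (C + 1) * (real k + 1) powr \<epsilon>" by (auto simp: K_def)
            also have "\<dots> \<le> R n"
            proof -
              have "real (k + 1) \<le> real (2 ^ Suc n)" using k'(2) by (simp only: of_nat_le_iff)
              then show ?thesis unfolding R_def using C \<epsilon>
                by (intro mult_left_mono powr_mono2) auto
            qed
            finally have "\<bar>incr 0 (real k) \<omega>\<bar> \<le> R n" using elim(3) by (simp add: incr_def)
            then have "\<bar>incr 0 (real k) \<omega> / (2 * R n)\<bar> \<le> 1 / 2" using R[of n] by (simp add: abs_divide field_simps)
            then show "1 \<le> 2 * tent (incr 0 (real k) \<omega> / (2 * R n))" by (simp add: tent_def)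
          qed
          also have "\<dots> \<le> (\<Sum>k\<in>{2^n..<2^Suc n}. 2 * tent (incr 0 (real k) \<omega> / (2 * R n)))"
            by (intro sum_mono2) (auto simp: K_def tent_nonneg)
          finally show "real (card K) * (2 powr real_of_int (int (Suc n))) powr (- \<rho>) \<le> V n \<omega>"
            unfolding V_def by (simp add: powr_realpow[symmetric] powr_add mult.commute mult_left_mono)
        qed
        finally show ?thesis .
      qed
      have "(\<Sum>k. nu (int (k + Suc k0)) \<rho> ?E) \<le> (\<Sum>k. ennreal (V (k + k0) \<omega>))"
        using nu_le[of "_ + k0"] by (intro suminf_le summableI) (simp add: add_ac)
      also have "\<dots> \<le> (\<Sum>k. ennreal (V k \<omega>))"
        using suminf_offset[of "\<lambda>k. ennreal (V k \<omega>)" k0] by (simp add: summableI)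
      also have "\<dots> < \<top>" by (rule elim(1))
      finally show "\<exists>N. (\<Sum>k. nu (int (k + N)) \<rho> ?E) < \<top>" by blast
    qed
  qed
qed

text \<open>Almost sure statements are combined only for the countably many exponents
  \<open>1 - H + \<delta> m\<close> and \<open>1 - H - \<delta> m\<close>. Monotonicity of
  \<open>nu\<close> in the exponent then excludes every smaller exponent; nonpositive values of
  \<open>1 - H - \<delta> m\<close> are harmless because candidates are positive.\<close>

lemma macro_dimH_level_sets:
  assumes cont: "\<forall>\<omega>\<in>space M. continuous_on {0..} (\<lambda>t. B t \<omega>)"
  shows "AE \<omega> in M. \<forall>x. macro_dimH {t. t \<ge> 0 \<and> B t \<omega> = x} = 1 - H"
proof -
  define \<delta> where "\<delta> m = 1 / real (Suc m)" for m
  have \<delta>: "0 < \<delta> m" for m by (simp add: \<delta>_def)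
  have \<delta>0: "\<exists>m. \<delta> m < e" if "0 < e" for e
    using reals_Archimedean[OF that] by (auto simp: \<delta>_def inverse_eq_divide)
  let ?fin = "\<lambda>\<rho> E. \<exists>N. (\<Sum>k. nu (int (k + N)) \<rho> E) < \<top>"
  have "AE \<omega> in M. \<forall>m x. ?fin (1 - H + \<delta> m) {t. t \<ge> 0 \<and> B t \<omega> = x}"
    unfolding AE_all_countable using \<delta> by (intro allI level_set_nu_sum_finite cont) auto
  moreover have "AE \<omega> in M. \<forall>m x. 0 < 1 - H - \<delta> m \<longrightarrow> \<not> ?fin (1 - H - \<delta> m) {t. t \<ge> 0 \<and> B t \<omega> = x}"
    unfolding AE_all_countable
  proof
    fix m
    show "AE \<omega> in M. \<forall>x. 0 < 1 - H - \<delta> m \<longrightarrow> \<not> ?fin (1 - H - \<delta> m) {t. t \<ge> 0 \<and> B t \<omega> = x}"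
    proof (cases "0 < 1 - H - \<delta> m")
      case True
      then show ?thesis using level_set_nu_sum_infinite[OF True _ cont] \<delta>[of m] by simp
    qed simp
  qed
  ultimately show ?thesis
  proof eventually_elim
    case (elim \<omega>)
    show ?case
    proof
      fix x
      let ?E = "{t. t \<ge> 0 \<and> B t \<omega> = x}"
      define S where "S = {\<rho>. \<rho> > 0 \<and> ?fin \<rho> ?E}"
      have upper: "1 - H + \<delta> m \<in> S" for m
        using elim(1) H_less_1 \<delta>[of m] by (auto simp: S_def)
      have lower: "1 - H - \<delta> m \<le> \<rho>" if \<rho>: "\<rho> \<in> S" for \<rho> m
      proof (rule ccontr)
        assume "\<not> 1 - H - \<delta> m \<le> \<rho>"
        then have le: "\<rho> \<le> 1 - H - \<delta> m" by simp
        from \<rho> obtain N where N: "0 < \<rho>" "(\<Sum>k. nu (int (k + N)) \<rho> ?E) < \<top>" by (auto simp: S_def)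
        have "(\<Sum>k. nu (int (k + N)) (1 - H - \<delta> m) ?E) \<le> (\<Sum>k. nu (int (k + N)) \<rho> ?E)"
          by (intro suminf_le summableI nu_antimono_exponent le)
        with N(2) have "?fin (1 - H - \<delta> m) ?E" by (intro exI[of _ N]) (rule le_less_trans)
        moreover have "0 < 1 - H - \<delta> m" using N(1) le by linarith
        ultimately show False using elim(2) by blast
      qed
      have "Inf S = 1 - H"
      proof (rule antisym)
        show "Inf S \<le> 1 - H"
        proof (rule field_le_epsilon)
          fix e :: real assume "0 < e"
          then obtain m where m: "\<delta> m < e" using \<delta>0 by blast
          have "Inf S \<le> 1 - H + \<delta> m"
            by (rule cInf_lower[OF upper]) (auto intro!: bdd_belowI[of _ 0] simp: S_def)
          with m show "Inf S \<le> 1 - H + e" by linarith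
        qed
        show "1 - H \<le> Inf S"
        proof (rule cInf_greatest)
          show "S \<noteq> {}" using upper by blast
          fix \<rho> assume \<rho>: "\<rho> \<in> S"
          show "1 - H \<le> \<rho>"
          proof (rule field_le_epsilon)
            fix e :: real assume "0 < e"
            then obtain m where "\<delta> m < e" using \<delta>0 by blast
            with lower[OF \<rho>, of m] show "1 - H \<le> \<rho> + e" by linarith
          qed
        qed
      qed
      then show "macro_dimH ?E = 1 - H" by (simp add: macro_dimH_def S_def)
    qed
  qed
qed

end

theorem theorem2:
  fixes M :: "'a measure" and H :: real and B :: "real \<Rightarrow> 'a \<Rightarrow> real"
  assumes "0 < H" "H < 1"
    and "fbm M H B"
    and "\<forall>\<omega>\<in>space M. continuous_on {0..} (\<lambda>t. B t \<omega>)"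
  shows "AE \<omega> in M. \<forall>x::real. macro_dimH {t. t \<ge> 0 \<and> B t \<omega> = x} = 1 - H"
proof -
  interpret fractional_brownian_motion M H B
    using assms(1-3) by unfold_locales
  show ?thesis by (rule macro_dimH_level_sets[OF assms(4)])
qed

end
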